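(* Let $p,q$ be polynomials in one variable over $\mathbb{C}$ such that $p(0)=q(0)=0$ and such that $1-p(x)$ and $1-q(y)$ have simple roots only. Let $S$ be the hypersurface in $\mathbb{C}^3_{x,y,z}$ given by the equation $p(x)+q(y)+xyz=1$, equipped with the algebraic volume form $\omega$ that is the regular extension to $S$ of the form $\frac{\mathrm{d}x\wedge\mathrm{d}y}{xy}$ on the torus $\{xy\neq0\}\simeq\mathbb{C}^*_x\times\mathbb{C}^*_y\subset S$. Then $S$ has the algebraic volume density property with respect to $\omega$, i.e. $\mathrm{Lie}_{\mathrm{alg}}^\omega(S)=\mathrm{AVF}_\omega(S)$.
   Context: A vector field $\xi$ has $\omega$-divergence zero if $L_\xi\omega=0$. An algebraic vector field is complete if it generates a holomorphic action of $(\mathbb{C},+)$ (its flow is defined for all complex times). $\mathrm{AVF}_\omega(S)$ is the space of all algebraic vector fields on $S$ of $\omega$-divergence zero, and $\mathrm{Lie}_{\mathrm{alg}}^\omega(S)$ is the Lie algebra generated by complete algebraic vector fields of $\omega$-divergence zero. *)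

theory Defs
  imports "HOL-Analysis.Analysis" "HOL-Computational_Algebra.Polynomial"
begin

section \<open>Regular functions on an algebraic subset of \<open>\<complex>\<^sup>n\<close>\<close>

inductive complex_polynomial_function :: "(complex ^ 'n \<Rightarrow> complex) \<Rightarrow> bool" where
  const: "complex_polynomial_function (\<lambda>_. c)"
| coord: "complex_polynomial_function (\<lambda>v. v $ i)"
| add: "complex_polynomial_function f \<Longrightarrow> complex_polynomial_function g
          \<Longrightarrow> complex_polynomial_function (\<lambda>v. f v + g v)"
| mult: "complex_polynomial_function f \<Longrightarrow> complex_polynomial_function g
          \<Longrightarrow> complex_polynomial_function (\<lambda>v. f v * g v)"

definition restrict0 :: "(complex ^ 'n) set \<Rightarrow> (complex ^ 'n \<Rightarrow> complex) \<Rightarrow> complex ^ 'n \<Rightarrow> complex"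
  where "restrict0 S f = (\<lambda>s. if s \<in> S then f s else 0)"

text \<open>The coordinate ring \<open>\<complex>[S]\<close>. Functions on \<open>S\<close> are represented by their extension by zero
  to \<open>\<complex>\<^sup>n\<close>, so that equality of functions on \<open>S\<close> is equality in HOL.\<close>

definition regular_functions :: "(complex ^ 'n) set \<Rightarrow> (complex ^ 'n \<Rightarrow> complex) set"
  where "regular_functions S = {restrict0 S f | f. complex_polynomial_function f}"

abbreviation coordinate :: "(complex ^ 'n) set \<Rightarrow> 'n \<Rightarrow> complex ^ 'n \<Rightarrow> complex"
  where "coordinate S i \<equiv> restrict0 S (\<lambda>s. s $ i)"

section \<open>Algebraic vector fields\<close>

text \<open>The algebraic vector fields on an affine variety \<open>S\<close> are the \<open>\<complex>\<close>-linear derivations of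
  \<open>\<complex>[S]\<close>. Arguments outside \<open>\<complex>[S]\<close> are mapped to zero, again to make equality extensional.\<close>

type_synonym 'n vfield = "(complex ^ 'n \<Rightarrow> complex) \<Rightarrow> (complex ^ 'n \<Rightarrow> complex)"

definition alg_vector_fields :: "(complex ^ 'n) set \<Rightarrow> 'n vfield set"
  where "alg_vector_fields S = {\<xi>.
    (\<forall>f\<in>regular_functions S. \<xi> f \<in> regular_functions S) \<and>
    (\<forall>f. f \<notin> regular_functions S \<longrightarrow> \<xi> f = (\<lambda>_. 0)) \<and>
    (\<forall>f\<in>regular_functions S. \<forall>g\<in>regular_functions S.
        \<xi> (\<lambda>s. f s + g s) = (\<lambda>s. \<xi> f s + \<xi> g s)) \<and>
    (\<forall>c. \<forall>f\<in>regular_functions S. \<xi> (\<lambda>s. c * f s) = (\<lambda>s. c * \<xi> f s)) \<and>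
    (\<forall>f\<in>regular_functions S. \<forall>g\<in>regular_functions S.
        \<xi> (\<lambda>s. f s * g s) = (\<lambda>s. \<xi> f s * g s + f s * \<xi> g s))}"

definition vf_zero :: "'n::finite vfield"
  where "vf_zero = (\<lambda>f s. 0)"

definition vf_add :: "'n::finite vfield \<Rightarrow> 'n vfield \<Rightarrow> 'n vfield"
  where "vf_add \<xi> \<eta> = (\<lambda>f s. \<xi> f s + \<eta> f s)"

definition vf_scale :: "complex \<Rightarrow> 'n::finite vfield \<Rightarrow> 'n vfield"
  where "vf_scale c \<xi> = (\<lambda>f s. c * \<xi> f s)"

definition vf_mult :: "(complex ^ 'n \<Rightarrow> complex) \<Rightarrow> 'n::finite vfield \<Rightarrow> 'n vfield"
  where "vf_mult h \<xi> = (\<lambda>f s. h s * \<xi> f s)"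

definition lie_bracket :: "'n::finite vfield \<Rightarrow> 'n vfield \<Rightarrow> 'n vfield"
  where "lie_bracket \<xi> \<eta> = (\<lambda>f s. \<xi> (\<eta> f) s - \<eta> (\<xi> f) s)"

inductive_set lie_algebra_generated :: "'n::finite vfield set \<Rightarrow> 'n vfield set"
  for A :: "'n vfield set" where
  incl: "\<xi> \<in> A \<Longrightarrow> \<xi> \<in> lie_algebra_generated A"
| zero: "vf_zero \<in> lie_algebra_generated A"
| add: "\<xi> \<in> lie_algebra_generated A \<Longrightarrow> \<eta> \<in> lie_algebra_generated A
          \<Longrightarrow> vf_add \<xi> \<eta> \<in> lie_algebra_generated A"
| scale: "\<xi> \<in> lie_algebra_generated A \<Longrightarrow> vf_scale c \<xi> \<in> lie_algebra_generated A"
| bracket: "\<xi> \<in> lie_algebra_generated A \<Longrightarrow> \<eta> \<in> lie_algebra_generated A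
          \<Longrightarrow> lie_bracket \<xi> \<eta> \<in> lie_algebra_generated A"

section \<open>Complete vector fields\<close>

text \<open>Holomorphy in several variables on an open set: Frechet differentiability with
  \<open>\<complex>\<close>-linear derivative.\<close>

definition holomorphic_map_on ::
  "(complex \<times> (complex ^ 'n) \<Rightarrow> complex ^ 'n) \<Rightarrow> (complex \<times> (complex ^ 'n)) set \<Rightarrow> bool"
  where "holomorphic_map_on F W \<longleftrightarrow>
    (\<forall>w\<in>W. \<exists>F'. (F has_derivative F') (at w) \<and>
       (\<forall>c t v. F' (c * t, c *s v) = c *s F' (t, v)))"

text \<open>A map on \<open>\<complex> \<times> S\<close> is holomorphic if it is locally the restriction of a holomorphic map
  on an open subset of \<open>\<complex> \<times> \<complex>\<^sup>n\<close>.\<close>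

definition holomorphic_action ::
  "(complex ^ 'n) set \<Rightarrow> (complex \<Rightarrow> complex ^ 'n \<Rightarrow> complex ^ 'n) \<Rightarrow> bool"
  where "holomorphic_action S \<phi> \<longleftrightarrow>
    (\<forall>t. \<forall>s\<in>S. \<phi> t s \<in> S) \<and>
    (\<forall>s\<in>S. \<phi> 0 s = s) \<and>
    (\<forall>t u. \<forall>s\<in>S. \<phi> (t + u) s = \<phi> t (\<phi> u s)) \<and>
    (\<forall>t. \<forall>s\<in>S. \<exists>W F. open W \<and> (t, s) \<in> W \<and> holomorphic_map_on F W \<and>
        (\<forall>u. \<forall>r\<in>S. (u, r) \<in> W \<longrightarrow> F (u, r) = \<phi> u r))"

definition complete_vf :: "(complex ^ 'n) set \<Rightarrow> 'n::finite vfield \<Rightarrow> bool"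
  where "complete_vf S \<xi> \<longleftrightarrow> (\<exists>\<phi>. holomorphic_action S \<phi> \<and>
    (\<forall>f\<in>regular_functions S. \<forall>s\<in>S.
       ((\<lambda>t. f (\<phi> t s)) has_field_derivative \<xi> f s) (at 0)))"

section \<open>Two-forms, Lie derivative and volume density property\<close>

text \<open>On a smooth affine variety \<open>S\<close> the regular two-forms are the alternating
  \<open>\<complex>[S]\<close>-bilinear maps from vector fields to \<open>\<complex>[S]\<close>. Values at arguments that are not
  algebraic vector fields are irrelevant. Linearity in the second argument follows from
  antisymmetry.\<close>

type_synonym 'n two_form = "'n vfield \<Rightarrow> 'n vfield \<Rightarrow> complex ^ 'n \<Rightarrow> complex"

definition alg_two_form :: "(complex ^ 'n) set \<Rightarrow> 'n::finite two_form \<Rightarrow> bool"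
  where "alg_two_form S \<omega> \<longleftrightarrow>
    (\<forall>\<eta>\<in>alg_vector_fields S. \<forall>\<theta>\<in>alg_vector_fields S.
        \<omega> \<eta> \<theta> \<in> regular_functions S \<and>
        \<omega> \<eta> \<theta> = (\<lambda>s. - \<omega> \<theta> \<eta> s) \<and>
        (\<forall>\<zeta>\<in>alg_vector_fields S. \<omega> (vf_add \<eta> \<zeta>) \<theta> = (\<lambda>s. \<omega> \<eta> \<theta> s + \<omega> \<zeta> \<theta> s)) \<and>
        (\<forall>h\<in>regular_functions S. \<omega> (vf_mult h \<eta>) \<theta> = (\<lambda>s. h s * \<omega> \<eta> \<theta> s)))"

text \<open>A volume form on a smooth affine surface is a nowhere vanishing two-form. Algebraic vector
  fields span every tangent space of a smooth affine variety, so it is enough to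
  evaluate on them.\<close>

definition alg_volume_form :: "(complex ^ 'n) set \<Rightarrow> 'n::finite two_form \<Rightarrow> bool"
  where "alg_volume_form S \<omega> \<longleftrightarrow> alg_two_form S \<omega> \<and>
    (\<forall>s\<in>S. \<exists>\<eta>\<in>alg_vector_fields S. \<exists>\<theta>\<in>alg_vector_fields S. \<omega> \<eta> \<theta> s \<noteq> 0)"

definition lie_derivative :: "'n::finite vfield \<Rightarrow> 'n two_form \<Rightarrow> 'n two_form"
  where "lie_derivative \<xi> \<omega> =
    (\<lambda>\<eta> \<theta> s. \<xi> (\<omega> \<eta> \<theta>) s - \<omega> (lie_bracket \<xi> \<eta>) \<theta> s - \<omega> \<eta> (lie_bracket \<xi> \<theta>) s)"

definition divergence_zero :: "(complex ^ 'n) set \<Rightarrow> 'n::finite two_form \<Rightarrow> 'n vfield \<Rightarrow> bool"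
  where "divergence_zero S \<omega> \<xi> \<longleftrightarrow>
    (\<forall>\<eta>\<in>alg_vector_fields S. \<forall>\<theta>\<in>alg_vector_fields S. \<forall>s\<in>S. lie_derivative \<xi> \<omega> \<eta> \<theta> s = 0)"

definition AVF :: "(complex ^ 'n) set \<Rightarrow> 'n::finite two_form \<Rightarrow> 'n vfield set"
  where "AVF S \<omega> = {\<xi> \<in> alg_vector_fields S. divergence_zero S \<omega> \<xi>}"

definition Lie_alg :: "(complex ^ 'n) set \<Rightarrow> 'n::finite two_form \<Rightarrow> 'n vfield set"
  where "Lie_alg S \<omega> = lie_algebra_generated
    {\<xi> \<in> alg_vector_fields S. complete_vf S \<xi> \<and> divergence_zero S \<omega> \<xi>}"

definition alg_volume_density_property :: "(complex ^ 'n) set \<Rightarrow> 'n::finite two_form \<Rightarrow> bool"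
  where "alg_volume_density_property S \<omega> \<longleftrightarrow> Lie_alg S \<omega> = AVF S \<omega>"

section \<open>The surface and its volume form\<close>

definition surface :: "complex poly \<Rightarrow> complex poly \<Rightarrow> (complex ^ 3) set"
  where "surface p q = {s. poly p (s $ 1) + poly q (s $ 2) + s $ 1 * s $ 2 * s $ 3 = 1}"

text \<open>The form \<open>dx \<and> dy / (x y)\<close>, evaluated on two vector fields of \<open>S\<close> at a point with
  \<open>x y \<noteq> 0\<close>; here \<open>dx(\<eta>) = \<eta>(x)\<close>.\<close>

definition torus_form :: "(complex ^ 3) set \<Rightarrow> 3 two_form"
  where "torus_form S = (\<lambda>\<eta> \<theta> s.
    (\<eta> (coordinate S 1) s * \<theta> (coordinate S 2) s - \<eta> (coordinate S 2) s * \<theta> (coordinate S 1) s)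
      / (s $ 1 * s $ 2))"

definition extends_torus_form :: "(complex ^ 3) set \<Rightarrow> 3 two_form \<Rightarrow> bool"
  where "extends_torus_form S \<omega> \<longleftrightarrow>
    (\<forall>\<eta>\<in>alg_vector_fields S. \<forall>\<theta>\<in>alg_vector_fields S. \<forall>s\<in>S.
        s $ 1 * s $ 2 \<noteq> 0 \<longrightarrow> \<omega> \<eta> \<theta> s = torus_form S \<eta> \<theta> s)"

end

theory Submission
  imports Defs "HOL-Computational_Algebra.Fundamental_Theorem_Algebra"
begin

text \<open>Write \<open>F = p(x) + q(y) + x y z - 1\<close>. The form is dual to the Poisson bracket with \<open>{x, y} = x y\<close>,
  \<open>{y, z} = F\<^sub>x\<close>, \<open>{z, x} = F\<^sub>y\<close>. The functions \<open>x\<^sup>n\<close>, \<open>y\<^sup>n\<close>, \<open>v = (1 - p(x)) / y\<close> and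
  \<open>w = (1 - q(y)) / x\<close> are regular, and their Hamiltonian fields are complete with explicit entire
  flows. Brackets of these fields give the Hamiltonian field of every regular function: \<open>{x\<^sup>i, y\<^sup>j}\<close>
  produces all monomials in \<open>x, y\<close>, then \<open>{x\<^sup>i, x z}\<close> produces \<open>x\<^bsup>i+1\<^esup> z\<close>, \<open>{x z\<^bsup>k+1\<^esup>, y z}\<close>
  produces \<open>z\<^bsup>k+1\<^esup>\<close>, and \<open>{x\<^sup>i z\<^sup>k, z}\<close> produces \<open>x\<^sup>i z\<^bsup>k+1\<^esup>\<close>.

  Conversely, on the torus a divergence-free field is \<open>h\<close>-Hamiltonian, for a Laurent polynomial \<open>h\<close>,
  up to \<open>a x \<partial>/\<partial>x + b y \<partial>/\<partial>y\<close>. Regularity of the field along the lines over \<open>x = 0\<close> and \<open>y = 0\<close> forces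
  \<open>h\<close> to be regular. The simple roots force \<open>a = 0\<close> unless \<open>p = 0\<close>, in which case \<open>x \<partial>/\<partial>x - z \<partial>/\<partial>z\<close>
  is itself complete; similarly for \<open>b\<close> and \<open>q\<close>.\<close>

text \<open>Where x y = 0 there are no torus coordinates, and z is a quotient with denominator x y.
  Identities between regular functions are therefore checked on the torus and carried to
  \<open>S\<close> by density. Density itself rests on the simple roots: they let a curve in the
  torus approach a point of x = 0 with any prescribed z. The flows are entire because an increment
  p(x) - p(x e^(vt)) is divisible by both x and v, with a quotient that stays entire across v = 0.
  For the converse, write the field as alpha d/dx + beta d/dy. Divergence zero says that (beta/y)
  dx/x - (alpha/x) dy/y is closed. Its potential is found coefficientwise, since x d/dx and y d/dy
  are diagonal on Laurent monomials. Only the constant monomial is killed by both, and the constant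
  terms of alpha/x and beta/y are the numbers a and b. A diagonal operator keeps divisibility of
  coefficients, so the conditions of beta along x = 0 and of alpha along y = 0 pass to the
  potential.\<close>

lemmas cpf_intros = complex_polynomial_function.intros

lemma cpf_uminus: "complex_polynomial_function f \<Longrightarrow> complex_polynomial_function (\<lambda>v. - f v)"
  using complex_polynomial_function.mult[OF complex_polynomial_function.const[of "-1"]] by simp

lemma cpf_diff:
  "complex_polynomial_function f \<Longrightarrow> complex_polynomial_function g
    \<Longrightarrow> complex_polynomial_function (\<lambda>v. f v - g v)"
  using complex_polynomial_function.add[OF _ cpf_uminus] by fastforce

lemma cpf_power:
  "complex_polynomial_function f \<Longrightarrow> complex_polynomial_function (\<lambda>v. f v ^ n)"
  by (induction n) (auto intro: cpf_intros)

lemma cpf_poly: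
  "complex_polynomial_function f \<Longrightarrow> complex_polynomial_function (\<lambda>v. poly r (f v))"
  by (induction r) (auto intro: cpf_intros)

lemma cpf_sum:
  "(\<And>k. k \<in> K \<Longrightarrow> complex_polynomial_function (f k))
    \<Longrightarrow> complex_polynomial_function (\<lambda>v. \<Sum>k\<in>K. f k v)"
  by (induction K rule: infinite_finite_induct) (auto intro: cpf_intros)

lemmas cpf = cpf_intros cpf_uminus cpf_diff cpf_power cpf_poly

lemma cpf_isCont: "complex_polynomial_function f \<Longrightarrow> isCont f s"
  by (induction rule: complex_polynomial_function.induct) (auto intro!: continuous_intros)

text \<open>\<open>L\<close> is only a linear space, so a plain induction fails at products. The
  induction statement carries a multiplier \<open>g\<close>, into which the second factor of a
  product is absorbed.\<close>

lemma cpf_span: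
  assumes f: "complex_polynomial_function (f :: complex ^ 3 \<Rightarrow> complex)"
    and L_add: "\<And>g h. g \<in> L \<Longrightarrow> h \<in> L \<Longrightarrow> (\<lambda>s. g s + h s) \<in> L"
    and L_scale: "\<And>c g. g \<in> L \<Longrightarrow> (\<lambda>s. c * g s) \<in> L"
    and L_monom: "\<And>i j k. (\<lambda>s. s $ 1 ^ i * s $ 2 ^ j * s $ 3 ^ k) \<in> L"
  shows "f \<in> L"
proof -
  have "\<forall>g. (\<forall>i j k. (\<lambda>s. s $ 1 ^ i * s $ 2 ^ j * s $ 3 ^ k * g s) \<in> L) \<longrightarrow> (\<lambda>s. f s * g s) \<in> L"
    using f
  proof induction
    case (const c)
    show ?case
    proof (intro allI impI)
      fix g assume "\<forall>i j k. (\<lambda>s. s $ 1 ^ i * s $ 2 ^ j * s $ 3 ^ k * g s) \<in> L"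
      from this[rule_format, of 0 0 0] show "(\<lambda>s. c * g s) \<in> L"
        by (auto intro: L_scale)
    qed
  next
    case (coord m)
    show ?case
    proof (intro allI impI)
      fix g assume *: "\<forall>i j k. (\<lambda>s. s $ 1 ^ i * s $ 2 ^ j * s $ 3 ^ k * g s) \<in> L"
      from exhaust_3[of m] show "(\<lambda>s. s $ m * g s) \<in> L"
        using *[rule_format, of 1 0 0] *[rule_format, of 0 1 0] *[rule_format, of 0 0 1]
        by auto
    qed
  next
    case (add f1 f2)
    then show ?case
      using L_add by (fastforce simp: algebra_simps)
  next
    case (mult f1 f2)
    show ?case
    proof (intro allI impI)
      fix g assume *: "\<forall>i j k. (\<lambda>s. s $ 1 ^ i * s $ 2 ^ j * s $ 3 ^ k * g s) \<in> L"
      have "(\<lambda>s. f2 s * (s $ 1 ^ i * s $ 2 ^ j * s $ 3 ^ k * g s)) \<in> L" for i j k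
      proof (rule mult.IH(2)[rule_format])
        fix i' j' k'
        show "(\<lambda>s. s $ 1 ^ i' * s $ 2 ^ j' * s $ 3 ^ k'
            * (s $ 1 ^ i * s $ 2 ^ j * s $ 3 ^ k * g s)) \<in> L"
          using *[rule_format, of "i'+i" "j'+j" "k'+k"] by (simp add: power_add algebra_simps)
      qed
      then have "(\<lambda>s. f1 s * (f2 s * g s)) \<in> L"
        by (intro mult.IH(1)[rule_format]) (simp add: algebra_simps)
      then show "(\<lambda>s. f1 s * f2 s * g s) \<in> L"
        by (simp add: algebra_simps)
    qed
  qed
  from this[rule_format, of "\<lambda>_. 1"] L_monom show ?thesis by simp
qed

section \<open>Regular functions and algebraic vector fields\<close>

lemma restrict0_in [simp]: "s \<in> S \<Longrightarrow> restrict0 S f s = f s"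
  and restrict0_out [simp]: "s \<notin> S \<Longrightarrow> restrict0 S f s = 0"
  by (auto simp: restrict0_def)

lemma restrict0_cong: "(\<And>s. s \<in> S \<Longrightarrow> f s = g s) \<Longrightarrow> restrict0 S f = restrict0 S g"
  by (auto simp: restrict0_def)

lemma regular_restrict0:
  "complex_polynomial_function f \<Longrightarrow> restrict0 S f \<in> regular_functions S"
  by (auto simp: regular_functions_def)

lemma regularE:
  assumes "\<phi> \<in> regular_functions S"
  obtains f where "complex_polynomial_function f" "\<phi> = restrict0 S f"
  using assms by (auto simp: regular_functions_def)

lemma regular_out: "\<phi> \<in> regular_functions S \<Longrightarrow> s \<notin> S \<Longrightarrow> \<phi> s = 0"
  by (auto elim: regularE)

lemma regular_zero: "(\<lambda>_. 0) \<in> regular_functions S"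
  using regular_restrict0[OF complex_polynomial_function.const[of 0], of S]
  by (simp add: restrict0_def)

lemma regular_add:
  assumes "f \<in> regular_functions S" "g \<in> regular_functions S"
  shows "(\<lambda>s. f s + g s) \<in> regular_functions S"
proof -
  from assms obtain a b where "complex_polynomial_function a" "f = restrict0 S a"
    "complex_polynomial_function b" "g = restrict0 S b" by (auto elim!: regularE)
  moreover have "(\<lambda>s. restrict0 S a s + restrict0 S b s) = restrict0 S (\<lambda>s. a s + b s)"
    by (auto simp: restrict0_def)
  ultimately show ?thesis by (auto intro!: regular_restrict0 cpf_intros)
qed

lemma regular_mult:
  assumes "f \<in> regular_functions S" "g \<in> regular_functions S"
  shows "(\<lambda>s. f s * g s) \<in> regular_functions S"
proof -
  from assms obtain a b where "complex_polynomial_function a" "f = restrict0 S a"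
    "complex_polynomial_function b" "g = restrict0 S b" by (auto elim!: regularE)
  moreover have "(\<lambda>s. restrict0 S a s * restrict0 S b s) = restrict0 S (\<lambda>s. a s * b s)"
    by (auto simp: restrict0_def)
  ultimately show ?thesis by (auto intro!: regular_restrict0 cpf_intros)
qed

lemma regular_scale: "f \<in> regular_functions S \<Longrightarrow> (\<lambda>s. c * f s) \<in> regular_functions S"
proof (erule regularE)
  fix a assume "complex_polynomial_function a" "f = restrict0 S a"
  moreover have "(\<lambda>s. c * restrict0 S a s) = restrict0 S (\<lambda>s. c * a s)"
    by (auto simp: restrict0_def)
  ultimately show ?thesis by (auto intro!: regular_restrict0 cpf_intros)
qed

lemma regular_diff:
  "f \<in> regular_functions S \<Longrightarrow> g \<in> regular_functions S
    \<Longrightarrow> (\<lambda>s. f s - g s) \<in> regular_functions S"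
  using regular_add[OF _ regular_scale[of g S "-1"]] by fastforce

lemmas regular = regular_zero regular_add regular_mult regular_scale regular_diff
  regular_restrict0

context
  fixes \<xi> :: "'n::finite vfield" and S
  assumes \<xi>: "\<xi> \<in> alg_vector_fields S"
begin

lemma avf_regular: "\<xi> f \<in> regular_functions S"
  using \<xi> regular_zero[of S] by (cases "f \<in> regular_functions S") (auto simp: alg_vector_fields_def)

lemma avf_nonregular: "f \<notin> regular_functions S \<Longrightarrow> \<xi> f = (\<lambda>_. 0)"
  using \<xi> by (auto simp: alg_vector_fields_def)

lemma avf_out: "s \<notin> S \<Longrightarrow> \<xi> f s = 0"
  using avf_regular regular_out by blast

lemma avf_add:
  "f \<in> regular_functions S \<Longrightarrow> g \<in> regular_functions S
    \<Longrightarrow> \<xi> (\<lambda>s. f s + g s) = (\<lambda>s. \<xi> f s + \<xi> g s)"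
  using \<xi> by (auto simp: alg_vector_fields_def)

lemma avf_scale: "f \<in> regular_functions S \<Longrightarrow> \<xi> (\<lambda>s. c * f s) = (\<lambda>s. c * \<xi> f s)"
  using \<xi> by (auto simp: alg_vector_fields_def)

lemma avf_mult:
  "f \<in> regular_functions S \<Longrightarrow> g \<in> regular_functions S
    \<Longrightarrow> \<xi> (\<lambda>s. f s * g s) = (\<lambda>s. \<xi> f s * g s + f s * \<xi> g s)"
  using \<xi> by (auto simp: alg_vector_fields_def)

lemma avf_diff:
  assumes "f \<in> regular_functions S" "g \<in> regular_functions S"
  shows "\<xi> (\<lambda>s. f s - g s) = (\<lambda>s. \<xi> f s - \<xi> g s)"
  using avf_add[OF assms(1) regular_scale[OF assms(2), of "-1"]]
  unfolding avf_scale[OF assms(2)] by simp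

lemma avf_const: "\<xi> (restrict0 S (\<lambda>_. c)) = (\<lambda>_. 0)"
proof -
  let ?o = "restrict0 S (\<lambda>_. 1)"
  have o: "?o \<in> regular_functions S" by (intro regular cpf)
  have "(\<lambda>s. ?o s * ?o s) = ?o" by (auto simp: restrict0_def)
  with avf_mult[OF o o] have *: "\<xi> ?o = (\<lambda>s. \<xi> ?o s * ?o s + ?o s * \<xi> ?o s)" by simp
  have "\<xi> ?o s = 0" for s
    using fun_cong[OF *, of s] avf_out[of s ?o] by (cases "s \<in> S") auto
  moreover have "restrict0 S (\<lambda>_. c) = (\<lambda>s. c * ?o s)" by (auto simp: restrict0_def)
  ultimately show ?thesis using avf_scale[OF o, of c] by simp
qed

lemma avf_poly_add:
  assumes "complex_polynomial_function f" "complex_polynomial_function g"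
  shows "\<xi> (restrict0 S (\<lambda>s. f s + g s)) = (\<lambda>s. \<xi> (restrict0 S f) s + \<xi> (restrict0 S g) s)"
proof -
  have "restrict0 S (\<lambda>s. f s + g s) = (\<lambda>s. restrict0 S f s + restrict0 S g s)"
    by (auto simp: restrict0_def)
  then show ?thesis by (simp add: avf_add assms regular)
qed

lemma avf_poly_mult:
  assumes "complex_polynomial_function f" "complex_polynomial_function g"
  shows "\<xi> (restrict0 S (\<lambda>s. f s * g s))
    = (\<lambda>s. \<xi> (restrict0 S f) s * g s + f s * \<xi> (restrict0 S g) s)"
proof -
  have *: "restrict0 S (\<lambda>s. f s * g s) = (\<lambda>s. restrict0 S f s * restrict0 S g s)"
    by (auto simp: restrict0_def)
  show ?thesis
  proof
    fix s
    show "\<xi> (restrict0 S (\<lambda>s. f s * g s)) s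
        = \<xi> (restrict0 S f) s * g s + f s * \<xi> (restrict0 S g) s"
      unfolding * avf_mult[OF assms[THEN regular_restrict0]]
      by (cases "s \<in> S") (auto simp: avf_out)
  qed
qed

lemma avf_poly_poly:
  assumes f: "complex_polynomial_function f"
  shows "\<xi> (restrict0 S (\<lambda>s. poly r (f s)))
    = (\<lambda>s. poly (pderiv r) (f s) * \<xi> (restrict0 S f) s)"
proof (induction r)
  case 0
  then show ?case using avf_const[of 0] by simp
next
  case (pCons a r)
  show ?case
    using avf_poly_add[OF complex_polynomial_function.const[of a] complex_polynomial_function.mult[OF f cpf_poly[OF f, of r]]]
      avf_poly_mult[OF f cpf_poly[OF f, of r]]
    by (auto simp: avf_const pCons.IH pderiv_pCons algebra_simps)
qed

end

lemma avf_zero: "vf_zero \<in> alg_vector_fields S"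
  by (auto simp: alg_vector_fields_def vf_zero_def regular_zero)

lemma avf_vf_add:
  assumes "\<xi> \<in> alg_vector_fields S" "\<eta> \<in> alg_vector_fields S"
  shows "vf_add \<xi> \<eta> \<in> alg_vector_fields S"
  unfolding alg_vector_fields_def vf_add_def mem_Collect_eq
  using assms[THEN avf_regular] assms[THEN avf_add] assms[THEN avf_scale] assms[THEN avf_mult]
    assms[THEN avf_nonregular]
  by (auto simp: algebra_simps intro!: regular)

lemma avf_vf_scale:
  assumes "\<xi> \<in> alg_vector_fields S"
  shows "vf_scale c \<xi> \<in> alg_vector_fields S"
  unfolding alg_vector_fields_def vf_scale_def mem_Collect_eq
  using assms[THEN avf_regular] assms[THEN avf_add] assms[THEN avf_scale] assms[THEN avf_mult]
    assms[THEN avf_nonregular]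
  by (auto simp: algebra_simps intro!: regular)

lemma avf_bracket:
  assumes \<xi>: "\<xi> \<in> alg_vector_fields S" and \<eta>: "\<eta> \<in> alg_vector_fields S"
  shows "lie_bracket \<xi> \<eta> \<in> alg_vector_fields S"
proof -
  note reg = avf_regular[OF \<xi>] avf_regular[OF \<eta>]
  have zero: "\<xi> (\<lambda>_. 0) = (\<lambda>_. 0)" "\<eta> (\<lambda>_. 0) = (\<lambda>_. 0)"
    using avf_scale[OF \<xi> regular_zero, of 0] avf_scale[OF \<eta> regular_zero, of 0] by auto
  show ?thesis
    unfolding alg_vector_fields_def mem_Collect_eq
  proof (intro conjI ballI allI impI)
    fix f assume "f \<in> regular_functions S"
    then show "lie_bracket \<xi> \<eta> f \<in> regular_functions S"
      unfolding lie_bracket_def by (intro regular_diff reg)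
  next
    fix f assume "f \<notin> regular_functions S"
    then show "lie_bracket \<xi> \<eta> f = (\<lambda>_. 0)"
      by (simp add: lie_bracket_def avf_nonregular[OF \<xi>] avf_nonregular[OF \<eta>] zero)
  next
    fix f g assume f: "f \<in> regular_functions S" and g: "g \<in> regular_functions S"
    show "lie_bracket \<xi> \<eta> (\<lambda>s. f s + g s)
        = (\<lambda>s. lie_bracket \<xi> \<eta> f s + lie_bracket \<xi> \<eta> g s)"
      by (simp add: lie_bracket_def avf_add[OF \<xi> f g] avf_add[OF \<eta> f g]
          avf_add[OF \<xi> reg(2) reg(2)] avf_add[OF \<eta> reg(1) reg(1)] fun_eq_iff)
    have "\<xi> (\<eta> (\<lambda>s. f s * g s)) s
          = \<xi> (\<eta> f) s * g s + \<eta> f s * \<xi> g s + (\<xi> f s * \<eta> g s + f s * \<xi> (\<eta> g) s)"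
      and "\<eta> (\<xi> (\<lambda>s. f s * g s)) s
          = \<eta> (\<xi> f) s * g s + \<xi> f s * \<eta> g s + (\<eta> f s * \<xi> g s + f s * \<eta> (\<xi> g) s)" for s
      unfolding avf_mult[OF \<xi> f g] avf_mult[OF \<eta> f g]
        avf_add[OF \<xi> regular_mult[OF reg(2) g] regular_mult[OF f reg(2)]]
        avf_add[OF \<eta> regular_mult[OF reg(1) g] regular_mult[OF f reg(1)]]
        avf_mult[OF \<xi> reg(2) g] avf_mult[OF \<xi> f reg(2)]
        avf_mult[OF \<eta> reg(1) g] avf_mult[OF \<eta> f reg(1)] by simp_all
    then show "lie_bracket \<xi> \<eta> (\<lambda>s. f s * g s)
        = (\<lambda>s. lie_bracket \<xi> \<eta> f s * g s + f s * lie_bracket \<xi> \<eta> g s)"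
      by (simp add: lie_bracket_def fun_eq_iff algebra_simps)
  next
    fix c f assume f: "f \<in> regular_functions S"
    show "lie_bracket \<xi> \<eta> (\<lambda>s. c * f s) = (\<lambda>s. c * lie_bracket \<xi> \<eta> f s)"
      by (simp add: lie_bracket_def avf_scale[OF \<xi> f] avf_scale[OF \<eta> f]
          avf_scale[OF \<xi> reg(2)] avf_scale[OF \<eta> reg(1)] right_diff_distrib)
  qed
qed

text \<open>\<open>alg_two_form\<close> speaks of multiplication by regular functions only, so a
  scalar has to enter as a constant function cut off outside \<open>S\<close>.\<close>

lemma vf_scale_eq_mult:
  assumes "\<eta> \<in> alg_vector_fields S"
  shows "vf_scale c \<eta> = vf_mult (restrict0 S (\<lambda>_. c)) \<eta>"
  by (auto simp: vf_scale_def vf_mult_def restrict0_def fun_eq_iff avf_out[OF assms])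

section \<open>Divergence-free fields form a Lie algebra\<close>

context
  fixes \<omega> :: "'n::finite two_form" and S
  assumes \<omega>: "alg_two_form S \<omega>"
begin

lemma form_regular:
  "\<eta> \<in> alg_vector_fields S \<Longrightarrow> \<theta> \<in> alg_vector_fields S \<Longrightarrow> \<omega> \<eta> \<theta> \<in> regular_functions S"
  using \<omega> unfolding alg_two_form_def by blast

lemma form_antisym:
  "\<eta> \<in> alg_vector_fields S \<Longrightarrow> \<theta> \<in> alg_vector_fields S \<Longrightarrow> \<omega> \<eta> \<theta> = (\<lambda>s. - \<omega> \<theta> \<eta> s)"
  using \<omega> unfolding alg_two_form_def by blast

lemma form_add_left:
  assumes "\<eta> \<in> alg_vector_fields S" "\<theta> \<in> alg_vector_fields S" "\<zeta> \<in> alg_vector_fields S"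
  shows "\<omega> (vf_add \<eta> \<zeta>) \<theta> s = \<omega> \<eta> \<theta> s + \<omega> \<zeta> \<theta> s"
proof -
  have "\<omega> (vf_add \<eta> \<zeta>) \<theta> = (\<lambda>s. \<omega> \<eta> \<theta> s + \<omega> \<zeta> \<theta> s)"
    using \<omega> assms unfolding alg_two_form_def by blast
  then show ?thesis by (rule fun_cong)
qed

lemma form_scale_left:
  assumes \<eta>: "\<eta> \<in> alg_vector_fields S" and \<theta>: "\<theta> \<in> alg_vector_fields S"
  shows "\<omega> (vf_scale c \<eta>) \<theta> s = c * \<omega> \<eta> \<theta> s"
proof -
  have "restrict0 S (\<lambda>_. c) \<in> regular_functions S" by (intro regular cpf)
  then have "\<omega> (vf_mult (restrict0 S (\<lambda>_. c)) \<eta>) \<theta> = (\<lambda>s. restrict0 S (\<lambda>_. c) s * \<omega> \<eta> \<theta> s)"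
    using \<omega> \<eta> \<theta> unfolding alg_two_form_def by blast
  from fun_cong[OF this, of s] show ?thesis
    using regular_out[OF form_regular[OF \<eta> \<theta>], of s]
    by (cases "s \<in> S") (auto simp: vf_scale_eq_mult[OF \<eta>])
qed

lemma form_add_right:
  assumes "\<eta> \<in> alg_vector_fields S" "\<theta> \<in> alg_vector_fields S" "\<zeta> \<in> alg_vector_fields S"
  shows "\<omega> \<theta> (vf_add \<eta> \<zeta>) s = \<omega> \<theta> \<eta> s + \<omega> \<theta> \<zeta> s"
  unfolding form_antisym[OF assms(2,1)] form_antisym[OF assms(2,3)]
    form_antisym[OF assms(2) avf_vf_add[OF assms(1,3)]] form_add_left[OF assms] by simp

lemma form_scale_right:
  assumes "\<eta> \<in> alg_vector_fields S" "\<theta> \<in> alg_vector_fields S"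
  shows "\<omega> \<theta> (vf_scale c \<eta>) s = c * \<omega> \<theta> \<eta> s"
  unfolding form_antisym[OF assms(2,1)] form_antisym[OF assms(2) avf_vf_scale[OF assms(1)]]
    form_scale_left[OF assms] by simp

lemmas form_linear = form_add_left form_add_right form_scale_left form_scale_right

lemma divergence_zeroD:
  assumes "divergence_zero S \<omega> \<xi>" and \<xi>: "\<xi> \<in> alg_vector_fields S"
    and \<eta>: "\<eta> \<in> alg_vector_fields S" and \<theta>: "\<theta> \<in> alg_vector_fields S"
  shows "\<xi> (\<omega> \<eta> \<theta>) = (\<lambda>s. \<omega> (lie_bracket \<xi> \<eta>) \<theta> s + \<omega> \<eta> (lie_bracket \<xi> \<theta>) s)"
proof
  fix s
  show "\<xi> (\<omega> \<eta> \<theta>) s = \<omega> (lie_bracket \<xi> \<eta>) \<theta> s + \<omega> \<eta> (lie_bracket \<xi> \<theta>) s"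
  proof (cases "s \<in> S")
    case True
    then have "lie_derivative \<xi> \<omega> \<eta> \<theta> s = 0" using assms by (auto simp: divergence_zero_def)
    then show ?thesis by (simp add: lie_derivative_def algebra_simps)
  next
    case False
    then show ?thesis
      by (simp add: avf_out[OF \<xi>] regular_out[OF form_regular] \<xi> \<eta> \<theta> avf_bracket)
  qed
qed

lemma AVF_zero: "vf_zero \<in> AVF S \<omega>"
proof -
  have zero: "vf_zero = vf_scale 0 \<eta>" for \<eta> :: "'n vfield" by (auto simp: vf_zero_def vf_scale_def)
  have "lie_derivative vf_zero \<omega> \<eta> \<theta> s = 0"
    if "\<eta> \<in> alg_vector_fields S" "\<theta> \<in> alg_vector_fields S" for \<eta> \<theta> s
  proof -
    have "lie_bracket vf_zero \<eta> = vf_scale 0 \<eta>" if "\<eta> \<in> alg_vector_fields S" for \<eta>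
      using avf_scale[OF that regular_zero, of 0]
      by (auto simp: lie_bracket_def vf_zero_def vf_scale_def fun_eq_iff)
    then show ?thesis
      using that by (simp add: lie_derivative_def form_linear) (simp add: vf_zero_def)
  qed
  then show ?thesis by (auto simp: AVF_def avf_zero divergence_zero_def)
qed

lemma AVF_add:
  assumes \<xi>: "\<xi> \<in> AVF S \<omega>" and \<eta>: "\<eta> \<in> AVF S \<omega>"
  shows "vf_add \<xi> \<eta> \<in> AVF S \<omega>"
proof -
  have alg: "\<xi> \<in> alg_vector_fields S" "\<eta> \<in> alg_vector_fields S" using assms by (auto simp: AVF_def)
  have br: "lie_bracket (vf_add \<xi> \<eta>) \<theta> = vf_add (lie_bracket \<xi> \<theta>) (lie_bracket \<eta> \<theta>)"
    if "\<theta> \<in> alg_vector_fields S" for \<theta>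
    unfolding lie_bracket_def vf_add_def
      avf_add[OF that avf_regular[OF alg(1)] avf_regular[OF alg(2)]]
    by (simp add: fun_eq_iff)
  have "lie_derivative (vf_add \<xi> \<eta>) \<omega> \<theta> \<kappa> s = 0"
    if "\<theta> \<in> alg_vector_fields S" "\<kappa> \<in> alg_vector_fields S" "s \<in> S" for \<theta> \<kappa> s
  proof -
    have "lie_derivative (vf_add \<xi> \<eta>) \<omega> \<theta> \<kappa> s
        = lie_derivative \<xi> \<omega> \<theta> \<kappa> s + lie_derivative \<eta> \<omega> \<theta> \<kappa> s"
      by (simp add: lie_derivative_def br form_linear that alg avf_bracket)
        (simp add: vf_add_def)
    then show ?thesis using that assms by (simp add: AVF_def divergence_zero_def)
  qed
  then show ?thesis by (auto simp: AVF_def avf_vf_add alg divergence_zero_def)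
qed

lemma AVF_scale:
  assumes \<xi>: "\<xi> \<in> AVF S \<omega>"
  shows "vf_scale c \<xi> \<in> AVF S \<omega>"
proof -
  have alg: "\<xi> \<in> alg_vector_fields S" using assms by (auto simp: AVF_def)
  have br: "lie_bracket (vf_scale c \<xi>) \<theta> = vf_scale c (lie_bracket \<xi> \<theta>)"
    if "\<theta> \<in> alg_vector_fields S" for \<theta>
    unfolding lie_bracket_def vf_scale_def avf_scale[OF that avf_regular[OF alg]]
    by (simp add: fun_eq_iff right_diff_distrib)
  have "lie_derivative (vf_scale c \<xi>) \<omega> \<theta> \<kappa> s = 0"
    if "\<theta> \<in> alg_vector_fields S" "\<kappa> \<in> alg_vector_fields S" "s \<in> S" for \<theta> \<kappa> s
  proof -
    have "lie_derivative (vf_scale c \<xi>) \<omega> \<theta> \<kappa> s = c * lie_derivative \<xi> \<omega> \<theta> \<kappa> s"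
      by (simp add: lie_derivative_def br form_linear that alg avf_bracket)
        (simp add: vf_scale_def algebra_simps)
    then show ?thesis using that assms by (simp add: AVF_def divergence_zero_def)
  qed
  then show ?thesis by (auto simp: AVF_def avf_vf_scale alg divergence_zero_def)
qed

text \<open>The Lie derivative along a bracket is the commutator of the Lie derivatives. Using
  \<open>divergence_zeroD\<close> twice, the mixed terms pairing a bracket with xi and a bracket
  with eta cancel, and the Jacobi identity collects the rest.\<close>

lemma AVF_bracket:
  assumes \<xi>: "\<xi> \<in> AVF S \<omega>" and \<eta>: "\<eta> \<in> AVF S \<omega>"
  shows "lie_bracket \<xi> \<eta> \<in> AVF S \<omega>"
proof -
  have alg: "\<xi> \<in> alg_vector_fields S" "\<eta> \<in> alg_vector_fields S"
    and dz: "divergence_zero S \<omega> \<xi>" "divergence_zero S \<omega> \<eta>" using assms by (auto simp: AVF_def)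
  have jacobi: "lie_bracket (lie_bracket \<xi> \<eta>) \<theta>
      = vf_add (lie_bracket \<xi> (lie_bracket \<eta> \<theta>)) (vf_scale (-1) (lie_bracket \<eta> (lie_bracket \<xi> \<theta>)))"
    if "\<theta> \<in> alg_vector_fields S" for \<theta>
    unfolding lie_bracket_def vf_add_def vf_scale_def
      avf_diff[OF that avf_regular[OF alg(1)] avf_regular[OF alg(2)]]
      avf_diff[OF alg(1) avf_regular[OF alg(2)] avf_regular[OF that]]
      avf_diff[OF alg(2) avf_regular[OF alg(1)] avf_regular[OF that]]
    by (simp add: fun_eq_iff)
  have "lie_derivative (lie_bracket \<xi> \<eta>) \<omega> \<theta> \<kappa> s = 0"
    if t: "\<theta> \<in> alg_vector_fields S" "\<kappa> \<in> alg_vector_fields S" "s \<in> S" for \<theta> \<kappa> s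
  proof -
    have "lie_bracket \<xi> \<eta> (\<omega> \<theta> \<kappa>) s
       = \<xi> (\<lambda>s. \<omega> (lie_bracket \<eta> \<theta>) \<kappa> s + \<omega> \<theta> (lie_bracket \<eta> \<kappa>) s) s
         - \<eta> (\<lambda>s. \<omega> (lie_bracket \<xi> \<theta>) \<kappa> s + \<omega> \<theta> (lie_bracket \<xi> \<kappa>) s) s"
      by (simp add: lie_bracket_def[of \<xi> \<eta>] divergence_zeroD[OF dz(1) alg(1)]
          divergence_zeroD[OF dz(2) alg(2)] t)
    also have "\<dots> = \<omega> (lie_bracket \<xi> (lie_bracket \<eta> \<theta>)) \<kappa> s - \<omega> (lie_bracket \<eta> (lie_bracket \<xi> \<theta>)) \<kappa> s
        + \<omega> \<theta> (lie_bracket \<xi> (lie_bracket \<eta> \<kappa>)) s - \<omega> \<theta> (lie_bracket \<eta> (lie_bracket \<xi> \<kappa>)) s"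
      by (simp add: avf_add[OF alg(1)] avf_add[OF alg(2)] form_regular avf_bracket alg t
          divergence_zeroD[OF dz(1) alg(1)] divergence_zeroD[OF dz(2) alg(2)])
    finally show ?thesis
      by (simp add: lie_derivative_def[of "lie_bracket \<xi> \<eta>"] jacobi t form_linear alg avf_bracket
          avf_vf_scale)
  qed
  then show ?thesis by (auto simp: AVF_def avf_bracket alg divergence_zero_def)
qed

lemma Lie_alg_subset_AVF: "Lie_alg S \<omega> \<subseteq> AVF S \<omega>"
proof
  fix \<xi> assume "\<xi> \<in> Lie_alg S \<omega>"
  then show "\<xi> \<in> AVF S \<omega>"
    unfolding Lie_alg_def
  proof induction
    case (incl \<xi>)
    then show ?case by (simp add: AVF_def)
  qed (auto intro: AVF_zero AVF_add AVF_scale AVF_bracket)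
qed

end

section \<open>Entire flows\<close>

text \<open>Scalar counterpart of \<open>holomorphic_map_on\<close> on the whole space. It is closed
  under the operations that build the flows, so \<open>UNIV\<close> can serve as the neighbourhood
  in \<open>holomorphic_action\<close>.\<close>

definition entire :: "(complex \<times> (complex ^ 'n) \<Rightarrow> complex) \<Rightarrow> bool"
  where "entire f \<longleftrightarrow> (\<forall>w. \<exists>f'. (f has_derivative f') (at w) \<and>
    (\<forall>c t v. f' (c * t, c *s v) = c * f' (t, v)))"

lemma entire_const: "entire (\<lambda>_. c)"
  unfolding entire_def by (auto intro!: exI[of _ "\<lambda>_. 0"])

lemma entire_time: "entire (\<lambda>w. fst w)"
  unfolding entire_def by (auto intro!: exI[of _ fst] derivative_eq_intros)

lemma entire_coord:
  fixes i :: "'n::finite"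
  shows "entire (\<lambda>w. snd w $ i)"
  unfolding entire_def
proof (intro allI exI conjI)
  fix w :: "complex \<times> (complex ^ 'n)"
  have "bounded_linear (\<lambda>w. snd w $ i)"
    using bounded_linear_compose[OF bounded_linear_vec_nth bounded_linear_snd] .
  then show "((\<lambda>w. snd w $ i) has_derivative (\<lambda>w. snd w $ i)) (at w)"
    by (rule bounded_linear_imp_has_derivative)
qed auto

lemma entire_add:
  assumes "entire f" "entire g"
  shows "entire (\<lambda>w. f w + g w)"
  unfolding entire_def
proof
  fix w
  obtain f' g' where "(f has_derivative f') (at w)" "\<forall>c t v. f' (c * t, c *s v) = c * f' (t, v)"
    "(g has_derivative g') (at w)" "\<forall>c t v. g' (c * t, c *s v) = c * g' (t, v)"
    using assms unfolding entire_def by meson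
  then show "\<exists>h'. ((\<lambda>w. f w + g w) has_derivative h') (at w) \<and>
      (\<forall>c t v. h' (c * t, c *s v) = c * h' (t, v))"
    by (intro exI[of _ "\<lambda>x. f' x + g' x"]) (auto intro!: derivative_intros simp: algebra_simps)
qed

lemma entire_mult:
  assumes "entire f" "entire g"
  shows "entire (\<lambda>w. f w * g w)"
  unfolding entire_def
proof
  fix w
  obtain f' g' where "(f has_derivative f') (at w)" "\<forall>c t v. f' (c * t, c *s v) = c * f' (t, v)"
    "(g has_derivative g') (at w)" "\<forall>c t v. g' (c * t, c *s v) = c * g' (t, v)"
    using assms unfolding entire_def by meson
  then show "\<exists>h'. ((\<lambda>w. f w * g w) has_derivative h') (at w) \<and>
      (\<forall>c t v. h' (c * t, c *s v) = c * h' (t, v))"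
    by (intro exI[of _ "\<lambda>x. f w * g' x + f' x * g w"])
      (auto intro!: derivative_intros simp: algebra_simps)
qed

lemma entire_compose:
  assumes f: "entire f" and g: "\<And>z. (g has_field_derivative g' z) (at z)"
  shows "entire (\<lambda>w. g (f w))"
  unfolding entire_def
proof
  fix w
  obtain f' where f': "(f has_derivative f') (at w)" "\<forall>c t v. f' (c * t, c *s v) = c * f' (t, v)"
    using f unfolding entire_def by meson
  have "((\<lambda>w. g (f w)) has_derivative (\<lambda>x. g' (f w) * f' x)) (at w)"
    using has_derivative_compose[OF f'(1) g[THEN has_field_derivative_imp_has_derivative]] .
  then show "\<exists>h'. ((\<lambda>w. g (f w)) has_derivative h') (at w) \<and>
      (\<forall>c t v. h' (c * t, c *s v) = c * h' (t, v))"
    using f'(2) by (intro exI[of _ "\<lambda>x. g' (f w) * f' x"]) auto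
qed

lemma entire_uminus: "entire f \<Longrightarrow> entire (\<lambda>w. - f w)"
  using entire_mult[OF entire_const[of "-1"]] by simp

lemma entire_diff: "entire f \<Longrightarrow> entire g \<Longrightarrow> entire (\<lambda>w. f w - g w)"
  using entire_add[OF _ entire_uminus] by fastforce

lemma entire_power: "entire f \<Longrightarrow> entire (\<lambda>w. f w ^ n)"
  by (induction n) (auto intro: entire_const entire_mult)

lemma entire_poly: "entire f \<Longrightarrow> entire (\<lambda>w. poly r (f w))"
  by (induction r) (auto intro: entire_const entire_mult entire_add)

lemma entire_synthetic_div:
  "entire f \<Longrightarrow> entire g \<Longrightarrow> entire (\<lambda>w. poly (synthetic_div r (f w)) (g w))"
  by (induction r) (auto intro: entire_const entire_mult entire_add entire_poly)

lemma entire_exp: "entire f \<Longrightarrow> entire (\<lambda>w. exp (f w))"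
  by (rule entire_compose) (auto intro: DERIV_exp)

lemma entire_continuous:
  assumes "entire f" shows "isCont (\<lambda>s. f (t, s)) s"
proof -
  obtain f' where "(f has_derivative f') (at (t, s))" using assms unfolding entire_def by meson
  then have "isCont f (t, s)" by (rule has_derivative_continuous)
  moreover have "isCont (\<lambda>s. (t, s)) s" by (intro continuous_intros)
  ultimately show ?thesis using isCont_o2[where f = "Pair t" and g = f and a = s] by simp
qed

text \<open>Existence of some derivative suffices: in the flows below this factor is multiplied by
  t, so its derivative drops out at t = 0.\<close>

lemma entire_time_deriv:
  assumes "entire f"
  obtains D where "((\<lambda>t. f (t, s)) has_field_derivative D) (at t)"
proof -
  obtain f' where f': "(f has_derivative f') (at (t, s))" "\<forall>c t v. f' (c * t, c *s v) = c * f' (t, v)"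
    using assms unfolding entire_def by meson
  have "((\<lambda>t. (t, s)) has_derivative (\<lambda>h. (h, 0))) (at t)"
    by (auto intro!: derivative_eq_intros)
  from has_derivative_compose[OF this f'(1)]
  have "((\<lambda>t. f (t, s)) has_derivative (\<lambda>h. f' (h, 0))) (at t)" .
  moreover have "f' (h, 0) = f' (1, 0) * h" for h
    using f'(2)[rule_format, of h 1 0] by (simp add: mult.commute)
  then have "(\<lambda>h. f' (h, 0)) = (*) (f' (1, 0))" by (rule ext)
  ultimately have "((\<lambda>t. f (t, s)) has_derivative (*) (f' (1, 0))) (at t)" by simp
  then show ?thesis using that by (auto simp: has_field_derivative_def)
qed

lemma holomorphic_map_componentwise:
  fixes F :: "complex \<times> (complex ^ 'n) \<Rightarrow> complex ^ 'n"
  assumes "\<And>i. entire (\<lambda>w. F w $ i)"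
  shows "holomorphic_map_on F UNIV"
  unfolding holomorphic_map_on_def
proof
  fix w
  have "\<forall>i. \<exists>f'. ((\<lambda>w. F w $ i) has_derivative f') (at w) \<and>
      (\<forall>c t v. f' (c * t, c *s v) = c * f' (t, v))"
    using assms unfolding entire_def by blast
  then obtain f' where f': "\<And>i. ((\<lambda>w. F w $ i) has_derivative f' i) (at w)"
    "\<And>i c t v. f' i (c * t, c *s v) = c * f' i (t, v)" by metis
  have axis: "bounded_linear (\<lambda>z::complex. axis i z :: complex ^ 'n)" for i
    unfolding linear_conv_bounded_linear[symmetric]
    by (rule linearI) (auto simp: vec_eq_iff axis_def)
  have "((\<lambda>w. \<Sum>i\<in>UNIV. axis i (F w $ i)) has_derivative (\<lambda>x. \<Sum>i\<in>UNIV. axis i (f' i x))) (at w)"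
    by (intro has_derivative_sum bounded_linear.has_derivative[OF axis] f')
  moreover have "(\<Sum>i\<in>UNIV. axis i (a i)) = (\<chi> i. a i)" for a :: "'n \<Rightarrow> complex"
    by (simp add: vec_eq_iff axis_def if_distrib sum.delta cong: if_cong)
  ultimately have "(F has_derivative (\<lambda>x. \<chi> i. f' i x)) (at w)" by simp
  then show "\<exists>F'. (F has_derivative F') (at w) \<and> (\<forall>c t v. F' (c * t, c *s v) = c *s F' (t, v))"
    by (intro exI[of _ "\<lambda>x. \<chi> i. f' i x"]) (auto simp: f'(2) vec_eq_iff)
qed

text \<open>The field is read off from its flow, so completeness is automatic. The Leibniz rule
  carries polynomial velocities from the coordinates to all polynomials, hence the derivation
  preserves regular functions.\<close>

lemma complete_field_of_flow:
  fixes \<phi> :: "complex \<Rightarrow> complex ^ 'n::finite \<Rightarrow> complex ^ 'n"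
  assumes entire: "\<And>i. entire (\<lambda>w. \<phi> (fst w) (snd w) $ i)"
    and inv: "\<And>t s. s \<in> S \<Longrightarrow> \<phi> t s \<in> S"
    and zero: "\<And>s. s \<in> S \<Longrightarrow> \<phi> 0 s = s"
    and add: "\<And>t u s. s \<in> S \<Longrightarrow> \<phi> (t + u) s = \<phi> t (\<phi> u s)"
    and V: "\<And>i. complex_polynomial_function (V i)"
    and deriv: "\<And>s i. s \<in> S \<Longrightarrow> ((\<lambda>t. \<phi> t s $ i) has_field_derivative V i s) (at 0)"
  obtains \<xi> where "\<xi> \<in> alg_vector_fields S" "complete_vf S \<xi>"
    "\<And>i. \<xi> (coordinate S i) = restrict0 S (V i)"
proof
  define \<xi> where "\<xi> f s = (if f \<in> regular_functions S \<and> s \<in> S then deriv (\<lambda>t. f (\<phi> t s)) 0 else 0)"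
    for f s
  have ex: "\<exists>g. complex_polynomial_function g \<and>
      (\<forall>s\<in>S. ((\<lambda>t. f (\<phi> t s)) has_field_derivative g s) (at 0))"
    if "complex_polynomial_function f" for f
    using that
  proof induction
    case (const c)
    show ?case by (intro exI[of _ "\<lambda>_. 0"]) (auto intro: cpf)
  next
    case (coord i)
    show ?case by (intro exI[of _ "V i"]) (auto intro: V deriv)
  next
    case (add f1 f2)
    then obtain g1 g2 where "complex_polynomial_function g1" "complex_polynomial_function g2"
      "\<forall>s\<in>S. ((\<lambda>t. f1 (\<phi> t s)) has_field_derivative g1 s) (at 0)"
      "\<forall>s\<in>S. ((\<lambda>t. f2 (\<phi> t s)) has_field_derivative g2 s) (at 0)" by blast
    then show ?case
      by (intro exI[of _ "\<lambda>s. g1 s + g2 s"]) (auto intro!: cpf_intros derivative_intros)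
  next
    case (mult f1 f2)
    then obtain g1 g2 where "complex_polynomial_function g1" "complex_polynomial_function g2"
      "\<forall>s\<in>S. ((\<lambda>t. f1 (\<phi> t s)) has_field_derivative g1 s) (at 0)"
      "\<forall>s\<in>S. ((\<lambda>t. f2 (\<phi> t s)) has_field_derivative g2 s) (at 0)" by blast
    with mult.hyps show ?case
      by (intro exI[of _ "\<lambda>s. f1 s * g2 s + g1 s * f2 s"])
        (auto intro!: cpf_intros derivative_eq_intros simp: zero)
  qed
  have key: "\<exists>g. complex_polynomial_function g \<and> \<xi> f = restrict0 S g \<and>
      (\<forall>s\<in>S. ((\<lambda>t. f (\<phi> t s)) has_field_derivative g s) (at 0))"
    if f: "f \<in> regular_functions S" for f
  proof -
    obtain a where a: "complex_polynomial_function a" "f = restrict0 S a" using f by (rule regularE)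
    obtain g where g: "complex_polynomial_function g"
      "\<forall>s\<in>S. ((\<lambda>t. a (\<phi> t s)) has_field_derivative g s) (at 0)" using ex[OF a(1)] by blast
    have g': "((\<lambda>t. f (\<phi> t s)) has_field_derivative g s) (at 0)" if "s \<in> S" for s
      using g(2) that by (simp add: a(2) inv)
    then have "\<xi> f = restrict0 S g"
      using f by (auto simp: \<xi>_def fun_eq_iff restrict0_def intro: DERIV_imp_deriv)
    with g(1) g' show ?thesis by blast
  qed
  have val: "((\<lambda>t. f (\<phi> t s)) has_field_derivative \<xi> f s) (at 0)"
    if "f \<in> regular_functions S" "s \<in> S" for f s
    using key[OF that(1)] that(2) by auto
  have eqI: "\<xi> f = h" if f: "f \<in> regular_functions S" and h: "h \<in> regular_functions S"
    and d: "\<And>s. s \<in> S \<Longrightarrow> ((\<lambda>t. f (\<phi> t s)) has_field_derivative h s) (at 0)" for f h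
  proof
    fix s show "\<xi> f s = h s"
      using DERIV_unique[OF val[OF f] d] regular_out[OF h] by (cases "s \<in> S") (auto simp: \<xi>_def)
  qed
  have reg: "\<xi> f \<in> regular_functions S" if "f \<in> regular_functions S" for f
    using key[OF that] by (auto intro: regular)
  show "\<xi> \<in> alg_vector_fields S"
    unfolding alg_vector_fields_def mem_Collect_eq
  proof (intro conjI ballI allI impI)
    fix f assume "f \<notin> regular_functions S" then show "\<xi> f = (\<lambda>_. 0)" by (auto simp: \<xi>_def)
  next
    fix f g assume fg: "f \<in> regular_functions S" "g \<in> regular_functions S"
    show "\<xi> (\<lambda>s. f s + g s) = (\<lambda>s. \<xi> f s + \<xi> g s)"
      by (intro eqI regular_add reg fg) (auto intro!: derivative_eq_intros val fg)
    show "\<xi> (\<lambda>s. f s * g s) = (\<lambda>s. \<xi> f s * g s + f s * \<xi> g s)"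
      by (intro eqI regular_add regular_mult reg fg)
        (auto intro!: derivative_eq_intros val fg simp: zero)
  next
    fix f c assume f: "f \<in> regular_functions S"
    show "\<xi> (\<lambda>s. c * f s) = (\<lambda>s. c * \<xi> f s)"
      by (intro eqI regular_scale reg f) (auto intro!: derivative_eq_intros val f)
  qed (rule reg)
  show "complete_vf S \<xi>"
    unfolding complete_vf_def
  proof (intro exI[of _ \<phi>] conjI ballI val)
    show "holomorphic_action S \<phi>"
      unfolding holomorphic_action_def
    proof (intro conjI allI ballI)
      fix t s
      have "holomorphic_map_on (\<lambda>w. \<phi> (fst w) (snd w)) UNIV"
        by (rule holomorphic_map_componentwise) (rule entire)
      then show "\<exists>W F. open W \<and> (t, s) \<in> W \<and> holomorphic_map_on F W \<and>
          (\<forall>u. \<forall>r\<in>S. (u, r) \<in> W \<longrightarrow> F (u, r) = \<phi> u r)"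
        by (intro exI[of _ UNIV] exI[of _ "\<lambda>w. \<phi> (fst w) (snd w)"]) auto
    qed (auto simp: inv zero add)
  qed
  show "\<xi> (coordinate S i) = restrict0 S (V i)" for i
    by (intro eqI regular cpf V) (auto intro: deriv simp: inv)
qed

section \<open>The entire function (e^w - 1) / w and polynomial increments along
  exponentials\<close>

definition expm1_quot :: "complex \<Rightarrow> complex"
  where "expm1_quot w = (\<Sum>n. inverse (fact (Suc n)) * w ^ n)"

lemma expm1_quot_sums: "(\<lambda>n. inverse (fact (Suc n)) * w ^ n * w) sums (exp w - 1)"
  for w :: complex
proof -
  have "(\<lambda>n. inverse (fact n) * w ^ n) sums exp w"
  proof -
    have "w ^ n /\<^sub>R fact n = inverse (fact n) * w ^ n" for n
      by (simp add: scaleR_conv_of_real)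
    then show ?thesis using exp_converges[of w] by simp
  qed
  then have "(\<lambda>n. inverse (fact (Suc n)) * w ^ Suc n) sums (exp w - 1)"
    using sums_Suc_iff[of "\<lambda>n. inverse (fact n) * w ^ n" "exp w - 1"] by (simp del: fact_Suc power_Suc)
  then show ?thesis by (simp only: power_Suc2 mult.assoc)
qed

lemma expm1_quot_summable: "summable (\<lambda>n. inverse (fact (Suc n)) * w ^ n :: complex)"
proof (cases "w = 0")
  case False
  then show ?thesis
    using sums_mult2[OF expm1_quot_sums[of w], of "inverse w"] by (auto simp: sums_iff mult.assoc simp del: fact_Suc)
next
  case True
  show ?thesis unfolding True by (rule summable_finite[of "{0}"]) auto
qed

lemma expm1_quot_0 [simp]: "expm1_quot 0 = 1"
  using powser_zero[of "\<lambda>n. inverse (fact (Suc n)) :: complex"] by (simp add: expm1_quot_def del: fact_Suc)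

lemma expm1_quot_mult: "w * expm1_quot w = exp w - 1"
  using sums_unique2[OF expm1_quot_sums[of w] sums_mult2[OF summable_sums[OF expm1_quot_summable], of w w]]
  by (simp add: expm1_quot_def mult.commute del: fact_Suc)

lemma entire_expm1_quot: "entire f \<Longrightarrow> entire (\<lambda>w. expm1_quot (f w))"
  unfolding expm1_quot_def
  by (rule entire_compose)
    (auto intro!: termdiffs_strong_converges_everywhere expm1_quot_summable simp del: fact_Suc)

text \<open>\<open>synthetic_div r b\<close> at \<open>a\<close> is the divided difference of
  \<open>r\<close>, a polynomial in both points; on the diagonal it becomes the derivative, without
  any division.\<close>

lemma poly_diff_synthetic_div:
  fixes r :: "'a::comm_ring_1 poly"
  shows "poly r a - poly r b = (a - b) * poly (synthetic_div r b) a"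
proof (induction r)
  case (pCons c r)
  have "poly (pCons c r) a - poly (pCons c r) b
      = (a - b) * poly r b + a * (poly r a - poly r b)"
    by (simp add: algebra_simps)
  then show ?case by (simp add: pCons.IH algebra_simps)
qed simp

lemma poly_synthetic_div_same:
  fixes r :: "'a::{comm_ring_1,semiring_no_zero_divisors} poly"
  shows "poly (synthetic_div r a) a = poly (pderiv r) a"
  by (induction r) (auto simp: pderiv_pCons)

text \<open>The quotient \<open>(r(x) - r(x e\<^sup>u)) / (x u)\<close> extends to an entire function of \<open>(x, u)\<close>.\<close>

definition exp_increment :: "complex poly \<Rightarrow> complex \<Rightarrow> complex \<Rightarrow> complex"
  where "exp_increment r x u = - expm1_quot u * poly (synthetic_div r (x * exp u)) x"

lemma exp_increment_mult:
  "x * u * exp_increment r x u = poly r x - poly r (x * exp u)"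
proof -
  have "x - x * exp u = - x * (u * expm1_quot u)"
    unfolding expm1_quot_mult by (simp add: algebra_simps)
  then show ?thesis
    unfolding poly_diff_synthetic_div[of r x "x * exp u"] exp_increment_def by simp
qed

lemma exp_increment_0: "exp_increment r x 0 = - poly (pderiv r) x"
  by (simp add: exp_increment_def poly_synthetic_div_same)

text \<open>This is the group law of the mutation flow. Multiplied by v, both sides are increments
  of \<open>r\<close> telescoping along x, x e^(vu), x e^(v(t+u)). For v = 0 nothing can be
  cancelled, but then both sides are linear in time.\<close>

lemma exp_increment_add:
  "x * (t + u) * exp_increment r x (v * (t + u))
    = x * u * exp_increment r x (v * u) + x * exp (v * u) * t * exp_increment r (x * exp (v * u)) (v * t)"
proof (cases "v = 0")
  case True
  then show ?thesis by (simp add: algebra_simps)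
next
  case False
  have "v * (x * (t + u) * exp_increment r x (v * (t + u))) = poly r x - poly r (x * exp (v * (t + u)))"
    using exp_increment_mult[of x "v * (t + u)" r] by (simp add: mult_ac)
  moreover have "v * (x * u * exp_increment r x (v * u)) = poly r x - poly r (x * exp (v * u))"
    using exp_increment_mult[of x "v * u" r] by (simp add: mult_ac)
  moreover have "v * (x * exp (v * u) * t * exp_increment r (x * exp (v * u)) (v * t))
      = poly r (x * exp (v * u)) - poly r (x * exp (v * (t + u)))"
    using exp_increment_mult[of "x * exp (v * u)" "v * t" r]
    by (simp add: mult_ac exp_add[symmetric] algebra_simps)
  ultimately have "v * (x * (t + u) * exp_increment r x (v * (t + u)))
    = v * (x * u * exp_increment r x (v * u) + x * exp (v * u) * t * exp_increment r (x * exp (v * u)) (v * t))"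
    unfolding distrib_left[of v "_ * exp_increment _ _ _"] by simp
  then show ?thesis using False by simp
qed

lemma entire_exp_increment:
  "entire f \<Longrightarrow> entire g \<Longrightarrow> entire (\<lambda>w. exp_increment r (f w) (g w))"
  unfolding exp_increment_def
  by (intro entire_mult entire_uminus entire_expm1_quot entire_synthetic_div entire_exp)

lemmas entire_intros = entire_const entire_time entire_coord entire_add entire_mult entire_uminus
  entire_diff entire_power entire_poly entire_synthetic_div entire_exp entire_exp_increment

section \<open>The surface\<close>

text \<open>Statements symmetric in the two coordinates \<open>x\<close> and \<open>y\<close> are proved for an index pair
  \<open>(i, j)\<close> that is \<open>(1, 2)\<close> or \<open>(2, 1)\<close>.\<close>

definition xy_pair :: "3 \<Rightarrow> 3 \<Rightarrow> bool"
  where "xy_pair i j \<longleftrightarrow> i = 1 \<and> j = 2 \<or> i = 2 \<and> j = 1"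

lemma xy_pair_12: "xy_pair 1 2" and xy_pair_21: "xy_pair 2 1"
  by (auto simp: xy_pair_def)

lemma xy_pair_sym: "xy_pair i j \<Longrightarrow> xy_pair j i"
  by (auto simp: xy_pair_def)

lemma xy_pair_neq:
  assumes "xy_pair i j" shows "i \<noteq> j" "j \<noteq> i" "i \<noteq> 3" "j \<noteq> 3" "3 \<noteq> i" "3 \<noteq> j"
  using assms by (auto simp: xy_pair_def)

lemma all_xy_pair: "xy_pair i j \<Longrightarrow> (\<forall>k. Q k) \<longleftrightarrow> Q i \<and> Q j \<and> Q 3"
  by (auto simp: xy_pair_def forall_3)

definition point :: "3 \<Rightarrow> 3 \<Rightarrow> complex \<Rightarrow> complex \<Rightarrow> complex \<Rightarrow> complex ^ 3"
  where "point i j a b c = (\<chi> k. if k = i then a else if k = j then b else c)"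

lemma point_nth [simp]:
  "point i j a b c $ i = a"
  "xy_pair i j \<Longrightarrow> point i j a b c $ j = b"
  "xy_pair i j \<Longrightarrow> point i j a b c $ 3 = c"
  by (auto simp: point_def dest: xy_pair_neq)

lemma xy_pair_eqI:
  "xy_pair i j \<Longrightarrow> s $ i = r $ i \<Longrightarrow> s $ j = r $ j \<Longrightarrow> s $ 3 = r $ 3 \<Longrightarrow> s = r"
  by (simp add: vec_eq_iff all_xy_pair[of i j])

locale simple_root_surface =
  fixes p q :: "complex poly"
  assumes p_0: "poly p 0 = 0" and q_0: "poly q 0 = 0"
    and p_simple: "poly p a = 1 \<Longrightarrow> poly (pderiv p) a \<noteq> 0"
    and q_simple: "poly q a = 1 \<Longrightarrow> poly (pderiv q) a \<noteq> 0"
begin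

abbreviation S :: "(complex ^ 3) set"
  where "S \<equiv> surface p q"

definition P :: "3 \<Rightarrow> complex poly"
  where "P k = (if k = 1 then p else q)"

definition P\<^sub>1 :: "3 \<Rightarrow> complex poly"
  where "P\<^sub>1 k = synthetic_div (P k) 0"

lemma P_0: "poly (P k) 0 = 0"
  by (simp add: P_def p_0 q_0)

lemma P_simple: "poly (P k) a = 1 \<Longrightarrow> poly (pderiv (P k)) a \<noteq> 0"
  by (simp add: P_def p_simple q_simple split: if_splits)

lemma P_eq: "poly (P k) a = a * poly (P\<^sub>1 k) a"
  using poly_diff_synthetic_div[of "P k" a 0] by (simp add: P_0 P\<^sub>1_def)

lemma P_eq_pCons: "P k = pCons 0 (P\<^sub>1 k)"
  using synthetic_div_correct[of "P k" 0] by (simp add: P_0 P\<^sub>1_def)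

lemma pderiv_P: "poly (pderiv (P k)) a = poly (P\<^sub>1 k) a + a * poly (pderiv (P\<^sub>1 k)) a"
  by (simp add: P_eq_pCons pderiv_pCons)

lemma mem_S:
  "xy_pair i j \<Longrightarrow> s \<in> S \<longleftrightarrow> poly (P i) (s $ i) + poly (P j) (s $ j) + s $ i * s $ j * s $ 3 = 1"
  by (auto simp: xy_pair_def surface_def P_def algebra_simps)

definition torus :: "(complex ^ 3) set"
  where "torus = {s \<in> S. s $ 1 * s $ 2 \<noteq> 0}"

lemma mem_torus: "xy_pair i j \<Longrightarrow> s \<in> torus \<longleftrightarrow> s \<in> S \<and> s $ i \<noteq> 0 \<and> s $ j \<noteq> 0"
  by (auto simp: xy_pair_def torus_def)

lemma torus_S: "s \<in> torus \<Longrightarrow> s \<in> S"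
  by (simp add: torus_def)

text \<open>A point with \<open>x = 0\<close> is the limit of torus points along \<open>t \<mapsto> (t, b + \<sigma> t, z(t))\<close>; the simple
  root \<open>b\<close> of \<open>1 - q\<close> makes it possible to choose the slope \<open>\<sigma>\<close> so that \<open>z(0)\<close> is prescribed.\<close>

lemma torus_approximation:
  assumes ij: "xy_pair i j" and s: "s \<in> S" "s $ i = 0"
  obtains c where "c 0 = s" "isCont c 0" "eventually (\<lambda>t. c t \<in> torus) (at (0::complex))"
proof -
  define b where "b = s $ j"
  have b1: "poly (P j) b = 1" using s by (simp add: mem_S[OF ij] P_0 b_def)
  then have b0: "b \<noteq> 0" using P_0 by auto
  \<comment> \<open>The slope that solves z(0) = s $ 3 below; the simple root makes its denominator
    nonzero.\<close>
  define \<sigma> where "\<sigma> = - (b * s $ 3 + poly (P\<^sub>1 i) 0) / poly (pderiv (P j)) b"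
  have \<sigma>: "poly (P\<^sub>1 i) 0 + \<sigma> * poly (pderiv (P j)) b = - b * s $ 3"
    using P_simple[OF b1] by (simp add: \<sigma>_def)
  \<comment> \<open>The equation of \<open>S\<close> solved for z along the curve. Because P j(b) =
    1 and P i(0) = 0, the numerator contains a factor t that cancels the t of x_i, so no pole
    remains at t = 0.\<close>
  define z where
    "z t = - (poly (P\<^sub>1 i) t + \<sigma> * poly (synthetic_div (P j) b) (b + \<sigma> * t)) / (b + \<sigma> * t)" for t
  define c where "c t = point i j t (b + \<sigma> * t) (z t)" for t
  have z0: "z 0 = s $ 3" unfolding z_def using \<sigma> b0 by (simp add: poly_synthetic_div_same)
  have c0: "c 0 = s"
    using s z0 by (intro xy_pair_eqI[OF ij]) (auto simp: c_def ij b_def)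
  have z: "isCont z 0" unfolding z_def using b0 by (intro continuous_intros) auto
  have "((\<lambda>t. \<chi> k. if k = i then t else if k = j then b + \<sigma> * t else z t)
      \<longlongrightarrow> (\<chi> k. if k = i then 0 else if k = j then b + \<sigma> * 0 else z 0)) (at 0)"
    using z by (intro tendsto_vec_lambda) (auto intro!: tendsto_eq_intros simp: isCont_def)
  then have cont: "isCont c 0" by (simp add: c_def[abs_def] point_def isCont_def)
  have "((\<lambda>t. b + \<sigma> * t) \<longlongrightarrow> b + \<sigma> * 0) (at 0)" by (intro tendsto_intros)
  then have "eventually (\<lambda>t. b + \<sigma> * t \<noteq> 0) (at 0)"
    using b0 by (intro tendsto_imp_eventually_ne) auto
  moreover have "eventually (\<lambda>t::complex. t \<noteq> 0) (at 0)" by (rule eventually_neq_at_within)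
  ultimately have "eventually (\<lambda>t. c t \<in> torus) (at 0)"
  proof eventually_elim
    case (elim t)
    have "(b + \<sigma> * t) * z t = - (poly (P\<^sub>1 i) t + \<sigma> * poly (synthetic_div (P j) b) (b + \<sigma> * t))"
      using elim by (simp add: z_def)
    moreover have "poly (P j) (b + \<sigma> * t) = 1 + \<sigma> * t * poly (synthetic_div (P j) b) (b + \<sigma> * t)"
      using poly_diff_synthetic_div[of "P j" "b + \<sigma> * t" b] b1 by (simp add: algebra_simps)
    ultimately have "poly (P i) t + poly (P j) (b + \<sigma> * t) + t * (b + \<sigma> * t) * z t = 1"
      by (simp add: P_eq[of i] mult.assoc) (simp add: algebra_simps)
    then show ?case using elim by (simp add: mem_torus[OF ij] mem_S[OF ij] c_def ij)
  qed
  with c0 cont show ?thesis by (rule that)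
qed

text \<open>Density of the torus: a point of \<open>S\<close> outside it has x = 0 or y = 0, and
  \<open>torus_approximation\<close> covers both cases by symmetry.\<close>

lemma eq_on_S:
  fixes f g :: "complex ^ 3 \<Rightarrow> complex"
  assumes cont: "\<And>s. isCont f s" "\<And>s. isCont g s"
    and eq: "\<And>s. s \<in> torus \<Longrightarrow> f s = g s" and s: "s \<in> S"
  shows "f s = g s"
proof (cases "s \<in> torus")
  case False
  then obtain i j where ij: "xy_pair i j" "s $ i = 0"
    using s xy_pair_12 xy_pair_21 by (auto simp: torus_def)
  obtain c where c: "c 0 = s" "isCont c 0" "eventually (\<lambda>t. c t \<in> torus) (at (0::complex))"
    using torus_approximation[OF ij(1) s ij(2)] .
  have lim: "((\<lambda>t. f (c t)) \<longlongrightarrow> f s) (at 0)" "((\<lambda>t. g (c t)) \<longlongrightarrow> g s) (at 0)"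
    using isCont_o2[OF c(2), of f] isCont_o2[OF c(2), of g] cont by (auto simp: isCont_def c(1))
  have "eventually (\<lambda>t. f (c t) = g (c t)) (at 0)"
    using c(3) by eventually_elim (rule eq)
  from tendsto_cong[OF this] lim(2) have "((\<lambda>t. f (c t)) \<longlongrightarrow> g s) (at 0)" by simp
  from tendsto_unique[OF at_neq_bot lim(1) this] show ?thesis .
qed (rule eq)

lemma regular_eqI:
  assumes f: "f \<in> regular_functions S" and g: "g \<in> regular_functions S"
    and eq: "\<And>s. s \<in> torus \<Longrightarrow> f s = g s"
  shows "f = g"
proof
  fix s
  obtain a b where ab: "complex_polynomial_function a" "f = restrict0 S a"
    "complex_polynomial_function b" "g = restrict0 S b" using f g by (auto elim!: regularE)
  show "f s = g s"
  proof (cases "s \<in> S")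
    case True
    then show ?thesis
      using eq_on_S[of a b s] ab eq torus_S cpf_isCont by auto
  qed (simp add: ab)
qed

section \<open>Complete fields on the surface\<close>

text \<open>The time law for z is asked on the torus only. There it follows from the laws for x and
  y by solving an equation for z, and continuity extends it to \<open>S\<close>.\<close>

lemma surface_flow:
  assumes ij: "xy_pair i j"
    and entire: "entire (\<lambda>w. X (fst w) (snd w))" "entire (\<lambda>w. Y (fst w) (snd w))"
      "entire (\<lambda>w. Z (fst w) (snd w))"
    and inv: "\<And>t s. s \<in> S \<Longrightarrow> point i j (X t s) (Y t s) (Z t s) \<in> S"
    and zero: "\<And>s. X 0 s = s $ i" "\<And>s. Y 0 s = s $ j" "\<And>s. Z 0 s = s $ 3"
    and X_add: "\<And>t u s. s \<in> S \<Longrightarrow> X (t + u) s = X t (point i j (X u s) (Y u s) (Z u s))"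
    and Y_add: "\<And>t u s. s \<in> S \<Longrightarrow> Y (t + u) s = Y t (point i j (X u s) (Y u s) (Z u s))"
    and Z_add: "\<And>t u s. s \<in> torus \<Longrightarrow> Z (t + u) s = Z t (point i j (X u s) (Y u s) (Z u s))"
    and V: "complex_polynomial_function VX" "complex_polynomial_function VY"
      "complex_polynomial_function VZ"
    and deriv: "\<And>s. s \<in> S \<Longrightarrow> ((\<lambda>t. X t s) has_field_derivative VX s) (at 0)"
      "\<And>s. s \<in> S \<Longrightarrow> ((\<lambda>t. Y t s) has_field_derivative VY s) (at 0)"
      "\<And>s. s \<in> S \<Longrightarrow> ((\<lambda>t. Z t s) has_field_derivative VZ s) (at 0)"
  obtains \<xi> where "\<xi> \<in> alg_vector_fields S" "complete_vf S \<xi>"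
    "\<xi> (coordinate S i) = restrict0 S VX" "\<xi> (coordinate S j) = restrict0 S VY"
proof -
  define \<phi> where "\<phi> t s = point i j (X t s) (Y t s) (Z t s)" for t s
  define V where "V k = (if k = i then VX else if k = j then VY else VZ)" for k
  have V_nth: "V i = VX" "V j = VY" "V 3 = VZ" using xy_pair_neq[OF ij] by (auto simp: V_def)
  have nth: "\<phi> t s $ i = X t s" "\<phi> t s $ j = Y t s" "\<phi> t s $ 3 = Z t s" for t s
    by (auto simp: \<phi>_def ij)
  have \<phi>_entire: "\<forall>k. entire (\<lambda>w. \<phi> (fst w) (snd w) $ k)"
    unfolding all_xy_pair[OF ij] nth using entire by blast
  have cont: "isCont (\<lambda>s. \<phi> t s) s" for t s
  proof -
    have "\<forall>k. ((\<lambda>s. \<phi> t s $ k) \<longlongrightarrow> \<phi> t s $ k) (at s)"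
      using entire_continuous[of "\<lambda>w. \<phi> (fst w) (snd w) $ k" s t for k] \<phi>_entire
      by (simp add: isCont_def)
    then show ?thesis unfolding isCont_def by (intro vec_tendstoI) blast
  qed
  have Z_add': "Z (t + u) s = Z t (\<phi> u s)" if "s \<in> S" for t u s
  proof (rule eq_on_S[OF _ _ _ that])
    have Z_cont: "isCont (\<lambda>s. Z t s) s" for t s
      using entire_continuous[OF entire(3), of s t] by simp
    then show "isCont (\<lambda>s. Z (t + u) s) s" "isCont (\<lambda>s. Z t (\<phi> u s)) s" for s
      using isCont_o2[OF cont Z_cont] by auto
  qed (use Z_add in \<open>simp add: \<phi>_def\<close>)
  have V_cpf: "\<forall>k. complex_polynomial_function (V k)"
    unfolding all_xy_pair[OF ij] V_nth using V by blast
  have V_deriv: "\<forall>k. ((\<lambda>t. \<phi> t s $ k) has_field_derivative V k s) (at 0)" if "s \<in> S" for s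
    unfolding all_xy_pair[OF ij] V_nth nth using deriv[OF that] by blast
  have \<phi>_add: "\<phi> (t + u) s = \<phi> t (\<phi> u s)" if "s \<in> S" for t u s
    using X_add[OF that] Y_add[OF that] Z_add'[OF that]
    by (intro xy_pair_eqI[OF ij]) (simp_all only: nth \<phi>_def[symmetric])
  have \<phi>_0: "\<phi> 0 s = s" for s
    using zero by (intro xy_pair_eqI[OF ij]) (simp_all add: nth)
  have \<phi>_S: "\<phi> t s \<in> S" if "s \<in> S" for t s
    using inv[OF that] by (simp add: \<phi>_def)
  obtain \<xi> where "\<xi> \<in> alg_vector_fields S" "complete_vf S \<xi>"
    "\<And>k. \<xi> (coordinate S k) = restrict0 S (V k)"
    using complete_field_of_flow[of \<phi> S V, OF spec[OF \<phi>_entire] \<phi>_S \<phi>_0 \<phi>_add spec[OF V_cpf]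
        spec[OF V_deriv]] by blast
  then show ?thesis using that V_nth by metis
qed

text \<open>The Hamiltonian flow of x_i^n fixes x_i and multiplies x_j by e^(mt), with m = n x_i^n
  constant in time. The equation of \<open>S\<close> then dictates z.\<close>

lemma complete_field_power:
  assumes ij: "xy_pair i j" and n: "n > 0"
  obtains \<xi> where "\<xi> \<in> alg_vector_fields S" "complete_vf S \<xi>"
    "\<xi> (coordinate S i) = restrict0 S (\<lambda>_. 0)"
    "\<xi> (coordinate S j) = restrict0 S (\<lambda>s. of_nat n * s $ i ^ n * s $ j)"
proof -
  define X :: "complex \<Rightarrow> complex ^ 3 \<Rightarrow> complex" where "X t s = s $ i" for t s
  define m where "m s = of_nat n * s $ i ^ n" for s :: "complex ^ 3"
  define Y where "Y t s = s $ j * exp (m s * t)" for t s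
  \<comment> \<open>The product x y z has to grow by P j(y) - P j(y e^(mt)) = y m t times
    \<open>exp_increment\<close> (here y is x_j). Dividing by x y e^(mt) leaves n x^(n-1) t, which
    is why n > 0 matters.\<close>
  define Z where "Z t s = exp (- m s * t) *
    (s $ 3 + of_nat n * s $ i ^ (n - 1) * t * exp_increment (P j) (s $ j) (m s * t))" for t s
  have n': "s $ i * s $ i ^ (n - 1) = s $ i ^ n" for s :: "complex ^ 3"
    using n by (cases n) auto
  have XYZ: "X t s * Y t s * Z t s
      = s $ i * s $ j * s $ 3 + (poly (P j) (s $ j) - poly (P j) (Y t s))" for t s
  proof -
    have "exp (m s * t) * exp (- m s * t) = 1" by (simp add: exp_add[symmetric])
    then have "X t s * Y t s * Z t s = s $ i * s $ j *
        (s $ 3 + of_nat n * s $ i ^ (n - 1) * t * exp_increment (P j) (s $ j) (m s * t))"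
      unfolding X_def Y_def Z_def by (simp add: mult_ac)
    also have "\<dots> = s $ i * s $ j * s $ 3
        + s $ j * (of_nat n * (s $ i * s $ i ^ (n - 1)) * t) * exp_increment (P j) (s $ j) (m s * t)"
      by (simp add: algebra_simps)
    also have "\<dots> = s $ i * s $ j * s $ 3 + (poly (P j) (s $ j) - poly (P j) (Y t s))"
      unfolding n' using exp_increment_mult[of "s $ j" "m s * t" "P j"] by (simp add: Y_def m_def)
    finally show ?thesis .
  qed
  have inv: "point i j (X t s) (Y t s) (Z t s) \<in> S" if "s \<in> S" for t s
    using that XYZ[of t s] by (simp add: mem_S[OF ij] ij) (simp add: X_def add_ac)
  have m: "m (point i j (X t s) b c) = m s" for t s b c by (simp add: m_def X_def)
  have Y_add: "Y (t + u) s = Y t (point i j (X u s) (Y u s) (Z u s))" for t u s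
    unfolding Y_def m using ij by (simp add: distrib_left exp_add)
  have Z_add: "Z (t + u) s = Z t (point i j (X u s) (Y u s) (Z u s))" if s: "s \<in> torus" for t u s
  proof -
    let ?r = "point i j (X u s) (Y u s) (Z u s)"
    have S: "s \<in> S" "?r \<in> S" using s inv torus_S by auto
    have XY: "X (t + u) s = X t ?r" "Y (t + u) s = Y t ?r" using Y_add by (auto simp: X_def)
    have "X t r * Y t r * Z t r = 1 - poly (P i) (X t r) - poly (P j) (Y t r)" if "r \<in> S" for t r
      using inv[OF that, of t] by (simp add: mem_S[OF ij] ij algebra_simps)
    from this[OF S(1), of "t + u"] this[OF S(2), of t]
    have "X (t + u) s * Y (t + u) s * Z (t + u) s = X (t + u) s * Y (t + u) s * Z t ?r"
      unfolding XY by simp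
    moreover have "X (t + u) s * Y (t + u) s \<noteq> 0"
      using s by (simp add: X_def Y_def mem_torus[OF ij])
    ultimately show ?thesis by simp
  qed
  show ?thesis
  proof (rule surface_flow[OF ij, of X Y Z "\<lambda>_. 0" "\<lambda>s. of_nat n * s $ i ^ n * s $ j"
        "\<lambda>s. - m s * s $ 3 - of_nat n * s $ i ^ (n - 1) * poly (pderiv (P j)) (s $ j)"])
    show "entire (\<lambda>w. X (fst w) (snd w))" "entire (\<lambda>w. Y (fst w) (snd w))"
      "entire (\<lambda>w. Z (fst w) (snd w))"
      unfolding X_def Y_def Z_def m_def by (intro entire_intros)+
    show "((\<lambda>t. X t s) has_field_derivative 0) (at 0)" for s by (simp add: X_def)
    show "((\<lambda>t. Y t s) has_field_derivative of_nat n * s $ i ^ n * s $ j) (at 0)" for s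
      unfolding Y_def by (auto intro!: derivative_eq_intros simp: m_def)
    show "((\<lambda>t. Z t s) has_field_derivative
      - m s * s $ 3 - of_nat n * s $ i ^ (n - 1) * poly (pderiv (P j)) (s $ j)) (at 0)" for s
    proof -
      have "entire (\<lambda>w :: complex \<times> (complex ^ 3). exp_increment (P j) (s $ j) (m s * fst w))"
        by (intro entire_intros)
      from entire_time_deriv[OF this, of s 0]
      obtain D where "((\<lambda>t. exp_increment (P j) (s $ j) (m s * t)) has_field_derivative D) (at 0)"
        by auto
      then show ?thesis
        unfolding Z_def by (auto intro!: derivative_eq_intros simp: exp_increment_0)
    qed
  qed (use that inv Y_add Z_add in \<open>auto simp: X_def Y_def Z_def m_def intro!: cpf\<close>)
qed

text \<open>The Hamiltonian v = (1 - P i(x_i)) / x_j is constant along its own flow, so x_i moves by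
  e^(vt). The relation P i(x_i) + x_j v = 1 then determines x_j, and the definition of v determines
  z.\<close>

lemma complete_field_mutation:
  assumes ij: "xy_pair i j"
  obtains \<xi> where "\<xi> \<in> alg_vector_fields S" "complete_vf S \<xi>"
    "\<xi> (coordinate S i) = restrict0 S (\<lambda>s. s $ i * (poly (P\<^sub>1 j) (s $ j) + s $ i * s $ 3))"
    "\<xi> (coordinate S j) = restrict0 S (\<lambda>s. - s $ i * poly (pderiv (P i)) (s $ i))"
proof -
  define v where "v s = poly (P\<^sub>1 j) (s $ j) + s $ i * s $ 3" for s :: "complex ^ 3"
  define X where "X t s = s $ i * exp (v s * t)" for t s
  \<comment> \<open>The increment is (P i(x) - P i(x e^(vt))) / v, written so that it makes sense at
    v = 0.\<close>
  define Y where "Y t s = s $ j + s $ i * t * exp_increment (P i) (s $ i) (v s * t)" for t s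
  \<comment> \<open>Constancy of v prescribes X Z. The divided difference of
    \<open>P\<^sub>1 j\<close> brings out the factor s $ j - Y, which contains s $ i and so is
    divisible by X.\<close>
  define Z where "Z t s = exp (- v s * t) * (s $ 3 - t * exp_increment (P i) (s $ i) (v s * t) *
    poly (synthetic_div (P\<^sub>1 j) (Y t s)) (s $ j))" for t s
  define \<phi> where "\<phi> t s = point i j (X t s) (Y t s) (Z t s)" for t s
  have nth: "\<phi> t s $ i = X t s" "\<phi> t s $ j = Y t s" "\<phi> t s $ 3 = Z t s" for t s
    by (auto simp: \<phi>_def ij)
  have XZ: "X t s * Z t s = s $ i * s $ 3 + (poly (P\<^sub>1 j) (s $ j) - poly (P\<^sub>1 j) (Y t s))" for t s
  proof -
    have "exp (v s * t) * exp (- v s * t) = 1" by (simp add: exp_add[symmetric])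
    then have "X t s * Z t s = s $ i * (s $ 3 - t * exp_increment (P i) (s $ i) (v s * t) *
        poly (synthetic_div (P\<^sub>1 j) (Y t s)) (s $ j))"
      unfolding X_def Z_def by (simp add: mult_ac)
    also have "\<dots> = s $ i * s $ 3 + (s $ j - Y t s) * poly (synthetic_div (P\<^sub>1 j) (Y t s)) (s $ j)"
      by (simp add: Y_def algebra_simps)
    finally show ?thesis unfolding poly_diff_synthetic_div .
  qed
  have v: "v (\<phi> t s) = v s" for t s
    using XZ[of t s] by (simp add: v_def nth)
  have S_iff: "s \<in> S \<longleftrightarrow> poly (P i) (s $ i) + s $ j * v s = 1" for s
    by (simp add: mem_S[OF ij] v_def P_eq[of j] algebra_simps)
  have inv: "\<phi> t s \<in> S" if "s \<in> S" for t s
  proof -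
    have "Y t s * v s = s $ j * v s + (poly (P i) (s $ i) - poly (P i) (X t s))"
      using exp_increment_mult[of "s $ i" "v s * t" "P i"] by (simp add: X_def Y_def algebra_simps)
    then show ?thesis using that by (simp add: S_iff v) (simp add: nth add_ac)
  qed
  have X_add: "X (t + u) s = X t (\<phi> u s)" for t u s
    unfolding X_def v nth by (simp add: distrib_left exp_add)
  have Y_add: "Y (t + u) s = Y t (\<phi> u s)" for t u s
    unfolding Y_def v nth using exp_increment_add[of "s $ i" t u "P i" "v s"] by (simp add: X_def)
  have Z_add: "Z (t + u) s = Z t (\<phi> u s)" if s: "s \<in> torus" for t u s
  proof -
    have eq: "X t s * Z t s = v s - poly (P\<^sub>1 j) (Y t s)" for t s
      using XZ[of t s] by (simp add: v_def)
    have "X (t + u) s * Z (t + u) s = X (t + u) s * Z t (\<phi> u s)"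
      using eq[of "t + u" s] eq[of t "\<phi> u s"] unfolding X_add Y_add v by simp
    moreover have "X (t + u) s \<noteq> 0" using s by (simp add: X_def mem_torus[OF ij])
    ultimately show ?thesis by simp
  qed
  have D: "\<exists>D. ((\<lambda>t. exp_increment (P i) (s $ i) (v s * t)) has_field_derivative D) (at 0)" for s
  proof -
    have "entire (\<lambda>w :: complex \<times> (complex ^ 3). exp_increment (P i) (s $ i) (v s * fst w))"
      by (intro entire_intros)
    from entire_time_deriv[OF this, of s 0] show ?thesis by auto
  qed
  show ?thesis
  proof (rule surface_flow[OF ij, of X Y Z "\<lambda>s. s $ i * (poly (P\<^sub>1 j) (s $ j) + s $ i * s $ 3)"
        "\<lambda>s. - s $ i * poly (pderiv (P i)) (s $ i)"
        "\<lambda>s. - v s * s $ 3 + poly (pderiv (P i)) (s $ i) * poly (pderiv (P\<^sub>1 j)) (s $ j)"])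
    show "entire (\<lambda>w. X (fst w) (snd w))" "entire (\<lambda>w. Y (fst w) (snd w))"
      "entire (\<lambda>w. Z (fst w) (snd w))"
      unfolding X_def Y_def Z_def v_def by (intro entire_intros)+
    show "((\<lambda>t. X t s) has_field_derivative s $ i * (poly (P\<^sub>1 j) (s $ j) + s $ i * s $ 3)) (at 0)" for s
      unfolding X_def by (auto intro!: derivative_eq_intros simp: v_def)
    show "((\<lambda>t. Y t s) has_field_derivative - s $ i * poly (pderiv (P i)) (s $ i)) (at 0)" for s
      using D[of s] unfolding Y_def by (auto intro!: derivative_eq_intros simp: exp_increment_0)
    show "((\<lambda>t. Z t s) has_field_derivative
        - v s * s $ 3 + poly (pderiv (P i)) (s $ i) * poly (pderiv (P\<^sub>1 j)) (s $ j)) (at 0)" for s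
    proof -
      have "entire (\<lambda>w :: complex \<times> (complex ^ 3). poly (synthetic_div (P\<^sub>1 j)
          (s $ j + s $ i * fst w * exp_increment (P i) (s $ i) (v s * fst w))) (s $ j))"
        by (intro entire_intros)
      from entire_time_deriv[OF this, of s 0]
      obtain E where "((\<lambda>t. poly (synthetic_div (P\<^sub>1 j) (Y t s)) (s $ j)) has_field_derivative E) (at 0)"
        unfolding Y_def by auto
      moreover have "Y 0 s = s $ j" by (simp add: Y_def)
      ultimately show ?thesis
        using D[of s] unfolding Z_def
        by (auto intro!: derivative_eq_intros simp: exp_increment_0 poly_synthetic_div_same)
    qed
    show "complex_polynomial_function
        (\<lambda>s. - v s * s $ 3 + poly (pderiv (P i)) (s $ i) * poly (pderiv (P\<^sub>1 j)) (s $ j))"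
      unfolding v_def by (intro cpf)
    show "X 0 s = s $ i" "Y 0 s = s $ j" "Z 0 s = s $ 3" for s
      by (auto simp: X_def Y_def Z_def)
  qed (use that inv X_add Y_add Z_add in \<open>auto simp: \<phi>_def intro!: cpf\<close>)
qed

text \<open>If \<open>P i\<close> vanishes, x_i enters the equation only through the product x_i z,
  which is preserved when x_i is scaled by e^t and z by e^(-t).\<close>

lemma complete_field_linear:
  assumes ij: "xy_pair i j" and P: "P i = 0"
  obtains \<xi> where "\<xi> \<in> alg_vector_fields S" "complete_vf S \<xi>"
    "\<xi> (coordinate S i) = restrict0 S (\<lambda>s. s $ i)"
    "\<xi> (coordinate S j) = restrict0 S (\<lambda>_. 0)"
proof -
  define X where "X t s = s $ i * exp t" for t and s :: "complex ^ 3"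
  define Y where "Y t s = s $ j" for t :: complex and s :: "complex ^ 3"
  define Z where "Z t s = s $ 3 * exp (- t)" for t and s :: "complex ^ 3"
  have inv: "point i j (X t s) (Y t s) (Z t s) \<in> S" if "s \<in> S" for t s
  proof -
    have "exp t * exp (- t) = 1" by (simp add: exp_add[symmetric])
    moreover have "X t s * Y t s * Z t s = s $ i * s $ j * s $ 3 * (exp t * exp (- t))"
      by (simp add: X_def Y_def Z_def mult_ac)
    ultimately show ?thesis
      using that by (simp add: mem_S[OF ij] ij P) (simp add: Y_def)
  qed
  show ?thesis
  proof (rule surface_flow[OF ij, of X Y Z "\<lambda>s. s $ i" "\<lambda>_. 0" "\<lambda>s. - s $ 3"])
    show "entire (\<lambda>w. X (fst w) (snd w))" "entire (\<lambda>w. Y (fst w) (snd w))"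
      "entire (\<lambda>w. Z (fst w) (snd w))"
      unfolding X_def Y_def Z_def by (intro entire_intros)+
    show "X (t + u) s = X t (point i j (X u s) (Y u s) (Z u s))"
      "Z (t + u) s = Z t (point i j (X u s) (Y u s) (Z u s))" for t u s
      by (auto simp: X_def Z_def ij exp_add exp_minus exp_diff field_simps)
  qed (use that inv ij in \<open>auto simp: X_def Y_def Z_def intro!: cpf derivative_eq_intros\<close>)
qed

section \<open>Derivatives in the torus chart\<close>

definition other :: "3 \<Rightarrow> 3"
  where "other i = (if i = 1 then 2 else 1)"

lemma other: "xy_pair i j \<Longrightarrow> other i = j" "xy_pair i j \<Longrightarrow> other j = i"
  by (auto simp: other_def xy_pair_def)

text \<open>The coordinate line of the torus through \<open>s\<close>, with z solved from the
  equation. \<open>other\<close> supplies the second index of the pair, so that one index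
  suffices.\<close>

definition chart_curve :: "3 \<Rightarrow> complex ^ 3 \<Rightarrow> complex \<Rightarrow> complex ^ 3"
  where "chart_curve i s t = point i (other i) (s $ i + t) (s $ other i)
    ((1 - poly (P i) (s $ i + t) - poly (P (other i)) (s $ other i)) / ((s $ i + t) * s $ other i))"

text \<open>A partial derivative in the torus coordinates x, y, where z counts as a function of
  them; it is not the partial derivative in the ambient space.\<close>

definition chart_deriv :: "3 \<Rightarrow> (complex ^ 3 \<Rightarrow> complex) \<Rightarrow> complex ^ 3 \<Rightarrow> complex"
  where "chart_deriv i f s = deriv (\<lambda>t. f (chart_curve i s t)) 0"

text \<open>The ambient partial derivative of the defining polynomial: \<open>F 1\<close> and
  \<open>F 2\<close> are \<open>F\<^sub>x\<close> and \<open>F\<^sub>y\<close> of the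
  overview.\<close>

definition F :: "3 \<Rightarrow> complex ^ 3 \<Rightarrow> complex"
  where "F i s = poly (pderiv (P i)) (s $ i) + s $ other i * s $ 3"

lemma chart_curve_eq:
  assumes ij: "xy_pair i j"
  shows "chart_curve i s t = point i j (s $ i + t) (s $ j)
    ((1 - poly (P i) (s $ i + t) - poly (P j) (s $ j)) / ((s $ i + t) * s $ j))"
  by (simp add: chart_curve_def other[OF ij])

lemma F_eq: "xy_pair i j \<Longrightarrow> F i s = poly (pderiv (P i)) (s $ i) + s $ j * s $ 3"
  by (simp add: F_def other(1)[of i j])

lemma z_eq:
  assumes ij: "xy_pair i j" and s: "s \<in> torus"
  shows "s $ 3 = (1 - poly (P i) (s $ i) - poly (P j) (s $ j)) / (s $ i * s $ j)"
  using s unfolding mem_torus[OF ij] mem_S[OF ij] by (auto simp: field_simps)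

lemma chart_curve_0:
  assumes ij: "xy_pair i j" and s: "s \<in> torus"
  shows "chart_curve i s 0 = s"
  using z_eq[OF ij s] ij by (intro xy_pair_eqI[OF ij]) (simp_all add: chart_curve_eq[OF ij])

lemma chart_curve_torus:
  assumes ij: "xy_pair i j" and s: "s \<in> torus"
  shows "eventually (\<lambda>t. chart_curve i s t \<in> torus) (nhds 0)"
proof -
  have "((\<lambda>t. s $ i + t) \<longlongrightarrow> s $ i + 0) (nhds 0)"
    by (intro tendsto_intros filterlim_ident)
  then have "eventually (\<lambda>t. s $ i + t \<noteq> 0) (nhds 0)"
    using s by (intro tendsto_imp_eventually_ne) (auto simp: mem_torus[OF ij])
  then show ?thesis
    by eventually_elim (use s in \<open>auto simp: mem_torus[OF ij] mem_S[OF ij] chart_curve_eq[OF ij] ij\<close>)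
qed

lemma chart_deriv_z_aux:
  assumes ij: "xy_pair i j" and s: "s \<in> torus"
  shows "((\<lambda>t. chart_curve i s t $ 3) has_field_derivative - F i s / (s $ i * s $ j)) (at 0)"
proof -
  have nz: "s $ i \<noteq> 0" "s $ j \<noteq> 0" using s by (auto simp: mem_torus[OF ij])
  define c where "c = 1 - poly (P j) (s $ j)"
  have c: "c = s $ i * s $ j * s $ 3 + poly (P i) (s $ i)"
    using s by (simp add: mem_torus[OF ij] mem_S[OF ij] c_def algebra_simps)
  have "((\<lambda>t. (c - poly (P i) (s $ i + t)) / ((s $ i + t) * s $ j)) has_field_derivative
      (- poly (pderiv (P i)) (s $ i) * (s $ i * s $ j) - (c - poly (P i) (s $ i)) * s $ j)
        / ((s $ i * s $ j) * (s $ i * s $ j))) (at 0)"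
    by (rule derivative_eq_intros DERIV_chain2[OF poly_DERIV] | use nz in simp)+
  also have "(- poly (pderiv (P i)) (s $ i) * (s $ i * s $ j) - (c - poly (P i) (s $ i)) * s $ j)
        / ((s $ i * s $ j) * (s $ i * s $ j)) = - F i s / (s $ i * s $ j)"
    using nz unfolding c F_eq[OF ij] by (simp add: field_simps)
  finally show ?thesis
    by (simp add: chart_curve_eq[OF ij] ij c_def algebra_simps)
qed

lemma chart_deriv_exists:
  assumes f: "complex_polynomial_function f" and ij: "xy_pair i j" and s: "s \<in> torus"
  shows "\<exists>D. ((\<lambda>t. f (chart_curve i s t)) has_field_derivative D) (at 0)"
  using f
proof induction
  case (coord k)
  consider "k = i" | "k = j" | "k = 3" using ij exhaust_3[of k] by (auto simp: xy_pair_def)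
  then show ?case
  proof cases
    case 3 then show ?thesis using chart_deriv_z_aux[OF ij s] by blast
  qed (auto simp: chart_curve_eq[OF ij] ij intro!: exI derivative_eq_intros)
next
  case (add f g)
  then show ?case using DERIV_add by blast
next
  case (mult f g)
  then show ?case using DERIV_mult by blast
qed (auto intro: DERIV_const)

lemma chart_deriv:
  assumes "complex_polynomial_function f" "xy_pair i j" "s \<in> torus"
  shows "((\<lambda>t. f (chart_curve i s t)) has_field_derivative chart_deriv i f s) (at 0)"
  using chart_deriv_exists[OF assms] DERIV_imp_deriv unfolding chart_deriv_def by blast

lemma chart_deriv_const: "chart_deriv i (\<lambda>_. c) s = 0"
  by (simp add: chart_deriv_def)

context
  fixes i j s assumes ij: "xy_pair i j" and s: "s \<in> torus"
begin

lemma chart_deriv_coord: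
  "chart_deriv i (\<lambda>s. s $ i) s = 1" "chart_deriv i (\<lambda>s. s $ j) s = 0"
  "chart_deriv i (\<lambda>s. s $ 3) s = - F i s / (s $ i * s $ j)"
  unfolding chart_deriv_def
  using chart_deriv_z_aux[OF ij s]
  by (auto intro!: DERIV_imp_deriv derivative_eq_intros simp: chart_curve_eq[OF ij] ij)

lemma chart_deriv_add:
  "complex_polynomial_function f \<Longrightarrow> complex_polynomial_function g
    \<Longrightarrow> chart_deriv i (\<lambda>s. f s + g s) s = chart_deriv i f s + chart_deriv i g s"
  using chart_deriv[OF _ ij s]
  by (subst chart_deriv_def) (auto intro!: DERIV_imp_deriv derivative_intros)

lemma chart_deriv_mult:
  "complex_polynomial_function f \<Longrightarrow> complex_polynomial_function g
    \<Longrightarrow> chart_deriv i (\<lambda>s. f s * g s) s = chart_deriv i f s * g s + f s * chart_deriv i g s"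
  using chart_deriv[OF _ ij s] chart_curve_0[OF ij s]
  by (subst chart_deriv_def) (auto intro!: DERIV_imp_deriv derivative_eq_intros)

lemma chart_deriv_diff:
  "complex_polynomial_function f \<Longrightarrow> complex_polynomial_function g
    \<Longrightarrow> chart_deriv i (\<lambda>s. f s - g s) s = chart_deriv i f s - chart_deriv i g s"
  using chart_deriv[OF _ ij s]
  by (subst chart_deriv_def) (auto intro!: DERIV_imp_deriv derivative_intros)

lemma chart_deriv_poly:
  "complex_polynomial_function f
    \<Longrightarrow> chart_deriv i (\<lambda>s. poly r (f s)) s = poly (pderiv r) (f s) * chart_deriv i f s"
  using DERIV_chain2[OF poly_DERIV chart_deriv[OF _ ij s]] chart_curve_0[OF ij s]
  by (subst chart_deriv_def) (auto intro!: DERIV_imp_deriv)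

lemma chart_deriv_power:
  "complex_polynomial_function f
    \<Longrightarrow> chart_deriv i (\<lambda>s. f s ^ n) s = of_nat n * f s ^ (n - 1) * chart_deriv i f s"
  using chart_deriv_poly[of f "monom 1 n"] by (simp add: poly_monom pderiv_monom)

lemma chart_deriv_cong:
  assumes "\<And>r. r \<in> torus \<Longrightarrow> f r = g r"
  shows "chart_deriv i f s = chart_deriv i g s"
  unfolding chart_deriv_def
  by (intro deriv_cong_ev eventually_mono[OF chart_curve_torus[OF ij s]] assms) auto

lemma chart_deriv_restrict0: "chart_deriv i (restrict0 S f) s = chart_deriv i f s"
  by (rule chart_deriv_cong) (simp add: torus_S)

end

lemmas chart_deriv_rules = chart_deriv_const chart_deriv_coord chart_deriv_add chart_deriv_mult
  chart_deriv_diff chart_deriv_poly chart_deriv_power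

section \<open>Vector fields in the torus chart\<close>

text \<open>Tangency: the left side of the equation of \<open>S\<close> is constant as a regular
  function, so every derivation annihilates it.\<close>

lemma avf_relation:
  assumes \<xi>: "\<xi> \<in> alg_vector_fields S" and ij: "xy_pair i j" and s: "s \<in> S"
  shows "F i s * \<xi> (coordinate S i) s + F j s * \<xi> (coordinate S j) s
    + s $ i * s $ j * \<xi> (coordinate S 3) s = 0"
proof -
  have "restrict0 S (\<lambda>s. (poly (P i) (s $ i) + poly (P j) (s $ j)) + s $ i * (s $ j * s $ 3))
      = restrict0 S (\<lambda>_. 1)"
    by (rule restrict0_cong) (use ij in \<open>simp add: mem_S mult.assoc\<close>)
  then have *: "\<xi> (restrict0 S (\<lambda>s. (poly (P i) (s $ i) + poly (P j) (s $ j)) + s $ i * (s $ j * s $ 3))) s = 0"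
    by (simp only: avf_const[OF \<xi>])
  have cpf': "complex_polynomial_function (\<lambda>s :: complex ^ 3. poly (P k) (s $ k))"
    "complex_polynomial_function (\<lambda>s :: complex ^ 3. s $ k)"
    "complex_polynomial_function (\<lambda>s :: complex ^ 3. poly (P k) (s $ k) + poly (P l) (s $ l))"
    "complex_polynomial_function (\<lambda>s :: complex ^ 3. s $ k * s $ l)"
    "complex_polynomial_function (\<lambda>s :: complex ^ 3. s $ k * (s $ l * s $ m))" for k l m
    by (intro cpf)+
  show ?thesis
    using * unfolding avf_poly_add[OF \<xi> cpf'(3,5)] avf_poly_add[OF \<xi> cpf'(1,1)]
      avf_poly_mult[OF \<xi> cpf'(2,4)] avf_poly_mult[OF \<xi> cpf'(2,2)] avf_poly_poly[OF \<xi> cpf'(2)]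
    by (simp add: F_eq[OF ij] F_eq[OF xy_pair_sym[OF ij]] algebra_simps)
qed

lemma avf_chart_poly:
  assumes \<xi>: "\<xi> \<in> alg_vector_fields S" and ij: "xy_pair i j" and s: "s \<in> torus"
    and f: "complex_polynomial_function f"
  shows "\<xi> (restrict0 S f) s = chart_deriv i f s * \<xi> (coordinate S i) s
    + chart_deriv j f s * \<xi> (coordinate S j) s"
  using f
proof induction
  case (const c)
  show ?case by (simp add: avf_const[OF \<xi>] chart_deriv_const)
next
  case (coord k)
  note ji = xy_pair_sym[OF ij]
  consider "k = i" | "k = j" | "k = 3" using ij exhaust_3[of k] by (auto simp: xy_pair_def)
  then show ?case
  proof cases
    case 3
    have "s $ i \<noteq> 0" "s $ j \<noteq> 0" using s by (auto simp: mem_torus[OF ij])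
    with avf_relation[OF \<xi> ij torus_S[OF s]] show ?thesis
      unfolding 3 chart_deriv_coord[OF ij s] chart_deriv_coord[OF ji s]
      by (simp add: field_simps) (simp add: add_eq_0_iff algebra_simps)
  qed (simp_all add: chart_deriv_coord[OF ij s] chart_deriv_coord[OF ji s])
next
  case (add f g)
  then show ?case
    by (simp add: avf_poly_add[OF \<xi>] chart_deriv_add[OF ij s] chart_deriv_add[OF xy_pair_sym[OF ij] s]
        algebra_simps)
next
  case (mult f g)
  then show ?case
    by (simp add: avf_poly_mult[OF \<xi>] chart_deriv_mult[OF ij s]
        chart_deriv_mult[OF xy_pair_sym[OF ij] s] algebra_simps)
qed

lemma avf_chart:
  assumes \<xi>: "\<xi> \<in> alg_vector_fields S" and ij: "xy_pair i j" and s: "s \<in> torus"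
    and f: "f \<in> regular_functions S"
  shows "\<xi> f s = chart_deriv i f s * \<xi> (coordinate S i) s
    + chart_deriv j f s * \<xi> (coordinate S j) s"
  using f avf_chart_poly[OF \<xi> ij s]
  by (auto elim!: regularE simp: chart_deriv_restrict0[OF ij s] chart_deriv_restrict0[OF xy_pair_sym[OF ij] s])

text \<open>On the torus the z-component is forced by tangency, and the torus is dense; two
  components thus determine a field.\<close>

lemma avf_eqI:
  assumes \<xi>: "\<xi> \<in> alg_vector_fields S" and \<eta>: "\<eta> \<in> alg_vector_fields S" and ij: "xy_pair i j"
    and eq: "\<And>s. s \<in> torus \<Longrightarrow> \<xi> (coordinate S i) s = \<eta> (coordinate S i) s"
      "\<And>s. s \<in> torus \<Longrightarrow> \<xi> (coordinate S j) s = \<eta> (coordinate S j) s"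
  shows "\<xi> = \<eta>"
proof
  fix f
  show "\<xi> f = \<eta> f"
  proof (cases "f \<in> regular_functions S")
    case True
    then show ?thesis
      by (intro regular_eqI avf_regular \<xi> \<eta>) (simp add: avf_chart[OF _ ij] \<xi> \<eta> eq)
  qed (simp add: avf_nonregular[OF \<xi>] avf_nonregular[OF \<eta>])
qed

end

section \<open>Divergence computed in the torus chart\<close>

locale surface_with_form = simple_root_surface +
  fixes \<omega>
  assumes volume: "alg_volume_form S \<omega>" and torus_form: "extends_torus_form S \<omega>"
begin

lemma two_form: "alg_two_form S \<omega>"
  using volume by (simp add: alg_volume_form_def)

lemma form_on_torus:
  assumes "\<eta> \<in> alg_vector_fields S" "\<theta> \<in> alg_vector_fields S" "s \<in> torus"
  shows "s $ 1 * s $ 2 * \<omega> \<eta> \<theta> s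
    = \<eta> (coordinate S 1) s * \<theta> (coordinate S 2) s - \<eta> (coordinate S 2) s * \<theta> (coordinate S 1) s"
proof -
  have "\<omega> \<eta> \<theta> s = torus_form S \<eta> \<theta> s"
    using torus_form assms by (auto simp: extends_torus_form_def torus_def)
  then show ?thesis using assms(3) by (simp add: torus_form_def torus_def)
qed

text \<open>For alpha d/dx + beta d/dy and the form dx dy / (x y) the divergence is alpha_x + beta_y
  - alpha/x - beta/y; the factor x y clears denominators.\<close>

definition chart_divergence :: "3 vfield \<Rightarrow> complex ^ 3 \<Rightarrow> complex"
  where "chart_divergence \<xi> s =
    s $ 1 * s $ 2 * (chart_deriv 1 (\<xi> (coordinate S 1)) s + chart_deriv 2 (\<xi> (coordinate S 2)) s)
      - (s $ 2 * \<xi> (coordinate S 1) s + s $ 1 * \<xi> (coordinate S 2) s)"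

text \<open>In dimension two the Lie derivative of the form is the divergence times the form. The
  proof applies xi to x y omega(eta, theta) = eta(x) theta(y) - eta(y) theta(x) and compares with
  the same identity for the two brackets.\<close>

lemma lie_derivative_chart:
  assumes \<xi>: "\<xi> \<in> alg_vector_fields S" and \<eta>: "\<eta> \<in> alg_vector_fields S"
    and \<theta>: "\<theta> \<in> alg_vector_fields S" and s: "s \<in> torus"
  shows "s $ 1 * s $ 2 * lie_derivative \<xi> \<omega> \<eta> \<theta> s = \<omega> \<eta> \<theta> s * chart_divergence \<xi> s"
proof -
  let ?x = "coordinate S 1" and ?y = "coordinate S 2"
  note reg = avf_regular[OF \<xi>] avf_regular[OF \<eta>] avf_regular[OF \<theta>] form_regular[OF two_form \<eta> \<theta>]
    regular_restrict0[OF complex_polynomial_function.coord] regular_mult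
  note chart = avf_chart[OF _ xy_pair_12 s]
  have "(\<lambda>s. ?x s * (?y s * \<omega> \<eta> \<theta> s)) = (\<lambda>s. \<eta> ?x s * \<theta> ?y s - \<eta> ?y s * \<theta> ?x s)"
    using form_on_torus[OF \<eta> \<theta>] torus_S by (intro regular_eqI regular_diff reg) (auto simp: mult.assoc)
  then have "\<xi> (\<lambda>s. ?x s * (?y s * \<omega> \<eta> \<theta> s)) s
      = \<xi> (\<lambda>s. \<eta> ?x s * \<theta> ?y s - \<eta> ?y s * \<theta> ?x s) s" by simp
  then have e1: "\<xi> ?x s * (s $ 2 * \<omega> \<eta> \<theta> s) + s $ 1 * (\<xi> ?y s * \<omega> \<eta> \<theta> s + s $ 2 * \<xi> (\<omega> \<eta> \<theta>) s)
      = \<xi> (\<eta> ?x) s * \<theta> ?y s + \<eta> ?x s * \<xi> (\<theta> ?y) s - (\<xi> (\<eta> ?y) s * \<theta> ?x s + \<eta> ?y s * \<xi> (\<theta> ?x) s)"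
    using torus_S[OF s] avf_mult[OF \<xi> reg(5) regular_mult[OF reg(5,4)], of 1 2]
      avf_mult[OF \<xi> reg(5,4), of 2] avf_diff[OF \<xi> regular_mult[OF reg(2,3)] regular_mult[OF reg(2,3)], of ?x ?y ?y ?x]
      avf_mult[OF \<xi> reg(2,3), of ?x ?y] avf_mult[OF \<xi> reg(2,3), of ?y ?x]
    by simp
  have e2: "s $ 1 * s $ 2 * \<omega> (lie_bracket \<xi> \<eta>) \<theta> s
      = (\<xi> (\<eta> ?x) s - \<eta> (\<xi> ?x) s) * \<theta> ?y s - (\<xi> (\<eta> ?y) s - \<eta> (\<xi> ?y) s) * \<theta> ?x s"
    using form_on_torus[OF avf_bracket[OF \<xi> \<eta>] \<theta> s] by (simp add: lie_bracket_def)
  have e3: "s $ 1 * s $ 2 * \<omega> \<eta> (lie_bracket \<xi> \<theta>) s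
      = \<eta> ?x s * (\<xi> (\<theta> ?y) s - \<theta> (\<xi> ?y) s) - \<eta> ?y s * (\<xi> (\<theta> ?x) s - \<theta> (\<xi> ?x) s)"
    using form_on_torus[OF \<eta> avf_bracket[OF \<xi> \<theta>] s] by (simp add: lie_bracket_def)
  note e4 = form_on_torus[OF \<eta> \<theta> s]
  \<comment> \<open>Only eta and theta applied to components of xi are expanded, since these produce
    the partial derivatives in the divergence; terms such as xi(eta(x)) cancel as they
    stand.\<close>
  note c = chart[OF \<eta> reg(1), of ?x] chart[OF \<eta> reg(1), of ?y] chart[OF \<theta> reg(1), of ?x]
    chart[OF \<theta> reg(1), of ?y]
  show ?thesis
    unfolding lie_derivative_def chart_divergence_def
    using e1 e2[unfolded c] e3[unfolded c] e4 by algebra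
qed

text \<open>One direction cancels a nonzero value of the volume form at the given point. The other
  shows that the Lie derivative, a regular function, vanishes on the torus and hence on
  \<open>S\<close>.\<close>

lemma divergence_zero_iff:
  assumes \<xi>: "\<xi> \<in> alg_vector_fields S"
  shows "divergence_zero S \<omega> \<xi> \<longleftrightarrow> (\<forall>s\<in>torus. chart_divergence \<xi> s = 0)"
proof
  assume dz: "divergence_zero S \<omega> \<xi>"
  show "\<forall>s\<in>torus. chart_divergence \<xi> s = 0"
  proof
    fix s assume s: "s \<in> torus"
    obtain \<eta> \<theta> where "\<eta> \<in> alg_vector_fields S" "\<theta> \<in> alg_vector_fields S" "\<omega> \<eta> \<theta> s \<noteq> 0"
      using volume torus_S[OF s] by (auto simp: alg_volume_form_def)
    with lie_derivative_chart[OF \<xi> this(1,2) s] dz torus_S[OF s]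
    show "chart_divergence \<xi> s = 0" by (auto simp: divergence_zero_def)
  qed
next
  assume *: "\<forall>s\<in>torus. chart_divergence \<xi> s = 0"
  show "divergence_zero S \<omega> \<xi>"
    unfolding divergence_zero_def
  proof (intro ballI)
    fix \<eta> \<theta> s
    assume \<eta>: "\<eta> \<in> alg_vector_fields S" and \<theta>: "\<theta> \<in> alg_vector_fields S" and "s \<in> S"
    have "lie_derivative \<xi> \<omega> \<eta> \<theta> = (\<lambda>_. 0)"
    proof (rule regular_eqI)
      show "lie_derivative \<xi> \<omega> \<eta> \<theta> \<in> regular_functions S"
        unfolding lie_derivative_def
        by (intro regular_diff avf_regular[OF \<xi>] form_regular[OF two_form] avf_bracket \<xi> \<eta> \<theta>)
      show "lie_derivative \<xi> \<omega> \<eta> \<theta> s = 0" if "s \<in> torus" for s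
        using lie_derivative_chart[OF \<xi> \<eta> \<theta> that] * that by (auto simp: torus_def)
    qed (rule regular_zero)
    then show "lie_derivative \<xi> \<omega> \<eta> \<theta> s = 0" by simp
  qed
qed

lemma divergence_zero_pair:
  assumes \<xi>: "\<xi> \<in> alg_vector_fields S" and ij: "xy_pair i j"
  shows "divergence_zero S \<omega> \<xi> \<longleftrightarrow> (\<forall>s\<in>torus.
    s $ i * s $ j * (chart_deriv i (\<xi> (coordinate S i)) s + chart_deriv j (\<xi> (coordinate S j)) s)
      = s $ j * \<xi> (coordinate S i) s + s $ i * \<xi> (coordinate S j) s)"
  using ij unfolding divergence_zero_iff[OF \<xi>] chart_divergence_def xy_pair_def
  by (auto simp: algebra_simps)

lemma Lie_alg_AVF: "\<xi> \<in> Lie_alg S \<omega> \<Longrightarrow> \<xi> \<in> alg_vector_fields S \<and> divergence_zero S \<omega> \<xi>"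
  using Lie_alg_subset_AVF[OF two_form] by (auto simp: AVF_def)

lemma Lie_alg_closed:
  "vf_zero \<in> Lie_alg S \<omega>"
  "\<xi> \<in> Lie_alg S \<omega> \<Longrightarrow> \<eta> \<in> Lie_alg S \<omega> \<Longrightarrow> vf_add \<xi> \<eta> \<in> Lie_alg S \<omega>"
  "\<xi> \<in> Lie_alg S \<omega> \<Longrightarrow> vf_scale c \<xi> \<in> Lie_alg S \<omega>"
  "\<xi> \<in> Lie_alg S \<omega> \<Longrightarrow> \<eta> \<in> Lie_alg S \<omega> \<Longrightarrow> lie_bracket \<xi> \<eta> \<in> Lie_alg S \<omega>"
  by (simp_all add: Lie_alg_def lie_algebra_generated.intros)

section \<open>Hamiltonian fields\<close>

text \<open>On the torus the field is {h, _} for the bracket with {x_i, x_j} = x_i x_j. Exchanging i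
  and j changes the sign of the field.\<close>

definition hamiltonian :: "3 \<Rightarrow> 3 \<Rightarrow> (complex ^ 3 \<Rightarrow> complex) \<Rightarrow> 3 vfield \<Rightarrow> bool"
  where "hamiltonian i j h \<xi> \<longleftrightarrow> (\<forall>s\<in>torus.
    \<xi> (coordinate S i) s = - s $ i * s $ j * chart_deriv j h s \<and>
    \<xi> (coordinate S j) s = s $ i * s $ j * chart_deriv i h s)"

text \<open>Passing from fields to their Hamiltonians turns generation of a Lie algebra into a
  question about polynomials under a Poisson bracket.\<close>

definition Lie_hamiltonians :: "(complex ^ 3 \<Rightarrow> complex) set"
  where "Lie_hamiltonians = {h. complex_polynomial_function h \<and> (\<exists>\<xi>\<in>Lie_alg S \<omega>. hamiltonian 1 2 h \<xi>)}"

lemma Lie_hamiltonians_pair: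
  assumes ij: "xy_pair i j"
  shows "h \<in> Lie_hamiltonians \<longleftrightarrow>
    complex_polynomial_function h \<and> (\<exists>\<xi>\<in>Lie_alg S \<omega>. hamiltonian i j h \<xi>)"
proof -
  have "hamiltonian i j h (vf_scale (-1) \<xi>)" if "hamiltonian j i h \<xi>" for i j \<xi>
    using that by (auto simp: hamiltonian_def vf_scale_def)
  with Lie_alg_closed(3) show ?thesis
    using ij unfolding xy_pair_def Lie_hamiltonians_def mem_Collect_eq by meson
qed

lemma Lie_hamiltonians_cpf: "h \<in> Lie_hamiltonians \<Longrightarrow> complex_polynomial_function h"
  by (simp add: Lie_hamiltonians_def)

lemma Lie_hamiltonians_cong:
  assumes h: "h \<in> Lie_hamiltonians" and g: "complex_polynomial_function g"
    and eq: "\<And>s. s \<in> torus \<Longrightarrow> g s = h s"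
  shows "g \<in> Lie_hamiltonians"
  using h g chart_deriv_cong[OF xy_pair_12 _ eq] chart_deriv_cong[OF xy_pair_21 _ eq]
  by (auto simp: Lie_hamiltonians_def hamiltonian_def)

lemma Lie_hamiltonians_add:
  assumes "g \<in> Lie_hamiltonians" "h \<in> Lie_hamiltonians"
  shows "(\<lambda>s. g s + h s) \<in> Lie_hamiltonians"
proof -
  obtain \<xi> \<eta> where Lie: "\<xi> \<in> Lie_alg S \<omega>" "\<eta> \<in> Lie_alg S \<omega>"
    and "hamiltonian 1 2 g \<xi>" "hamiltonian 1 2 h \<eta>"
    using assms by (auto simp: Lie_hamiltonians_def)
  then have "hamiltonian 1 2 (\<lambda>s. g s + h s) (vf_add \<xi> \<eta>)"
    using assms[THEN Lie_hamiltonians_cpf]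
    by (auto simp: hamiltonian_def vf_add_def chart_deriv_add[OF xy_pair_12]
        chart_deriv_add[OF xy_pair_21] algebra_simps)
  then show ?thesis
    using assms[THEN Lie_hamiltonians_cpf] Lie_alg_closed(2)[OF Lie] by (auto simp: Lie_hamiltonians_def intro: cpf)
qed

lemma Lie_hamiltonians_scale:
  assumes "h \<in> Lie_hamiltonians"
  shows "(\<lambda>s. c * h s) \<in> Lie_hamiltonians"
proof -
  have cpf': "complex_polynomial_function (\<lambda>_ :: complex ^ 3. c)" by (intro cpf)
  obtain \<xi> where Lie: "\<xi> \<in> Lie_alg S \<omega>" and "hamiltonian 1 2 h \<xi>"
    using assms by (auto simp: Lie_hamiltonians_def)
  then have "hamiltonian 1 2 (\<lambda>s. c * h s) (vf_scale c \<xi>)"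
    using assms[THEN Lie_hamiltonians_cpf]
    by (auto simp: hamiltonian_def vf_scale_def chart_deriv_mult[OF xy_pair_12 _ cpf']
        chart_deriv_mult[OF xy_pair_21 _ cpf'] chart_deriv_const algebra_simps)
  then show ?thesis
    using assms[THEN Lie_hamiltonians_cpf] Lie_alg_closed(3)[OF Lie] by (auto simp: Lie_hamiltonians_def intro: cpf)
qed

lemma Lie_hamiltonians_cancel:
  assumes "(\<lambda>s. c * h s) \<in> Lie_hamiltonians" "c \<noteq> 0"
  shows "h \<in> Lie_hamiltonians"
proof -
  have "(\<lambda>s. inverse c * (c * h s)) = h" using assms(2) by (simp add: mult.assoc[symmetric])
  then show ?thesis using Lie_hamiltonians_scale[OF assms(1), of "inverse c"] by simp
qed

lemma Lie_hamiltonians_diff: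
  "g \<in> Lie_hamiltonians \<Longrightarrow> h \<in> Lie_hamiltonians \<Longrightarrow> (\<lambda>s. g s - h s) \<in> Lie_hamiltonians"
  using Lie_hamiltonians_add[OF _ Lie_hamiltonians_scale[of h "-1"]] by fastforce

lemma Lie_hamiltonians_const: "(\<lambda>_. c) \<in> Lie_hamiltonians"
  using Lie_alg_closed(1)
  by (auto simp: Lie_hamiltonians_def hamiltonian_def chart_deriv_const vf_zero_def intro!: cpf bexI[of _ vf_zero])

text \<open>By Cartan's formula the bracket of two divergence-free fields is the Hamiltonian field of
  their pairing under the volume form.\<close>

lemma Lie_hamiltonians_bracket:
  assumes ij: "xy_pair i j" and f: "f \<in> Lie_hamiltonians" and g: "g \<in> Lie_hamiltonians"
    and K: "complex_polynomial_function K"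
    and K_eq: "\<And>s. s \<in> torus \<Longrightarrow> K s = s $ i * s $ j *
      (chart_deriv i f s * chart_deriv j g s - chart_deriv j f s * chart_deriv i g s)"
  shows "K \<in> Lie_hamiltonians"
proof -
  note ji = xy_pair_sym[OF ij]
  obtain \<xi> \<eta> where Lie: "\<xi> \<in> Lie_alg S \<omega>" "\<eta> \<in> Lie_alg S \<omega>"
    and ham: "hamiltonian i j f \<xi>" "hamiltonian i j g \<eta>"
    using f g by (auto simp: Lie_hamiltonians_pair[OF ij])
  have \<xi>: "\<xi> \<in> alg_vector_fields S" and \<eta>: "\<eta> \<in> alg_vector_fields S"
    and dz: "divergence_zero S \<omega> \<xi>" "divergence_zero S \<omega> \<eta>"
    using Lie Lie_alg_AVF by auto
  obtain a b c d where
    cpf': "complex_polynomial_function a" "complex_polynomial_function b"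
      "complex_polynomial_function c" "complex_polynomial_function d"
    and abcd: "\<xi> (coordinate S i) = restrict0 S a" "\<xi> (coordinate S j) = restrict0 S b"
      "\<eta> (coordinate S i) = restrict0 S c" "\<eta> (coordinate S j) = restrict0 S d"
    using avf_regular[OF \<xi>, THEN regularE] avf_regular[OF \<eta>, THEN regularE] by metis
  have K': "s $ i * (s $ j * K s) = a s * d s - b s * c s" if s: "s \<in> torus" for s
  proof -
    have "a s = - s $ i * s $ j * chart_deriv j f s" "b s = s $ i * s $ j * chart_deriv i f s"
      "c s = - s $ i * s $ j * chart_deriv j g s" "d s = s $ i * s $ j * chart_deriv i g s"
      using ham s torus_S[OF s] abcd by (auto simp: hamiltonian_def)
    then show ?thesis unfolding K_eq[OF s] by (simp add: algebra_simps)
  qed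
  have cpf_prod: "complex_polynomial_function (\<lambda>s. s $ j * K s)"
    "complex_polynomial_function (\<lambda>s. a s * d s)" "complex_polynomial_function (\<lambda>s. b s * c s)"
    "complex_polynomial_function (\<lambda>s :: complex ^ 3. s $ i)"
    "complex_polynomial_function (\<lambda>s :: complex ^ 3. s $ j)"
    by (intro cpf cpf' K)+
  have "hamiltonian i j K (lie_bracket \<xi> \<eta>)"
    unfolding hamiltonian_def
  proof (rule ballI)
    fix s assume s: "s \<in> torus"
    have nz': "s $ i * s $ j \<noteq> 0" using s by (simp add: mem_torus[OF ij])
    note rules = chart_deriv_mult[OF ij s] chart_deriv_mult[OF ji s] chart_deriv_diff[OF ij s]
      chart_deriv_diff[OF ji s] chart_deriv_coord[OF ij s] chart_deriv_coord[OF ji s] cpf' cpf_prod K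
      chart_deriv_restrict0[OF ij s] chart_deriv_restrict0[OF ji s]
    \<comment> \<open>The identity for x_i x_j K holds on the torus, hence along the coordinate
      curves for small times, and may be differentiated. This brings in first derivatives of the
      components instead of second derivatives of f and g.\<close>
    have "chart_deriv k (\<lambda>s. s $ i * (s $ j * K s)) s = chart_deriv k (\<lambda>s. a s * d s - b s * c s) s"
      if "xy_pair k l" for k l
      by (rule chart_deriv_cong[OF that s K'])
    from this[OF ij] this[OF ji]
    have e: "s $ j * K s + s $ i * (s $ j * chart_deriv i K s)
        = chart_deriv i a s * d s + a s * chart_deriv i d s
          - (chart_deriv i b s * c s + b s * chart_deriv i c s)"
      "s $ i * (K s + s $ j * chart_deriv j K s)
        = chart_deriv j a s * d s + a s * chart_deriv j d s
          - (chart_deriv j b s * c s + b s * chart_deriv j c s)"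
      by (simp_all add: rules)
    have d: "s $ i * s $ j * (chart_deriv i a s + chart_deriv j b s) = s $ j * a s + s $ i * b s"
      "s $ i * s $ j * (chart_deriv i c s + chart_deriv j d s) = s $ j * c s + s $ i * d s"
      using dz s torus_S[OF s] unfolding divergence_zero_pair[OF \<xi> ij] divergence_zero_pair[OF \<eta> ij]
      by (auto simp: abcd rules)
    note K's = K'[OF s]
    note chart = avf_chart_poly[OF \<xi> ij s] avf_chart_poly[OF \<eta> ij s]
    have br: "lie_bracket \<xi> \<eta> (coordinate S i) s
        = chart_deriv i c s * a s + chart_deriv j c s * b s - (chart_deriv i a s * c s + chart_deriv j a s * d s)"
      "lie_bracket \<xi> \<eta> (coordinate S j) s
        = chart_deriv i d s * a s + chart_deriv j d s * b s - (chart_deriv i b s * c s + chart_deriv j b s * d s)"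
      using torus_S[OF s] by (simp_all add: lie_bracket_def abcd chart cpf')
    have "s $ i * s $ j * lie_bracket \<xi> \<eta> (coordinate S i) s
        = s $ i * s $ j * (- s $ i * s $ j * chart_deriv j K s)"
      unfolding br using e(2) d K's by algebra
    moreover have "s $ i * s $ j * lie_bracket \<xi> \<eta> (coordinate S j) s
        = s $ i * s $ j * (s $ i * s $ j * chart_deriv i K s)"
      unfolding br using e(1) d K's by algebra
    ultimately show "lie_bracket \<xi> \<eta> (coordinate S i) s = - s $ i * s $ j * chart_deriv j K s \<and>
        lie_bracket \<xi> \<eta> (coordinate S j) s = s $ i * s $ j * chart_deriv i K s"
      unfolding mult_left_cancel[OF nz'] by blast
  qed
  then show ?thesis
    using K Lie_alg_closed(4)[OF Lie] by (auto simp: Lie_hamiltonians_pair[OF ij])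
qed

lemma Lie_alg_incl:
  "\<xi> \<in> alg_vector_fields S \<Longrightarrow> complete_vf S \<xi> \<Longrightarrow> divergence_zero S \<omega> \<xi> \<Longrightarrow> \<xi> \<in> Lie_alg S \<omega>"
  by (simp add: Lie_alg_def lie_algebra_generated.incl)

lemma Lie_hamiltonians_power:
  assumes ij: "xy_pair i j"
  shows "(\<lambda>s. s $ i ^ n) \<in> Lie_hamiltonians"
proof (cases "n = 0")
  case True
  then show ?thesis using Lie_hamiltonians_const[of 1] by simp
next
  case False
  note ji = xy_pair_sym[OF ij]
  obtain \<xi> where \<xi>: "\<xi> \<in> alg_vector_fields S" "complete_vf S \<xi>"
    and comp: "\<xi> (coordinate S i) = restrict0 S (\<lambda>_. 0)"
      "\<xi> (coordinate S j) = restrict0 S (\<lambda>s. of_nat n * s $ i ^ n * s $ j)"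
    using complete_field_power[OF ij] False by blast
  obtain m where n: "n = Suc m" using False by (cases n) auto
  have cpf': "complex_polynomial_function (\<lambda>s :: complex ^ 3. s $ i)"
    "complex_polynomial_function (\<lambda>s :: complex ^ 3. s $ j)"
    "complex_polynomial_function (\<lambda>s :: complex ^ 3. of_nat n * s $ i ^ n)"
    "complex_polynomial_function (\<lambda>s :: complex ^ 3. of_nat n :: complex)"
    "complex_polynomial_function (\<lambda>s :: complex ^ 3. s $ i ^ n)"
    by (intro cpf)+
  have "divergence_zero S \<omega> \<xi>"
    unfolding divergence_zero_pair[OF \<xi>(1) ij] comp
    using ij ji torus_S by (auto simp: chart_deriv_restrict0 chart_deriv_rules cpf')
  moreover have "hamiltonian i j (\<lambda>s. s $ i ^ n) \<xi>"
    unfolding hamiltonian_def comp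
  proof
    fix s assume s: "s \<in> torus"
    show "restrict0 S (\<lambda>_. 0) s = - s $ i * s $ j * chart_deriv j (\<lambda>s. s $ i ^ n) s \<and>
        restrict0 S (\<lambda>s. of_nat n * s $ i ^ n * s $ j) s
          = s $ i * s $ j * chart_deriv i (\<lambda>s. s $ i ^ n) s"
      unfolding chart_deriv_power[OF ij s cpf'(1)] chart_deriv_power[OF ji s cpf'(1)]
        chart_deriv_coord[OF ij s] chart_deriv_coord[OF ji s]
      using torus_S[OF s] by (simp add: n)
  qed
  ultimately show ?thesis
    using Lie_alg_incl[OF \<xi>] cpf' by (auto simp: Lie_hamiltonians_pair[OF ij])
qed

lemma Lie_hamiltonians_mutation:
  assumes ij: "xy_pair i j"
  shows "(\<lambda>s. poly (P\<^sub>1 j) (s $ j) + s $ i * s $ 3) \<in> Lie_hamiltonians"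
proof -
  define v where "v s = poly (P\<^sub>1 j) (s $ j) + s $ i * s $ 3" for s :: "complex ^ 3"
  note ji = xy_pair_sym[OF ij]
  obtain \<xi> where \<xi>: "\<xi> \<in> alg_vector_fields S" "complete_vf S \<xi>"
    and comp: "\<xi> (coordinate S i) = restrict0 S (\<lambda>s. s $ i * v s)"
      "\<xi> (coordinate S j) = restrict0 S (\<lambda>s. - s $ i * poly (pderiv (P i)) (s $ i))"
    using complete_field_mutation[OF ij] unfolding v_def by blast
  have cpf': "complex_polynomial_function (\<lambda>s :: complex ^ 3. s $ k)"
    "complex_polynomial_function (\<lambda>s :: complex ^ 3. - s $ k)"
    "complex_polynomial_function (\<lambda>s :: complex ^ 3. poly r (s $ k))"
    "complex_polynomial_function (\<lambda>s :: complex ^ 3. s $ k * s $ l)"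
    "complex_polynomial_function v" for k l r
    unfolding v_def by (intro cpf)+
  \<comment> \<open>On the torus v is (1 - P i(x_i)) / x_j, and these are the values the quotient
    rule predicts; here they come from the derivative of z.\<close>
  have v_i: "s $ j * chart_deriv i v s = - poly (pderiv (P i)) (s $ i)"
    and v_j: "s $ j * chart_deriv j v s = - v s" if s: "s \<in> torus" for s
  proof -
    have nz: "s $ i \<noteq> 0" "s $ j \<noteq> 0" using s by (auto simp: mem_torus[OF ij])
    note rules = chart_deriv_mult[OF ij s] chart_deriv_mult[OF ji s] chart_deriv_add[OF ij s]
      chart_deriv_add[OF ji s] chart_deriv_coord[OF ij s] chart_deriv_coord[OF ji s] cpf'
      chart_deriv_poly[OF ij s] chart_deriv_poly[OF ji s]
    have "chart_deriv i v s = s $ 3 - F i s / s $ j"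
      using nz by (simp add: v_def[abs_def] rules)
    then show "s $ j * chart_deriv i v s = - poly (pderiv (P i)) (s $ i)"
      using nz by (simp add: F_eq[OF ij] field_simps)
    have "chart_deriv j v s = poly (pderiv (P\<^sub>1 j)) (s $ j) - F j s / s $ j"
      using nz by (simp add: v_def[abs_def] rules)
    then show "s $ j * chart_deriv j v s = - v s"
      using nz by (simp add: F_eq[OF ji] pderiv_P v_def field_simps)
  qed
  have "divergence_zero S \<omega> \<xi>"
    unfolding divergence_zero_pair[OF \<xi>(1) ij]
  proof
    fix s assume s: "s \<in> torus"
    have "chart_deriv i (\<lambda>s. s $ i * v s) s = v s + s $ i * chart_deriv i v s"
      by (simp add: chart_deriv_mult[OF ij s] chart_deriv_coord[OF ij s] cpf')
    moreover have "chart_deriv j (\<lambda>s. - s $ i * poly (pderiv (P i)) (s $ i)) s = 0"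
    proof -
      have "chart_deriv j (\<lambda>s. poly (- [:0, 1:] * pderiv (P i)) (s $ i)) s = 0"
        unfolding chart_deriv_poly[OF ji s cpf'(1)] chart_deriv_coord[OF ji s] by simp
      then show ?thesis by simp
    qed
    ultimately show "s $ i * s $ j * (chart_deriv i (\<xi> (coordinate S i)) s
        + chart_deriv j (\<xi> (coordinate S j)) s)
      = s $ j * \<xi> (coordinate S i) s + s $ i * \<xi> (coordinate S j) s"
      using v_i[OF s] torus_S[OF s]
      unfolding comp chart_deriv_restrict0[OF ij s] chart_deriv_restrict0[OF ji s]
      by (simp add: algebra_simps)
  qed
  moreover have "hamiltonian i j v \<xi>"
    unfolding hamiltonian_def comp mult.assoc using v_i v_j torus_S by auto
  ultimately have "v \<in> Lie_hamiltonians"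
    using Lie_alg_incl[OF \<xi>] cpf' by (auto simp: Lie_hamiltonians_pair[OF ij])
  then show ?thesis by (simp add: v_def[abs_def])
qed

section \<open>Generating all monomials by brackets\<close>

lemma Lie_hamiltonians_poly:
  assumes "\<And>n. (\<lambda>s. s $ i ^ n * g s) \<in> Lie_hamiltonians"
  shows "(\<lambda>s. poly r (s $ i) * g s) \<in> Lie_hamiltonians"
  using assms
proof (induction r arbitrary: g)
  case 0
  show ?case using Lie_hamiltonians_const[of 0] by simp
next
  case (pCons a r)
  have "(\<lambda>s. s $ i ^ n * (s $ i * g s)) \<in> Lie_hamiltonians" for n
    using pCons.prems[of "Suc n"] by (simp add: mult_ac)
  from pCons.IH[OF this] have "(\<lambda>s. a * (s $ i ^ 0 * g s) + poly r (s $ i) * (s $ i * g s)) \<in> Lie_hamiltonians"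
    by (intro Lie_hamiltonians_add Lie_hamiltonians_scale pCons.prems)
  then show ?case by (simp add: algebra_simps)
qed

text \<open>The induction runs over the z-degree with all exponents of x and y at once, because the
  brackets produce p' and q' of arbitrary degree as lower-order terms.\<close>

definition monomials_upto :: "nat \<Rightarrow> bool"
  where "monomials_upto n \<longleftrightarrow>
    (\<forall>a b c. c \<le> n \<longrightarrow> (\<lambda>s. s $ 1 ^ a * s $ 2 ^ b * s $ 3 ^ c) \<in> Lie_hamiltonians)"

lemma monomials_uptoD:
  assumes "monomials_upto n" "xy_pair i j" "c \<le> n"
  shows "(\<lambda>s. s $ i ^ a * (s $ j ^ b * s $ 3 ^ c)) \<in> Lie_hamiltonians"
proof -
  have "(\<lambda>s. s $ 1 ^ a * s $ 2 ^ b * s $ 3 ^ c) \<in> Lie_hamiltonians"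
    "(\<lambda>s. s $ 1 ^ b * s $ 2 ^ a * s $ 3 ^ c) \<in> Lie_hamiltonians"
    using assms(1,3) unfolding monomials_upto_def by blast+
  then show ?thesis using assms(2) by (auto simp: xy_pair_def mult_ac)
qed

lemma cpf_coord_power: "complex_polynomial_function (\<lambda>s :: complex ^ 3. s $ k ^ n)"
  by (intro cpf)

lemmas cpf_rules = complex_polynomial_function.coord cpf_coord_power complex_polynomial_function.mult

lemma monomials_upto_0: "monomials_upto 0"
proof -
  have "(\<lambda>s. s $ 1 ^ a * s $ 2 ^ b) \<in> Lie_hamiltonians" for a b
  proof (cases "a = 0 \<or> b = 0")
    case True
    then show ?thesis
      using Lie_hamiltonians_power[OF xy_pair_12] Lie_hamiltonians_power[OF xy_pair_21] by auto
  next
    case False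
    then have "(of_nat a * of_nat b) * (s $ 1 ^ a * s $ 2 ^ b)
        = s $ 1 * s $ 2 * (of_nat a * s $ 1 ^ (a - 1)) * (of_nat b * s $ 2 ^ (b - 1))"
      for s :: "complex ^ 3" by (cases a; cases b; simp)
    then have "(\<lambda>s. (of_nat a * of_nat b) * (s $ 1 ^ a * s $ 2 ^ b)) \<in> Lie_hamiltonians"
      by (intro Lie_hamiltonians_bracket[OF xy_pair_12 Lie_hamiltonians_power[OF xy_pair_12, of a]
            Lie_hamiltonians_power[OF xy_pair_21, of b]] cpf)
        (simp add: chart_deriv_power[OF xy_pair_12] chart_deriv_power[OF xy_pair_21]
          chart_deriv_coord[OF xy_pair_12] chart_deriv_coord[OF xy_pair_21] cpf_rules mult_ac)
    then show ?thesis using False by (rule_tac Lie_hamiltonians_cancel[of "of_nat a * of_nat b"]) auto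
  qed
  then show ?thesis by (simp add: monomials_upto_def)
qed

text \<open>The bracket of \<open>x\<^sup>a z\<^sup>k\<close> with \<open>z\<close> produces \<open>x\<^sup>a z\<^bsup>k+1\<^esup>\<close> modulo lower powers of \<open>z\<close>.\<close>

lemma axis_step:
  assumes ij: "xy_pair i j" and n: "monomials_upto n" "n > 0" and a: "a > 0"
  shows "(\<lambda>s. s $ i ^ a * s $ 3 ^ Suc n) \<in> Lie_hamiltonians"
proof -
  note ji = xy_pair_sym[OF ij]
  have f: "(\<lambda>s. s $ i ^ a * s $ 3 ^ n) \<in> Lie_hamiltonians"
    using monomials_uptoD[OF n(1) ij, of n a 0] by simp
  \<comment> \<open>Here n > 0 is essential: z itself must already be available.\<close>
  have g: "(\<lambda>s. s $ 3) \<in> Lie_hamiltonians"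
    using monomials_uptoD[OF n(1) ij, of 1 0 0] n(2) by simp
  \<comment> \<open>The bracket {x_i^a z^n, z} is a x_i^(a-1) z^n {x_i, z}, and {x_i, z} = - F j has
    the term x_i z that raises the z-degree.\<close>
  define K where "K s = - of_nat a * (s $ i ^ (a - 1) * s $ 3 ^ n) * F j s" for s
  have "K \<in> Lie_hamiltonians"
  proof (rule Lie_hamiltonians_bracket[OF ij f g])
    show "complex_polynomial_function K"
      unfolding K_def F_eq[OF ji] by (intro cpf)
    fix s assume s: "s \<in> torus"
    have nz: "s $ i \<noteq> 0" "s $ j \<noteq> 0" using s by (auto simp: mem_torus[OF ij])
    note rules = chart_deriv_mult[OF ij s] chart_deriv_mult[OF ji s] chart_deriv_coord[OF ij s]
      chart_deriv_coord[OF ji s] chart_deriv_power[OF ij s] chart_deriv_power[OF ji s] cpf_rules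
    show "K s = s $ i * s $ j * (chart_deriv i (\<lambda>s. s $ i ^ a * s $ 3 ^ n) s * chart_deriv j (\<lambda>s. s $ 3) s
        - chart_deriv j (\<lambda>s. s $ i ^ a * s $ 3 ^ n) s * chart_deriv i (\<lambda>s. s $ 3) s)"
      using nz by (simp add: rules K_def field_simps)
  qed
  moreover have "(\<lambda>s. poly (pderiv (P j)) (s $ j) * (s $ i ^ (a - 1) * s $ 3 ^ n)) \<in> Lie_hamiltonians"
    by (rule Lie_hamiltonians_poly)
      (use monomials_uptoD[OF n(1) ij, of n "a - 1"] in \<open>simp add: mult_ac\<close>)
  ultimately have "(\<lambda>s. - inverse (of_nat a) * K s
      - poly (pderiv (P j)) (s $ j) * (s $ i ^ (a - 1) * s $ 3 ^ n)) \<in> Lie_hamiltonians"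
    by (intro Lie_hamiltonians_diff Lie_hamiltonians_scale)
  moreover have "- inverse (of_nat a) * K s - poly (pderiv (P j)) (s $ j) * (s $ i ^ (a - 1) * s $ 3 ^ n)
      = s $ i ^ a * s $ 3 ^ Suc n" for s
  proof -
    have "- inverse (of_nat a) * K s = s $ i ^ (a - 1) * s $ 3 ^ n * F j s"
      using a by (simp add: K_def field_simps)
    moreover have "s $ i ^ a = s $ i * s $ i ^ (a - 1)" using a by (cases a) auto
    ultimately show ?thesis by (simp add: F_eq[OF ji] algebra_simps)
  qed
  ultimately show ?thesis by simp
qed

text \<open>Starts the z-degree: z is not yet available for \<open>axis_step\<close>, but the
  mutation Hamiltonian minus its polynomial part in x_j is x_i z, and its bracket with x_i^b does
  the same work.\<close>

lemma axis_1:
  assumes ij: "xy_pair i j" and a: "a > 0"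
  shows "(\<lambda>s. s $ i ^ a * s $ 3) \<in> Lie_hamiltonians"
proof -
  note ji = xy_pair_sym[OF ij]
  have pw: "(\<lambda>s. s $ j ^ n * s $ i ^ m) \<in> Lie_hamiltonians" for n m
    using monomials_uptoD[OF monomials_upto_0 ji, of 0 n m] by simp
  have poly: "(\<lambda>s. poly r (s $ j) * s $ i ^ m) \<in> Lie_hamiltonians" for r m
    by (rule Lie_hamiltonians_poly) (rule pw)
  have 1: "(\<lambda>s. s $ i * s $ 3) \<in> Lie_hamiltonians"
    using Lie_hamiltonians_diff[OF Lie_hamiltonians_mutation[OF ij] poly[of "P\<^sub>1 j" 0]] by simp
  show ?thesis
  proof (cases "a = 1")
    case True
    then show ?thesis using 1 by simp
  next
    case False
    then obtain b where b: "a = Suc b" "b > 0" using a by (cases a) auto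
    define K where "K s = - of_nat b * s $ i ^ b * F j s" for s
    have "K \<in> Lie_hamiltonians"
    proof (rule Lie_hamiltonians_bracket[OF ij Lie_hamiltonians_power[OF ij, of b] 1])
      show "complex_polynomial_function K"
        unfolding K_def F_eq[OF ji] by (intro cpf)
      fix s assume s: "s \<in> torus"
      have nz: "s $ i \<noteq> 0" "s $ j \<noteq> 0" using s by (auto simp: mem_torus[OF ij])
      have "s $ i ^ b = s $ i * s $ i ^ (b - 1)" using b by (cases b) auto
      then show "K s = s $ i * s $ j * (chart_deriv i (\<lambda>s. s $ i ^ b) s * chart_deriv j (\<lambda>s. s $ i * s $ 3) s
        - chart_deriv j (\<lambda>s. s $ i ^ b) s * chart_deriv i (\<lambda>s. s $ i * s $ 3) s)"
        using nz by (simp add: K_def field_simps chart_deriv_mult[OF ij s] chart_deriv_mult[OF ji s]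
            chart_deriv_coord[OF ij s] chart_deriv_coord[OF ji s] chart_deriv_power[OF ij s]
            chart_deriv_power[OF ji s] cpf_rules)
    qed
    then have "(\<lambda>s. - inverse (of_nat b) * K s - poly (pderiv (P j)) (s $ j) * s $ i ^ b) \<in> Lie_hamiltonians"
      by (intro Lie_hamiltonians_diff Lie_hamiltonians_scale poly)
    moreover have "- inverse (of_nat b) * K s - poly (pderiv (P j)) (s $ j) * s $ i ^ b
        = s $ i ^ a * s $ 3" for s
    proof -
      have "- inverse (of_nat b) * K s = s $ i ^ b * F j s"
        using b by (simp add: K_def field_simps)
      then show ?thesis using b(1) by (simp add: F_eq[OF ji] algebra_simps)
    qed
    ultimately show ?thesis by simp
  qed
qed

lemma axis_Suc:
  assumes "xy_pair i j" "monomials_upto n" "a > 0"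
  shows "(\<lambda>s. s $ i ^ a * s $ 3 ^ Suc n) \<in> Lie_hamiltonians"
  using axis_step[OF assms(1,2)] axis_1[OF assms(1)] assms(3) by (cases "n = 0") auto

text \<open>The bracket of \<open>x z\<^bsup>n+1\<^esup>\<close> with \<open>y z\<close> contains \<open>x y z\<^bsup>n+2\<^esup> = z\<^bsup>n+1\<^esup> (1 - p - q)\<close>.\<close>

lemma z_power_step:
  assumes n: "monomials_upto n"
  shows "(\<lambda>s. s $ 3 ^ Suc n) \<in> Lie_hamiltonians"
proof -
  note ij = xy_pair_12 and ji = xy_pair_21
  let ?z = "\<lambda>s :: complex ^ 3. s $ 3 ^ Suc n"
  have f: "(\<lambda>s. s $ 1 * ?z s) \<in> Lie_hamiltonians" using axis_Suc[OF ij n, of 1] by simp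
  have g: "(\<lambda>s. s $ 2 * s $ 3) \<in> Lie_hamiltonians" using axis_1[OF ji, of 1] by simp
  \<comment> \<open>The factor \<open>[:0, 1:]\<close> removes the constant term, since the bare
    power of z is still to be produced.\<close>
  have axis: "(\<lambda>s. poly ([:0, 1:] * r) (s $ i) * ?z s) \<in> Lie_hamiltonians" if "xy_pair i j" for i j r
  proof -
    have "(\<lambda>s. s $ i ^ m * (s $ i * ?z s)) \<in> Lie_hamiltonians" for m
      using axis_Suc[OF that n, of "Suc m"] by (simp add: mult_ac)
    from Lie_hamiltonians_poly[OF this, of r] show ?thesis by (simp add: mult_ac)
  qed
  define K where "K s = - ?z s * (of_nat (Suc n) * (1 - poly (P 1) (s $ 1) - poly (P 2) (s $ 2))
      + s $ 2 * poly (pderiv (P 2)) (s $ 2) + of_nat (Suc n) * (s $ 1 * poly (pderiv (P 1)) (s $ 1)))"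
    for s
  have "K \<in> Lie_hamiltonians"
  proof (rule Lie_hamiltonians_bracket[OF ij f g])
    show "complex_polynomial_function K" unfolding K_def by (intro cpf)
    fix s assume s: "s \<in> torus"
    have nz: "s $ 1 \<noteq> 0" "s $ 2 \<noteq> 0" using s by (auto simp: mem_torus[OF ij])
    have e: "1 - poly (P 1) (s $ 1) - poly (P 2) (s $ 2) = s $ 1 * s $ 2 * s $ 3"
      using s by (simp add: mem_torus[OF ij] mem_S[OF ij] algebra_simps)
    note rules = chart_deriv_mult[OF ij s] chart_deriv_mult[OF ji s] chart_deriv_coord[OF ij s]
      chart_deriv_coord[OF ji s] chart_deriv_power[OF ij s] chart_deriv_power[OF ji s] cpf_rules
    show "K s = s $ 1 * s $ 2 * (chart_deriv 1 (\<lambda>s. s $ 1 * ?z s) s * chart_deriv 2 (\<lambda>s. s $ 2 * s $ 3) s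
        - chart_deriv 2 (\<lambda>s. s $ 1 * ?z s) s * chart_deriv 1 (\<lambda>s. s $ 2 * s $ 3) s)"
      unfolding K_def e using nz
      by (simp add: rules F_eq[OF ij] F_eq[OF ji] del: power_Suc)
        (simp add: field_simps)
  qed
  \<comment> \<open>All corrections to K have coefficients p, q, x p', y q', which vanish at 0
    because p(0) = q(0) = 0; each is therefore covered by \<open>axis\<close>.\<close>
  then have "(\<lambda>s. - inverse (of_nat (Suc n)) * (K s + poly ([:0, 1:] * pderiv (P 2)) (s $ 2) * ?z s)
        - poly ([:0, 1:] * pderiv (P 1)) (s $ 1) * ?z s
        + (poly ([:0, 1:] * P\<^sub>1 1) (s $ 1) * ?z s + poly ([:0, 1:] * P\<^sub>1 2) (s $ 2) * ?z s)) \<in> Lie_hamiltonians"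
    by (intro Lie_hamiltonians_add Lie_hamiltonians_diff Lie_hamiltonians_scale axis[OF ij] axis[OF ji])
  moreover have "- inverse (of_nat (Suc n)) * (K s + poly ([:0, 1:] * pderiv (P 2)) (s $ 2) * ?z s)
        - poly ([:0, 1:] * pderiv (P 1)) (s $ 1) * ?z s
        + (poly ([:0, 1:] * P\<^sub>1 1) (s $ 1) * ?z s + poly ([:0, 1:] * P\<^sub>1 2) (s $ 2) * ?z s) = ?z s" for s
  proof -
    define m :: complex where "m = of_nat (Suc n)"
    have m: "m \<noteq> 0" unfolding m_def using of_nat_neq_0 by blast
    show ?thesis
      unfolding K_def m_def[symmetric] P_eq[of 1] P_eq[of 2] using m
      by (simp add: field_simps del: power_Suc of_nat_Suc)
  qed
  ultimately show ?thesis by simp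
qed

text \<open>A monomial divisible by x y z loses a power of z through x y z = 1 - p - q. The others
  of the new degree are powers of z, possibly times powers of a single one of x and y, and come from
  the two preceding steps.\<close>

lemma monomials_upto: "monomials_upto n"
proof (induction n)
  case (Suc n)
  have "(\<lambda>s. s $ 1 ^ a * s $ 2 ^ b * s $ 3 ^ c) \<in> Lie_hamiltonians" if c: "c \<le> Suc n" for a b c
  proof (cases "c \<le> n")
    case True
    then show ?thesis using Suc by (simp add: monomials_upto_def)
  next
    case False
    then have c: "c = Suc n" using c by simp
    consider "a = 0" "b = 0" | "a > 0" "b = 0" | "a = 0" "b > 0" | a' b' where "a = Suc a'" "b = Suc b'"
      by (cases a; cases b) auto
    then show ?thesis
    proof cases
      case 4
      have m: "(\<lambda>s. s $ i ^ k * (s $ 1 ^ a' * s $ 2 ^ b' * s $ 3 ^ n)) \<in> Lie_hamiltonians"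
        if "xy_pair i j" for i j k
      proof -
        have "(\<lambda>s. s $ 1 ^ (k + a') * s $ 2 ^ b' * s $ 3 ^ n) \<in> Lie_hamiltonians"
          "(\<lambda>s. s $ 1 ^ a' * s $ 2 ^ (k + b') * s $ 3 ^ n) \<in> Lie_hamiltonians"
          using Suc by (simp_all add: monomials_upto_def)
        then show ?thesis using that by (auto simp: xy_pair_def power_add mult_ac)
      qed
      let ?m = "\<lambda>s :: complex ^ 3. s $ 1 ^ a' * s $ 2 ^ b' * s $ 3 ^ n"
      have "(\<lambda>s. s $ 1 ^ 0 * ?m s - poly (P 1) (s $ 1) * ?m s - poly (P 2) (s $ 2) * ?m s) \<in> Lie_hamiltonians"
        using m[OF xy_pair_12] m[OF xy_pair_21]
        by (intro Lie_hamiltonians_diff Lie_hamiltonians_poly)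
      then show ?thesis
      proof (rule Lie_hamiltonians_cong)
        show "complex_polynomial_function (\<lambda>s :: complex ^ 3. s $ 1 ^ a * s $ 2 ^ b * s $ 3 ^ c)"
          by (intro cpf)
        fix s assume "s \<in> torus"
        then have "1 - poly (P 1) (s $ 1) - poly (P 2) (s $ 2) = s $ 1 * s $ 2 * s $ 3"
          by (simp add: mem_torus[OF xy_pair_12] mem_S[OF xy_pair_12] algebra_simps)
        moreover have "s $ 1 ^ a * s $ 2 ^ b * s $ 3 ^ c = (s $ 1 * s $ 2 * s $ 3) * ?m s"
          by (simp add: 4 c mult_ac)
        ultimately have "s $ 1 ^ a * s $ 2 ^ b * s $ 3 ^ c
            = (1 - poly (P 1) (s $ 1) - poly (P 2) (s $ 2)) * ?m s" by simp
        then show "s $ 1 ^ a * s $ 2 ^ b * s $ 3 ^ c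
            = s $ 1 ^ 0 * ?m s - poly (P 1) (s $ 1) * ?m s - poly (P 2) (s $ 2) * ?m s"
          by (simp add: left_diff_distrib)
      qed
    qed (use z_power_step[OF Suc] axis_Suc[OF xy_pair_12 Suc] axis_Suc[OF xy_pair_21 Suc] c in simp_all)
  qed
  then show ?case unfolding monomials_upto_def by blast
qed (rule monomials_upto_0)

lemma Lie_hamiltonians_all: "complex_polynomial_function h \<Longrightarrow> h \<in> Lie_hamiltonians"
  using monomials_upto
  by (rule_tac cpf_span) (auto simp: Lie_hamiltonians_add Lie_hamiltonians_scale monomials_upto_def)

end

section \<open>Bivariate polynomials\<close>

text \<open>The outer variable is x and the coefficients lie in C[y], so a condition on poles along
  x = 0 is a condition on single coefficients.\<close>

definition poly2 :: "complex poly poly \<Rightarrow> complex \<Rightarrow> complex \<Rightarrow> complex"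
  where "poly2 R x y = poly (poly R [:x:]) y"

lemma poly2_0 [simp]: "poly2 0 x y = 0"
  and poly2_add [simp]: "poly2 (R + T) x y = poly2 R x y + poly2 T x y"
  and poly2_diff [simp]: "poly2 (R - T) x y = poly2 R x y - poly2 T x y"
  and poly2_minus [simp]: "poly2 (- R) x y = - poly2 R x y"
  and poly2_mult [simp]: "poly2 (R * T) x y = poly2 R x y * poly2 T x y"
  and poly2_smult [simp]: "poly2 (smult r R) x y = poly r y * poly2 R x y"
  and poly2_pCons [simp]: "poly2 (pCons r R) x y = poly r y + x * poly2 R x y"
  by (simp_all add: poly2_def)

lemma poly_const_power: "[:x:] ^ n = [:x ^ n:]" for x :: "'a::comm_semiring_1"
  by (induction n) (auto simp: one_pCons mult.commute)

lemma poly2_monom [simp]: "poly2 (monom r n) x y = poly r y * x ^ n"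
  by (simp add: poly2_def poly_monom poly_const_power)

lemma poly2_sum: "poly2 (\<Sum>k\<in>K. R k) x y = (\<Sum>k\<in>K. poly2 (R k) x y)"
  by (induction K rule: infinite_finite_induct) auto

lemma poly2_altdef: "poly2 R x y = (\<Sum>k\<le>degree R. poly (coeff R k) y * x ^ k)"
  by (simp add: poly2_def poly_altdef[of R] poly_sum poly_const_power mult.commute)

lemma poly2_lift: "poly2 (map_poly (\<lambda>c. [:c:]) r) x y = poly r x"
  by (induction r) (auto simp: map_poly_pCons)

lemma poly2_eq_0:
  assumes "\<And>x y. x \<noteq> 0 \<Longrightarrow> y \<noteq> 0 \<Longrightarrow> poly2 R x y = 0"
  shows "R = 0"
proof -
  have inf: "infinite (- {0::complex})" by (simp add: infinite_UNIV_char_0 Compl_eq_Diff_UNIV)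
  have *: "poly R [:x:] = 0" if "x \<noteq> 0" for x
  proof (rule ccontr)
    assume "poly R [:x:] \<noteq> 0"
    then have "finite {y. poly (poly R [:x:]) y = 0}" by (rule poly_roots_finite)
    then have "finite (- {0::complex})"
      by (rule finite_subset[rotated]) (use assms that in \<open>auto simp: poly2_def\<close>)
    with inf show False by simp
  qed
  show ?thesis
  proof (rule ccontr)
    assume "R \<noteq> 0"
    then have "finite {r. poly R r = 0}" by (rule poly_roots_finite)
    then have "finite ((\<lambda>x. [:x:]) ` (- {0::complex}))"
      by (rule finite_subset[rotated]) (use * in auto)
    then have "finite (- {0::complex})" by (rule finite_imageD) (auto simp: inj_on_def)
    with inf show False by simp
  qed
qed

lemma poly2_of_coeffs:
  assumes "\<And>k l. K < k \<or> L < l \<Longrightarrow> c k l = 0"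
  obtains R :: "complex poly poly" where "\<And>k l. coeff (coeff R k) l = c k l"
proof
  fix k l
  show "coeff (coeff (\<Sum>k\<le>K. monom (\<Sum>l\<le>L. monom (c k l) l) k) k) l = c k l"
    using assms[of k l] by (auto simp: coeff_sum if_distrib[of "\<lambda>p. coeff p l"] sum.delta' cong: if_cong)
qed

text \<open>Exchanging the variables turns conditions along y = 0 into instances of
  \<open>adapted\<close>.\<close>

definition swap_poly2 :: "complex poly poly \<Rightarrow> complex poly poly"
  where "swap_poly2 R = (\<Sum>k\<le>degree R. map_poly (\<lambda>c. monom c k) (coeff R k))"

lemma coeff_swap_poly2 [simp]: "coeff (coeff (swap_poly2 R) l) k = coeff (coeff R k) l"
  by (cases "k \<le> degree R")
    (auto simp: swap_poly2_def coeff_sum coeff_map_poly coeff_eq_0)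

lemma poly2_swap [simp]: "poly2 (swap_poly2 R) y x = poly2 R x y"
proof -
  have "poly2 (map_poly (\<lambda>c. monom c k) r) y x = poly r y * x ^ k" for r k
    by (induction r) (auto simp: map_poly_pCons poly_monom algebra_simps)
  then show ?thesis by (simp only: swap_poly2_def poly2_sum poly2_altdef[of R])
qed

lemma degree_coeff_bound:
  fixes R :: "complex poly poly"
  obtains L where "\<And>k l. L < l \<Longrightarrow> coeff (coeff R k) l = 0"
proof
  fix k l assume "degree (swap_poly2 R) < l"
  then have "coeff (swap_poly2 R) l = 0" by (rule coeff_eq_0)
  then show "coeff (coeff R k) l = 0" using coeff_swap_poly2[of R l k] by simp
qed

section \<open>The Euler operator x d/dx and pole conditions along x = 0\<close>

definition euler :: "complex poly poly \<Rightarrow> complex poly poly"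
  where "euler R = pCons 0 (pderiv R)"

lemma coeff_euler: "coeff (euler R) k = of_nat k * coeff R k"
  by (cases k) (auto simp: euler_def coeff_pderiv)

lemma poly2_DERIV: "((\<lambda>t. poly2 R (x + t) y) has_field_derivative poly2 (pderiv R) x y) (at 0)"
  by (induction R) (auto intro!: derivative_eq_intros simp: pderiv_pCons)

text \<open>For \<open>R\<close> with \<open>(x y)\<^sup>N f = R\<close>, this is the regularity of \<open>f\<close> along the lines \<open>x = 0\<close>,
  \<open>q(y) = 1\<close> of the surface, where \<open>(1 - q) / x\<close> is regular.\<close>

definition adapted :: "complex poly \<Rightarrow> nat \<Rightarrow> complex poly poly \<Rightarrow> bool"
  where "adapted q N R \<longleftrightarrow> (\<forall>k. (1 - q) ^ (N - k) dvd coeff R k)"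

lemma adapted_add: "adapted q N R \<Longrightarrow> adapted q N T \<Longrightarrow> adapted q N (R + T)"
  and adapted_diff: "adapted q N R \<Longrightarrow> adapted q N T \<Longrightarrow> adapted q N (R - T)"
  and adapted_minus: "adapted q N R \<Longrightarrow> adapted q N (- R)"
  by (auto simp: adapted_def)

lemma adapted_mult:
  assumes R: "adapted q M R" and T: "adapted q N T"
  shows "adapted q (M + N) (R * T)"
  unfolding adapted_def coeff_mult
proof (intro allI dvd_sum)
  fix k l :: nat assume l: "l \<in> {..k}"
  have "(1 - q) ^ (M + N - k) dvd (1 - q) ^ ((M - l) + (N - (k - l)))"
    using l by (intro le_imp_power_dvd) auto
  also have "\<dots> dvd coeff R l * coeff T (k - l)"
    unfolding power_add using R T by (intro mult_dvd_mono) (auto simp: adapted_def)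
  finally show "(1 - q) ^ (M + N - k) dvd coeff R l * coeff T (k - l)" .
qed

lemma adapted_monom:
  assumes "(1 - q) ^ (N - n) dvd r"
  shows "adapted q N (monom r n)"
  using assms by (auto simp: adapted_def)

lemma adapted_pCons: "adapted q N R \<Longrightarrow> adapted q (Suc N) (pCons 0 R)"
  by (auto simp: adapted_def coeff_pCons split: nat.split)

text \<open>The operator multiplies the coefficient of x^k by k - M. For k < M this is invertible
  and keeps divisibility; for k >= M the required power of 1 - q is trivial, so the extra term at
  x^M does no harm.\<close>

lemma adapted_euler:
  assumes eq: "euler R - of_nat M * R = T - monom r M" and T: "adapted q M T"
  shows "adapted q M R"
  unfolding adapted_def
proof
  fix k
  show "(1 - q) ^ (M - k) dvd coeff R k"
  proof (cases "k < M")
    case True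
    let ?c = "of_nat k - of_nat M :: complex"
    have "of_nat k * coeff R k - of_nat M * coeff R k = coeff T k"
      using arg_cong[OF eq, of "\<lambda>R. coeff R k"] True by (simp add: coeff_euler of_nat_poly)
    then have "smult ?c (coeff R k) = coeff T k"
      by (simp add: of_nat_poly smult_diff_left)
    moreover have "?c \<noteq> 0" using True by simp
    ultimately have "coeff R k = smult (inverse ?c) (coeff T k)"
      by (metis left_inverse smult_1_left smult_smult)
    then show ?thesis using T by (simp add: adapted_def dvd_smult)
  qed simp
qed

context simple_root_surface
begin

section \<open>Regular functions as Laurent polynomials\<close>

definition chart :: "3 \<Rightarrow> 3 \<Rightarrow> complex \<Rightarrow> complex \<Rightarrow> complex ^ 3"
  where "chart i j x y = point i j x y ((1 - poly (P i) x - poly (P j) y) / (x * y))"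

lemma chart_nth [simp]: "chart i j x y $ i = x" "xy_pair i j \<Longrightarrow> chart i j x y $ j = y"
  by (auto simp: chart_def)

lemma chart_swap: "xy_pair i j \<Longrightarrow> chart j i y x = chart i j x y"
  using xy_pair_sym[of i j]
  by (intro xy_pair_eqI[of i j]) (auto simp: chart_def algebra_simps)

lemma chart_torus: "xy_pair i j \<Longrightarrow> x \<noteq> 0 \<Longrightarrow> y \<noteq> 0 \<Longrightarrow> chart i j x y \<in> torus"
  by (simp add: mem_torus mem_S chart_def)

lemma torus_chart:
  assumes "xy_pair i j" "s \<in> torus"
  obtains x y where "x \<noteq> 0" "y \<noteq> 0" "s = chart i j x y"
proof
  show "s = chart i j (s $ i) (s $ j)"
    using z_eq[OF assms] assms by (intro xy_pair_eqI[OF assms(1)]) (auto simp: chart_def)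
qed (use assms in \<open>auto simp: mem_torus\<close>)

lemma chart_curve_chart:
  assumes "xy_pair i j" shows "chart_curve i (chart i j x y) t = chart i j (x + t) y"
  using assms by (simp add: chart_curve_eq chart_def)

text \<open>Asking for every large exponent N lets sums share one N and products split N as M + (N -
  M).\<close>

lemma regular_imp_adapted:
  assumes ij: "xy_pair i j" and f: "complex_polynomial_function f"
  shows "\<exists>N\<^sub>0. \<forall>N\<ge>N\<^sub>0. \<exists>R. adapted (P j) N R \<and>
    (\<forall>x y. x \<noteq> 0 \<longrightarrow> y \<noteq> 0 \<longrightarrow> (x * y) ^ N * f (chart i j x y) = poly2 R x y)"
  using f
proof induction
  case (const c)
  have "adapted (P j) N (monom (monom c N) N)" for N by (rule adapted_monom) simp
  then show ?case
    by (intro exI allI impI conjI) (auto simp: poly_monom power_mult_distrib mult_ac)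
next
  case (coord k)
  consider "k = i" | "k = j" | "k = 3" using ij exhaust_3[of k] by (auto simp: xy_pair_def)
  then show ?case
  proof cases
    case 1
    have "adapted (P j) N (monom (monom 1 N) (Suc N))" for N by (rule adapted_monom) simp
    then show ?thesis unfolding 1
      by (intro exI allI impI conjI) (auto simp: poly_monom power_mult_distrib mult_ac)
  next
    case 2
    have "adapted (P j) N (monom (monom 1 (Suc N)) N)" for N by (rule adapted_monom) simp
    then show ?thesis unfolding 2
      by (intro exI allI impI conjI) (auto simp: poly_monom power_mult_distrib mult_ac ij)
  next
    case 3
    have "\<exists>R. adapted (P j) (Suc N) R \<and> (\<forall>x y. x \<noteq> 0 \<longrightarrow> y \<noteq> 0 \<longrightarrow>
        (x * y) ^ Suc N * chart i j x y $ 3 = poly2 R x y)" for N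
    proof (intro exI conjI allI impI)
      \<comment> \<open>From x y z = (1 - P j(y)) - x \<open>P\<^sub>1 i\<close>(x): the term of
        order x^N carries the factor 1 - P j demanded at exponent N + 1, and the rest has one more
        x.\<close>
      let ?R = "monom (monom 1 N * (1 - P j)) N
        - monom (monom 1 N) (Suc N) * map_poly (\<lambda>c. [:c:]) (P\<^sub>1 i)"
      have "adapted (P j) (Suc N) (monom (monom 1 N) (Suc N))" by (rule adapted_monom) simp
      from adapted_mult[OF this, of 0] have
        "adapted (P j) (Suc N) (monom (monom 1 N) (Suc N) * map_poly (\<lambda>c. [:c:]) (P\<^sub>1 i))"
        by (simp add: adapted_def)
      then show "adapted (P j) (Suc N) ?R" by (intro adapted_diff adapted_monom) auto
      fix x y :: complex assume "x \<noteq> 0" "y \<noteq> 0"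
      then have "x * y * chart i j x y $ 3 = 1 - x * poly (P\<^sub>1 i) x - poly (P j) y"
        by (simp add: chart_def ij P_eq[of i x])
      then have "(x * y) ^ Suc N * chart i j x y $ 3
          = (x * y) ^ N * (1 - x * poly (P\<^sub>1 i) x - poly (P j) y)"
        by (simp add: mult_ac)
      then show "(x * y) ^ Suc N * chart i j x y $ 3 = poly2 ?R x y"
        by (simp add: poly2_lift poly_monom power_mult_distrib algebra_simps)
    qed
    then show ?thesis unfolding 3 by (intro exI[of _ 1]) (metis One_nat_def Suc_le_D)
  qed
next
  case (add f g)
  then obtain M N where M: "\<forall>n\<ge>M. \<exists>R. adapted (P j) n R \<and>
      (\<forall>x y. x \<noteq> 0 \<longrightarrow> y \<noteq> 0 \<longrightarrow> (x * y) ^ n * f (chart i j x y) = poly2 R x y)"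
    and N: "\<forall>n\<ge>N. \<exists>R. adapted (P j) n R \<and>
      (\<forall>x y. x \<noteq> 0 \<longrightarrow> y \<noteq> 0 \<longrightarrow> (x * y) ^ n * g (chart i j x y) = poly2 R x y)" by blast
  show ?case
  proof (rule exI[of _ "M + N"], intro allI impI)
    fix n assume n: "n \<ge> M + N"
    obtain R T where "adapted (P j) n R" "adapted (P j) n T"
      "\<And>x y. x \<noteq> 0 \<Longrightarrow> y \<noteq> 0 \<Longrightarrow> (x * y) ^ n * f (chart i j x y) = poly2 R x y"
      "\<And>x y. x \<noteq> 0 \<Longrightarrow> y \<noteq> 0 \<Longrightarrow> (x * y) ^ n * g (chart i j x y) = poly2 T x y"
      using M[rule_format, of n] N[rule_format, of n] n by auto
    then show "\<exists>R. adapted (P j) n R \<and> (\<forall>x y. x \<noteq> 0 \<longrightarrow> y \<noteq> 0 \<longrightarrow>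
        (x * y) ^ n * (f (chart i j x y) + g (chart i j x y)) = poly2 R x y)"
      by (intro exI[of _ "R + T"]) (auto simp: adapted_add distrib_left)
  qed
next
  case (mult f g)
  then obtain M N where M: "\<forall>n\<ge>M. \<exists>R. adapted (P j) n R \<and>
      (\<forall>x y. x \<noteq> 0 \<longrightarrow> y \<noteq> 0 \<longrightarrow> (x * y) ^ n * f (chart i j x y) = poly2 R x y)"
    and N: "\<forall>n\<ge>N. \<exists>R. adapted (P j) n R \<and>
      (\<forall>x y. x \<noteq> 0 \<longrightarrow> y \<noteq> 0 \<longrightarrow> (x * y) ^ n * g (chart i j x y) = poly2 R x y)" by blast
  show ?case
  proof (rule exI[of _ "M + N"], intro allI impI)
    fix n assume n: "n \<ge> M + N"
    then have "N \<le> n - M" by simp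
    then obtain R T where RT: "adapted (P j) M R" "adapted (P j) (n - M) T"
      "\<And>x y. x \<noteq> 0 \<Longrightarrow> y \<noteq> 0 \<Longrightarrow> (x * y) ^ M * f (chart i j x y) = poly2 R x y"
      "\<And>x y. x \<noteq> 0 \<Longrightarrow> y \<noteq> 0 \<Longrightarrow> (x * y) ^ (n - M) * g (chart i j x y) = poly2 T x y"
      using M N by (metis order_refl)
    have "(x * y) ^ n = (x * y) ^ M * (x * y) ^ (n - M)" for x y :: complex
      using n by (simp flip: power_add)
    then have "(x * y) ^ n * (f (chart i j x y) * g (chart i j x y)) = poly2 (R * T) x y"
      if "x \<noteq> 0" "y \<noteq> 0" for x y
      using RT(3,4)[OF that] by (simp add: mult_ac flip: RT(3,4)[OF that])
    then show "\<exists>R. adapted (P j) n R \<and> (\<forall>x y. x \<noteq> 0 \<longrightarrow> y \<noteq> 0 \<longrightarrow>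
        (x * y) ^ n * (f (chart i j x y) * g (chart i j x y)) = poly2 R x y)"
      using adapted_mult[OF RT(1,2)] n by (intro exI[of _ "R * T"]) auto
  qed
qed

text \<open>Dividing (1 - P j)^(M-k) x^k by x^M gives w^(M-k), where w = (1 - P j) / x is regular.
  Truncated subtraction treats k < M and k > M together, since one of the exponents M - k and k - M
  is 0.\<close>

lemma adapted_imp_regular:
  assumes ij: "xy_pair i j" and R: "adapted (P j) M R"
  obtains f where "complex_polynomial_function f"
    "\<And>x y. x \<noteq> 0 \<Longrightarrow> y \<noteq> 0 \<Longrightarrow> x ^ M * f (chart i j x y) = poly2 R x y"
proof -
  have "\<forall>k. \<exists>r. coeff R k = (1 - P j) ^ (M - k) * r" using R by (simp add: adapted_def dvd_def)
  then obtain r where r: "\<And>k. coeff R k = (1 - P j) ^ (M - k) * r k" by metis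
  define w where "w s = poly (P\<^sub>1 i) (s $ i) + s $ j * s $ 3" for s :: "complex ^ 3"
  define f where "f s = (\<Sum>k\<le>degree R. w s ^ (M - k) * s $ i ^ (k - M) * poly (r k) (s $ j))" for s
  have "complex_polynomial_function f" unfolding f_def w_def by (intro cpf cpf_sum)
  moreover have "x ^ M * f (chart i j x y) = poly2 R x y" if "x \<noteq> 0" "y \<noteq> 0" for x y
  proof -
    have w: "x * w (chart i j x y) = 1 - poly (P j) y"
      using that ij by (simp add: w_def chart_def P_eq[of i x] field_simps)
    have "x ^ M * (w (chart i j x y) ^ (M - k) * x ^ (k - M) * poly (r k) y)
        = poly (coeff R k) y * x ^ k" for k
    proof -
      have "M + (k - M) = (M - k) + k" by simp
      then have "x ^ M * x ^ (k - M) = x ^ (M - k) * x ^ k" by (metis power_add)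
      then have "x ^ M * (w (chart i j x y) ^ (M - k) * x ^ (k - M) * poly (r k) y)
          = (x * w (chart i j x y)) ^ (M - k) * poly (r k) y * x ^ k"
        by (simp add: power_mult_distrib mult_ac)
      then show ?thesis by (simp add: w r)
    qed
    then show ?thesis by (simp add: f_def poly2_altdef sum_distrib_left ij)
  qed
  ultimately show ?thesis by (rule that)
qed

text \<open>The lines over x = 0 and y = 0 are disjoint: as p and q vanish at 0, the equation of
  \<open>S\<close> reads u x + v y = 1. Each power is raised by multiplying a term with such a
  1.\<close>

lemma coprime_powers:
  assumes ij: "xy_pair i j"
  obtains g h where "complex_polynomial_function g" "complex_polynomial_function h"
    "\<And>s. s \<in> S \<Longrightarrow> g s * s $ i ^ m + h s * s $ j ^ n = 1"
proof -
  define u where "u s = poly (P\<^sub>1 i) (s $ i) + s $ j * s $ 3" for s :: "complex ^ 3"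
  define v where "v s = poly (P\<^sub>1 j) (s $ j)" for s :: "complex ^ 3"
  have uv: "complex_polynomial_function u" "complex_polynomial_function v"
    unfolding u_def v_def by (intro cpf)+
  have uv_1: "u s * s $ i + v s * s $ j = 1" if "s \<in> S" for s
    using that by (simp add: mem_S[OF ij] u_def v_def P_eq algebra_simps)
  have "\<exists>g h. complex_polynomial_function g \<and> complex_polynomial_function h \<and>
      (\<forall>s\<in>S. g s * s $ i ^ m + h s * s $ j = 1)"
  proof (induction m)
    case 0
    show ?case by (intro exI[of _ "\<lambda>_. 1"] exI[of _ "\<lambda>_. 0"]) (auto intro: cpf)
  next
    case (Suc m)
    then obtain g h where gh: "complex_polynomial_function g" "complex_polynomial_function h"
      "\<forall>s\<in>S. g s * s $ i ^ m + h s * s $ j = 1" by blast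
    have "g s * u s * s $ i ^ Suc m + (g s * s $ i ^ m * v s + h s) * s $ j = 1" if "s \<in> S" for s
    proof -
      have "g s * u s * s $ i ^ Suc m + (g s * s $ i ^ m * v s + h s) * s $ j
          = g s * s $ i ^ m * (u s * s $ i + v s * s $ j) + h s * s $ j"
        by (simp add: algebra_simps)
      then show ?thesis using gh(3) uv_1 that by simp
    qed
    moreover have "complex_polynomial_function (\<lambda>s. g s * u s)"
      "complex_polynomial_function (\<lambda>s. g s * s $ i ^ m * v s + h s)"
      by (intro cpf gh uv)+
    ultimately show ?case by blast
  qed
  then obtain g\<^sub>1 h\<^sub>1 where gh1: "complex_polynomial_function g\<^sub>1" "complex_polynomial_function h\<^sub>1"
    "\<forall>s\<in>S. g\<^sub>1 s * s $ i ^ m + h\<^sub>1 s * s $ j = 1" by blast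
  have "\<exists>g h. complex_polynomial_function g \<and> complex_polynomial_function h \<and>
      (\<forall>s\<in>S. g s * s $ i ^ m + h s * s $ j ^ n = 1)"
  proof (induction n)
    case 0
    show ?case by (intro exI[of _ "\<lambda>_. 0"] exI[of _ "\<lambda>_. 1"]) (auto intro: cpf)
  next
    case (Suc n)
    then obtain g h where gh: "complex_polynomial_function g" "complex_polynomial_function h"
      "\<forall>s\<in>S. g s * s $ i ^ m + h s * s $ j ^ n = 1" by blast
    have "(g s + h s * s $ j ^ n * g\<^sub>1 s) * s $ i ^ m + h s * h\<^sub>1 s * s $ j ^ Suc n = 1"
      if "s \<in> S" for s
    proof -
      have "(g s + h s * s $ j ^ n * g\<^sub>1 s) * s $ i ^ m + h s * h\<^sub>1 s * s $ j ^ Suc n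
          = g s * s $ i ^ m + h s * s $ j ^ n * (g\<^sub>1 s * s $ i ^ m + h\<^sub>1 s * s $ j)"
        by (simp add: algebra_simps)
      then show ?thesis using gh(3) gh1(3) that by simp
    qed
    moreover have "complex_polynomial_function (\<lambda>s. g s + h s * s $ j ^ n * g\<^sub>1 s)"
      "complex_polynomial_function (\<lambda>s. h s * h\<^sub>1 s)"
      by (intro cpf gh gh1)+
    ultimately show ?case by blast
  qed
  then show ?thesis using that by blast
qed

text \<open>The two conditions give \<open>x\<^sup>M h\<close> and \<open>y\<^sup>M h\<close> regular for \<open>h = R / (x y)\<^sup>M\<close>, and \<open>x\<^sup>M\<close>, \<open>y\<^sup>M\<close> generate
  the unit ideal.\<close>

lemma Laurent_regular:
  assumes ij: "xy_pair i j" and R: "adapted (P j) M R" "adapted (P i) M (swap_poly2 R)"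
  obtains h where "complex_polynomial_function h"
    "\<And>x y. x \<noteq> 0 \<Longrightarrow> y \<noteq> 0 \<Longrightarrow> (x * y) ^ M * h (chart i j x y) = poly2 R x y"
proof -
  obtain a where a: "complex_polynomial_function a"
    "\<And>x y. x \<noteq> 0 \<Longrightarrow> y \<noteq> 0 \<Longrightarrow> x ^ M * a (chart i j x y) = poly2 R x y"
    using adapted_imp_regular[OF ij R(1)] by blast
  obtain b where b: "complex_polynomial_function b"
    "\<And>x y. x \<noteq> 0 \<Longrightarrow> y \<noteq> 0 \<Longrightarrow> x ^ M * b (chart j i x y) = poly2 (swap_poly2 R) x y"
    using adapted_imp_regular[OF xy_pair_sym[OF ij] R(2)] by blast
  obtain g h where gh: "complex_polynomial_function g" "complex_polynomial_function h"
    "\<And>s. s \<in> S \<Longrightarrow> g s * s $ i ^ M + h s * s $ j ^ M = 1"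
    using coprime_powers[OF ij] by blast
  show ?thesis
  proof (rule that)
    \<comment> \<open>With f = R / (x y)^M, the functions b and a represent x^M f and y^M f, and g
      x^M + h y^M = 1 recombines them to f.\<close>
    show "complex_polynomial_function (\<lambda>s. g s * b s + h s * a s)" by (intro cpf a b gh)
    fix x y :: complex assume xy: "x \<noteq> 0" "y \<noteq> 0"
    let ?s = "chart i j x y"
    have b': "y ^ M * b ?s = poly2 R x y"
      using b(2)[OF xy(2,1)] by (simp add: chart_swap[OF ij])
    have one: "g ?s * x ^ M + h ?s * y ^ M = 1"
      using gh(3)[OF torus_S[OF chart_torus[OF ij xy]]] by (simp add: ij)
    have "(x * y) ^ M * (g ?s * b ?s + h ?s * a ?s)
        = g ?s * x ^ M * (y ^ M * b ?s) + h ?s * y ^ M * (x ^ M * a ?s)"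
      by (simp add: power_mult_distrib algebra_simps)
    also have "\<dots> = (g ?s * x ^ M + h ?s * y ^ M) * poly2 R x y"
      unfolding a(2)[OF xy] b' by (simp add: algebra_simps)
    finally show "(x * y) ^ M * (g ?s * b ?s + h ?s * a ?s) = poly2 R x y" by (simp add: one)
  qed
qed

text \<open>On numerators over (x y)^M the operator x d/dx becomes \<open>euler\<close> minus M, the
  shift coming from the denominator.\<close>

lemma chart_deriv_poly2:
  assumes ij: "xy_pair i j" and h: "complex_polynomial_function h"
    and eq: "\<And>x y. x \<noteq> 0 \<Longrightarrow> y \<noteq> 0 \<Longrightarrow> (x * y) ^ M * h (chart i j x y) = poly2 R x y"
    and xy: "x \<noteq> 0" "y \<noteq> 0"
  shows "(x * y) ^ M * (x * chart_deriv i h (chart i j x y)) = poly2 (euler R) x y - of_nat M * poly2 R x y"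
proof -
  note s = chart_torus[OF ij xy]
  let ?h' = "chart_deriv i h (chart i j x y)"
  have d: "((\<lambda>t. h (chart i j (x + t) y)) has_field_derivative ?h') (at 0)"
    using chart_deriv[OF h ij s] by (simp add: chart_curve_chart[OF ij])
  have der: "((\<lambda>t. ((x + t) * y) ^ M * h (chart i j (x + t) y)) has_field_derivative
      of_nat M * (x * y) ^ (M - 1) * y * h (chart i j x y) + (x * y) ^ M * ?h') (at 0)"
  proof -
    have "((\<lambda>t. ((x + t) * y) ^ M) has_field_derivative of_nat M * (x * y) ^ (M - 1) * y) (at 0)"
      by (auto intro!: derivative_eq_intros)
    from DERIV_mult[OF this d] show ?thesis by (simp add: mult.commute)
  qed
  have "eventually (\<lambda>t. ((x + t) * y) ^ M * h (chart i j (x + t) y) = poly2 R (x + t) y) (nhds 0)"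
  proof -
    have "((\<lambda>t. x + t) \<longlongrightarrow> x + 0) (nhds 0)" by (intro tendsto_intros filterlim_ident)
    then have "eventually (\<lambda>t. x + t \<noteq> 0) (nhds 0)"
      using xy by (intro tendsto_imp_eventually_ne) auto
    then show ?thesis by eventually_elim (use eq xy in auto)
  qed
  from DERIV_cong_ev[OF refl this refl, THEN iffD1, OF der]
  have "((\<lambda>t. poly2 R (x + t) y) has_field_derivative
      of_nat M * (x * y) ^ (M - 1) * y * h (chart i j x y) + (x * y) ^ M * ?h') (at 0)" .
  from DERIV_unique[OF this poly2_DERIV]
  have "x * poly2 (pderiv R) x y
      = x * (of_nat M * (x * y) ^ (M - 1) * y * h (chart i j x y) + (x * y) ^ M * ?h')" by simp
  also have "\<dots> = of_nat M * ((x * y) ^ M * h (chart i j x y)) + (x * y) ^ M * (x * ?h')"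
    by (cases M) (auto simp: algebra_simps)
  finally show ?thesis unfolding eq[OF xy] by (simp add: euler_def)
qed

end

section \<open>Potentials of divergence-free fields and the logarithmic remainder\<close>

context surface_with_form
begin

text \<open>The equations to solve are beta/y = x h_x + b and alpha/x = - y h_y + a. On Laurent
  coefficients they are diagonal, and divergence zero is their compatibility.\<close>

lemma potential:
  assumes ij: "xy_pair i j" and \<xi>: "\<xi> \<in> AVF S \<omega>"
  obtains h a b where "complex_polynomial_function h"
    "\<And>s. s \<in> torus \<Longrightarrow> \<xi> (coordinate S i) s = - s $ i * s $ j * chart_deriv j h s + a * s $ i"
    "\<And>s. s \<in> torus \<Longrightarrow> \<xi> (coordinate S j) s = s $ i * s $ j * chart_deriv i h s + b * s $ j"
proof -
  note ji = xy_pair_sym[OF ij]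
  have avf: "\<xi> \<in> alg_vector_fields S" and dz: "divergence_zero S \<omega> \<xi>"
    using \<xi> by (auto simp: AVF_def)
  obtain \<alpha> \<beta> where cpf': "complex_polynomial_function \<alpha>" "complex_polynomial_function \<beta>"
    and comp: "\<xi> (coordinate S i) = restrict0 S \<alpha>" "\<xi> (coordinate S j) = restrict0 S \<beta>"
    using avf_regular[OF avf, THEN regularE] by metis
  obtain N\<^sub>1 where N1: "\<And>N. N \<ge> N\<^sub>1 \<Longrightarrow> \<exists>R. adapted (P j) N R \<and>
    (\<forall>x y. x \<noteq> 0 \<longrightarrow> y \<noteq> 0 \<longrightarrow> (x * y) ^ N * \<beta> (chart i j x y) = poly2 R x y)"
    using regular_imp_adapted[OF ij cpf'(2)] by blast
  obtain N\<^sub>2 where N2: "\<And>N. N \<ge> N\<^sub>2 \<Longrightarrow> \<exists>R. adapted (P i) N R \<and>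
    (\<forall>x y. x \<noteq> 0 \<longrightarrow> y \<noteq> 0 \<longrightarrow> (x * y) ^ N * \<alpha> (chart j i x y) = poly2 R x y)"
    using regular_imp_adapted[OF ji cpf'(1)] by blast
  define N where "N = N\<^sub>1 + N\<^sub>2"
  \<comment> \<open>One extra factor x y clears the divisions in alpha/x and beta/y, whose
    numerators over (x y)^M are A and B.\<close>
  define M where "M = Suc N"
  obtain B\<^sub>0 where B0: "adapted (P j) N B\<^sub>0"
    "\<And>x y. x \<noteq> 0 \<Longrightarrow> y \<noteq> 0 \<Longrightarrow> (x * y) ^ N * \<beta> (chart i j x y) = poly2 B\<^sub>0 x y"
    using N1[of N] unfolding N_def by auto
  obtain A\<^sub>0 where A0: "adapted (P i) N A\<^sub>0"
    "\<And>x y. x \<noteq> 0 \<Longrightarrow> y \<noteq> 0 \<Longrightarrow> (x * y) ^ N * \<alpha> (chart j i x y) = poly2 A\<^sub>0 x y"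
    using N2[of N] unfolding N_def by auto
  define A B where "A = pCons 0 A\<^sub>0" and "B = pCons 0 B\<^sub>0"
  have A: "adapted (P i) M A" and B: "adapted (P j) M B"
    unfolding A_def B_def M_def by (rule adapted_pCons A0 B0)+
  have A_eq: "(y * x) ^ M * \<alpha> (chart j i y x) = x * poly2 A y x"
    and B_eq: "(x * y) ^ M * \<beta> (chart i j x y) = y * poly2 B x y" if "x \<noteq> 0" "y \<noteq> 0" for x y
    using A0(2)[OF that(2,1)] B0(2)[OF that] by (auto simp: A_def B_def M_def mult_ac)
  \<comment> \<open>A and B are ordered for the pole conditions; divergence differentiates alpha by
    x and beta by y, which needs the opposite outer variable.\<close>
  define A' B' where "A' = swap_poly2 A" and "B' = swap_poly2 B"
  have A'_eq: "(x * y) ^ M * \<alpha> (chart i j x y) = poly2 (pCons 0 A') x y"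
    and B'_eq: "(y * x) ^ M * \<beta> (chart j i y x) = poly2 (pCons 0 B') y x"
    if "x \<noteq> 0" "y \<noteq> 0" for x y
    using A_eq[OF that] B_eq[OF that] by (auto simp: A'_def B'_def chart_swap[OF ij] mult.commute)
  have euler_pCons: "poly2 (euler (pCons 0 R)) x y = x * (poly2 R x y + poly2 (euler R) x y)" for R x y
    by (simp add: euler_def pderiv_pCons algebra_simps)
  have "poly2 (euler A' + swap_poly2 (euler B') - of_nat M * (A' + B)) x y = 0"
    if xy: "x \<noteq> 0" "y \<noteq> 0" for x y
  proof -
    let ?s = "chart i j x y"
    note s = chart_torus[OF ij xy]
    have da: "(x * y) ^ M * (x * chart_deriv i \<alpha> ?s)
        = x * (poly2 A' x y + poly2 (euler A') x y - of_nat M * poly2 A' x y)"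
      using chart_deriv_poly2[OF ij cpf'(1) A'_eq xy] by (simp add: euler_pCons algebra_simps)
    have db: "(x * y) ^ M * (y * chart_deriv j \<beta> ?s)
        = y * (poly2 B' y x + poly2 (euler B') y x - of_nat M * poly2 B' y x)"
      using chart_deriv_poly2[OF ji cpf'(2) B'_eq xy(2,1)]
      by (simp add: euler_pCons algebra_simps chart_swap[OF ij])
    have "x * y * (chart_deriv i \<alpha> ?s + chart_deriv j \<beta> ?s) = y * \<alpha> ?s + x * \<beta> ?s"
      using dz s torus_S[OF s] unfolding divergence_zero_pair[OF avf ij]
      by (auto simp: comp chart_deriv_restrict0[OF ij s] chart_deriv_restrict0[OF ji s] ij)
    then have "(x * y) ^ M * (x * y * (chart_deriv i \<alpha> ?s + chart_deriv j \<beta> ?s))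
        = (x * y) ^ M * (y * \<alpha> ?s + x * \<beta> ?s)" by simp
    then have "y * ((x * y) ^ M * (x * chart_deriv i \<alpha> ?s)) + x * ((x * y) ^ M * (y * chart_deriv j \<beta> ?s))
        = y * ((x * y) ^ M * \<alpha> ?s) + x * ((x * y) ^ M * \<beta> ?s)"
      by (simp add: algebra_simps)
    then have "x * y * (poly2 A' x y + poly2 (euler A') x y - of_nat M * poly2 A' x y
        + (poly2 B' y x + poly2 (euler B') y x - of_nat M * poly2 B' y x))
        = x * y * (poly2 A' x y + poly2 B x y)"
      unfolding da db A'_eq[OF xy] B_eq[OF xy] by (simp add: algebra_simps)
    then have "poly2 A' x y + poly2 (euler A') x y - of_nat M * poly2 A' x y
        + (poly2 B' y x + poly2 (euler B') y x - of_nat M * poly2 B' y x)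
        = poly2 A' x y + poly2 B x y" using xy by simp
    moreover have "poly2 B' y x = poly2 B x y" by (simp add: B'_def)
    moreover have "poly2 (of_nat M) x y = of_nat M" by (simp add: of_nat_poly)
    ultimately show ?thesis by (simp add: algebra_simps)
  qed
  then have "euler A' + swap_poly2 (euler B') - of_nat M * (A' + B) = 0" by (rule poly2_eq_0)
  then have "coeff (coeff (euler A' + swap_poly2 (euler B') - of_nat M * (A' + B)) k) l = 0" for k l
    by simp
  then have rel: "(of_nat k - of_nat M) * coeff (coeff A l) k + (of_nat l - of_nat M) * coeff (coeff B k) l = 0"
    for k l
    by (simp add: coeff_euler of_nat_poly A'_def B'_def algebra_simps)
  define a b where "a = coeff (coeff A M) M" and "b = coeff (coeff B M) M"
  \<comment> \<open>Where both denominators are nonzero, \<open>rel\<close> makes the two formulas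
    agree; where one vanishes, it makes the corresponding numerator vanish. At k = l = M, the
    constant term of the potential, the value is free and the data a, b remain.\<close>
  define c where "c k l = (if k \<noteq> M then coeff (coeff B k) l / (of_nat k - of_nat M)
    else if l \<noteq> M then - coeff (coeff A l) k / (of_nat l - of_nat M) else 0)" for k l
  obtain L\<^sub>1 L\<^sub>2 where L: "\<And>k l. L\<^sub>1 < l \<Longrightarrow> coeff (coeff A k) l = 0" "\<And>k l. L\<^sub>2 < l \<Longrightarrow> coeff (coeff B k) l = 0"
    using degree_coeff_bound[of A] degree_coeff_bound[of B] by metis
  have "c k l = 0" if "max M (degree B) < k \<or> max L\<^sub>2 (degree A) < l" for k l
    using that L by (auto simp: c_def coeff_eq_0)
  then obtain R where R: "\<And>k l. coeff (coeff R k) l = c k l"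
    using poly2_of_coeffs[of "max M (degree B)" "max L\<^sub>2 (degree A)" c] by metis
  have R_B: "euler R - of_nat M * R = B - monom (monom b M) M"
  proof (intro poly_eqI)
    fix k l
    have "(of_nat k - of_nat M) * c k l = coeff (coeff B k) l - (if k = M \<and> l = M then b else 0)"
      using rel[of k l] by (auto simp: c_def b_def)
    then show "coeff (coeff (euler R - of_nat M * R) k) l = coeff (coeff (B - monom (monom b M) M) k) l"
      by (auto simp: coeff_euler of_nat_poly R algebra_simps)
  qed
  have R_A: "euler (swap_poly2 R) - of_nat M * swap_poly2 R = - A - monom (monom (- a) M) M"
  proof (intro poly_eqI)
    fix l k
    have "(of_nat l - of_nat M) * c k l = - coeff (coeff A l) k + (if k = M \<and> l = M then a else 0)"
      using rel[of k l] by (auto simp: c_def a_def field_simps)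
    then show "coeff (coeff (euler (swap_poly2 R) - of_nat M * swap_poly2 R) l) k
        = coeff (coeff (- A - monom (monom (- a) M) M) l) k"
      by (auto simp: coeff_euler of_nat_poly R algebra_simps)
  qed
  \<comment> \<open>Regularity along x_i = 0 is inherited from beta through B, and along x_j = 0
    from alpha through A.\<close>
  obtain h where h: "complex_polynomial_function h"
    and h_eq: "\<And>x y. x \<noteq> 0 \<Longrightarrow> y \<noteq> 0 \<Longrightarrow> (x * y) ^ M * h (chart i j x y) = poly2 R x y"
    using Laurent_regular[OF ij adapted_euler[OF R_B B] adapted_euler[OF R_A adapted_minus[OF A]]]
    by blast
  have h_eq': "(y * x) ^ M * h (chart j i y x) = poly2 (swap_poly2 R) y x"
    if "x \<noteq> 0" "y \<noteq> 0" for x y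
    using h_eq[OF that] by (simp add: chart_swap[OF ij] mult.commute)
  have poly2_M: "poly2 (euler T) x y - of_nat M * poly2 T x y = poly2 (euler T - of_nat M * T) x y"
    for T x y by (simp add: of_nat_poly)
  show ?thesis
  proof (rule that[OF h, of a b])
    fix s assume "s \<in> torus"
    then obtain x y where xy: "x \<noteq> 0" "y \<noteq> 0" and s: "s = chart i j x y"
      using torus_chart[OF ij] by blast
    have S: "s \<in> S" using torus_S[OF chart_torus[OF ij xy]] s by simp
    have "(x * y) ^ M * (x * chart_deriv i h s) = poly2 B x y - b * (x * y) ^ M"
      using chart_deriv_poly2[OF ij h h_eq xy] unfolding poly2_M R_B s
      by (simp add: poly_monom power_mult_distrib mult_ac)
    from arg_cong[OF this, of "(*) y"]
    have "(x * y) ^ M * (y * (x * chart_deriv i h s)) = y * (poly2 B x y - b * (x * y) ^ M)"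
      by (simp only: mult.left_commute[of y])
    also have "\<dots> = (x * y) ^ M * (\<beta> s - b * y)"
      using B_eq[OF xy] by (simp add: s algebra_simps)
    finally have "y * (x * chart_deriv i h s) = \<beta> s - b * y" using xy by simp
    then show "\<xi> (coordinate S j) s = s $ i * s $ j * chart_deriv i h s + b * s $ j"
      using S ij by (simp add: comp) (simp add: s ij algebra_simps)
    have "(x * y) ^ M * (y * chart_deriv j h s) = a * (x * y) ^ M - poly2 A y x"
      using chart_deriv_poly2[OF ji h h_eq' xy(2,1)] unfolding poly2_M R_A s
      by (simp add: poly_monom power_mult_distrib mult_ac chart_swap[OF ij])
    from arg_cong[OF this, of "(*) x"]
    have "(x * y) ^ M * (x * (y * chart_deriv j h s)) = x * (a * (x * y) ^ M - poly2 A y x)"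
      by (simp only: mult.left_commute[of x])
    also have "\<dots> = (x * y) ^ M * (a * x - \<alpha> s)"
      using A_eq[OF xy] by (simp add: s algebra_simps chart_swap[OF ij])
    finally have "x * (y * chart_deriv j h s) = a * x - \<alpha> s" using xy by simp
    then show "\<xi> (coordinate S i) s = - s $ i * s $ j * chart_deriv j h s + a * s $ i"
      using S ij by (simp add: comp) (simp add: s ij algebra_simps)
  qed
qed

text \<open>If \<open>P i\<close> is nonzero it takes the value 1 at some c, and tangency over that
  simple root forces a = 0. If \<open>P i\<close> = 0 there is no such c, and the scaling field is
  complete.\<close>

lemma log_field_Lie_alg:
  assumes ij: "xy_pair i j" and \<zeta>: "\<zeta> \<in> alg_vector_fields S"
    and \<zeta>_eq: "\<And>s. s \<in> torus \<Longrightarrow> \<zeta> (coordinate S i) s = a * s $ i"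
      "\<And>s. s \<in> torus \<Longrightarrow> \<zeta> (coordinate S j) s = b * s $ j"
  obtains \<kappa> where "\<kappa> \<in> Lie_alg S \<omega>" "\<And>s. s \<in> torus \<Longrightarrow> \<kappa> (coordinate S i) s = a * s $ i"
    "\<And>s. s \<in> torus \<Longrightarrow> \<kappa> (coordinate S j) s = 0"
proof (cases "P i = 0")
  case True
  note ji = xy_pair_sym[OF ij]
  obtain \<kappa> where \<kappa>: "\<kappa> \<in> alg_vector_fields S" "complete_vf S \<kappa>"
    "\<kappa> (coordinate S i) = restrict0 S (\<lambda>s. s $ i)" "\<kappa> (coordinate S j) = restrict0 S (\<lambda>_. 0)"
    using complete_field_linear[OF ij True] by blast
  have "divergence_zero S \<omega> \<kappa>"
    unfolding divergence_zero_pair[OF \<kappa>(1) ij] \<kappa>(3,4)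
    using torus_S by (auto simp: chart_deriv_restrict0[OF ij] chart_deriv_restrict0[OF ji]
        chart_deriv_coord[OF ij] chart_deriv_const)
  then have "vf_scale a \<kappa> \<in> Lie_alg S \<omega>"
    by (intro Lie_alg_closed(3) Lie_alg_incl \<kappa>)
  then show ?thesis
    by (rule that) (auto simp: vf_scale_def \<kappa>(3,4) torus_S)
next
  case False
  have "\<not> constant (poly (P i - 1))"
  proof
    assume "constant (poly (P i - 1))"
    then have "poly (P i - 1) x = poly (P i - 1) 0" for x unfolding constant_def by blast
    then have "\<forall>x. poly (P i) x = 0" by (simp add: P_0)
    with False show False by (simp add: poly_all_0_iff_0)
  qed
  then obtain c where c: "poly (P i) c = 1" using fundamental_theorem_of_algebra by fastforce
  then have c0: "c \<noteq> 0" using P_0 by auto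
  \<comment> \<open>At this point x_j = 0 removes both the b-term and the z-component from
    \<open>avf_relation\<close>, leaving P i'(c) a c = 0. It lies outside the torus, so the values
    of the field are first extended by density.\<close>
  let ?s = "point i j c 0 0"
  have s: "?s \<in> S" using c by (simp add: mem_S[OF ij] ij P_0)
  have ext: "\<zeta> (coordinate S k) s = e * s $ k"
    if "\<And>s. s \<in> torus \<Longrightarrow> \<zeta> (coordinate S k) s = e * s $ k" "s \<in> S" for k e s
  proof -
    have "\<zeta> (coordinate S k) = restrict0 S (\<lambda>s. e * s $ k)"
      using that(1) torus_S by (intro regular_eqI avf_regular \<zeta> regular cpf) auto
    then show ?thesis using that(2) by simp
  qed
  have "poly (pderiv (P i)) c * (a * c) = 0"
    using avf_relation[OF \<zeta> ij s] ext[OF \<zeta>_eq(1) s] ext[OF \<zeta>_eq(2) s]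
    by (simp add: F_eq[OF ij] ij)
  then have "a = 0" using P_simple[OF c] c0 by simp
  then show ?thesis
    using that[OF Lie_alg_closed(1)] by (simp add: vf_zero_def)
qed

lemma AVF_subset_Lie_alg: "AVF S \<omega> \<subseteq> Lie_alg S \<omega>"
proof
  fix \<xi> assume \<xi>: "\<xi> \<in> AVF S \<omega>"
  note ij = xy_pair_12 and ji = xy_pair_21
  obtain h a b where h: "complex_polynomial_function h"
    and pot: "\<And>s. s \<in> torus \<Longrightarrow> \<xi> (coordinate S 1) s = - s $ 1 * s $ 2 * chart_deriv 2 h s + a * s $ 1"
    "\<And>s. s \<in> torus \<Longrightarrow> \<xi> (coordinate S 2) s = s $ 1 * s $ 2 * chart_deriv 1 h s + b * s $ 2"
    using potential[OF ij \<xi>] by blast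
  obtain \<eta> where \<eta>: "\<eta> \<in> Lie_alg S \<omega>" "hamiltonian 1 2 h \<eta>"
    using Lie_hamiltonians_all[OF h] by (auto simp: Lie_hamiltonians_def)
  have avf: "\<xi> \<in> alg_vector_fields S" "\<eta> \<in> alg_vector_fields S"
    using \<xi> Lie_alg_AVF[OF \<eta>(1)] by (auto simp: AVF_def)
  \<comment> \<open>As a difference of two algebraic fields the logarithmic remainder is algebraic
    on all of \<open>S\<close>, which is what excludes nonzero a or b in the presence of
    roots.\<close>
  define \<zeta> where "\<zeta> = vf_add \<xi> (vf_scale (-1) \<eta>)"
  have \<zeta>: "\<zeta> \<in> alg_vector_fields S" unfolding \<zeta>_def by (intro avf_vf_add avf_vf_scale avf)
  have \<zeta>_eq: "\<zeta> (coordinate S 1) s = a * s $ 1" "\<zeta> (coordinate S 2) s = b * s $ 2" if "s \<in> torus" for s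
    using pot[OF that] \<eta>(2) that by (simp_all add: \<zeta>_def vf_add_def vf_scale_def hamiltonian_def)
  obtain \<kappa> where \<kappa>: "\<kappa> \<in> Lie_alg S \<omega>" "\<And>s. s \<in> torus \<Longrightarrow> \<kappa> (coordinate S 1) s = a * s $ 1"
    "\<And>s. s \<in> torus \<Longrightarrow> \<kappa> (coordinate S 2) s = 0"
    using log_field_Lie_alg[OF ij \<zeta> \<zeta>_eq] by blast
  obtain \<mu> where \<mu>: "\<mu> \<in> Lie_alg S \<omega>" "\<And>s. s \<in> torus \<Longrightarrow> \<mu> (coordinate S 2) s = b * s $ 2"
    "\<And>s. s \<in> torus \<Longrightarrow> \<mu> (coordinate S 1) s = 0"
    using log_field_Lie_alg[OF ji \<zeta> \<zeta>_eq(2,1)] by blast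
  have Lie: "vf_add \<eta> (vf_add \<kappa> \<mu>) \<in> Lie_alg S \<omega>"
    by (intro Lie_alg_closed \<eta> \<kappa> \<mu>)
  have "\<xi> = vf_add \<eta> (vf_add \<kappa> \<mu>)"
    using Lie_alg_AVF[OF Lie] \<eta>(2)
    by (intro avf_eqI[OF avf(1) _ ij]) (auto simp: vf_add_def pot \<kappa>(2,3) \<mu>(2,3) hamiltonian_def)
  with Lie show "\<xi> \<in> Lie_alg S \<omega>" by simp
qed

end

text \<open>Differentiation lowers the order of a root by one. The value r(0) = 0 ensures that 1 - r
  is nonzero and, having a root, not constant.\<close>

lemma simple_root_pderiv:
  fixes r :: "complex poly"
  assumes "poly r 0 = 0" and ord: "\<And>a. poly (1 - r) a = 0 \<Longrightarrow> order a (1 - r) = 1" and a: "poly r a = 1"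
  shows "poly (pderiv r) a \<noteq> 0"
proof
  assume d: "poly (pderiv r) a = 0"
  have nz: "1 - r \<noteq> 0" using assms(1) by auto
  have o: "order a (1 - r) = 1" using ord a by simp
  have "pderiv (1 - r) \<noteq> 0"
  proof
    assume "pderiv (1 - r) = 0"
    then obtain c where "1 - r = [:c:]" using pderiv_iszero by blast
    then have "poly (1 - r) a = poly (1 - r) 0" by simp
    then show False using a assms(1) by simp
  qed
  moreover have "order a (1 - r) = Suc (order a (pderiv (1 - r)))"
    using order_pderiv[of "1 - r" a] nz a by simp
  ultimately have "poly (pderiv (1 - r)) a \<noteq> 0" using o by (simp add: order_root)
  then show False using d by (simp add: pderiv_diff)
qed

theorem theorem6:
  fixes p q :: "complex poly" and \<omega> :: "3 two_form"
  assumes "poly p 0 = 0" and "poly q 0 = 0"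
    and "\<And>a. poly (1 - p) a = 0 \<Longrightarrow> order a (1 - p) = 1"
    and "\<And>b. poly (1 - q) b = 0 \<Longrightarrow> order b (1 - q) = 1"
    and "alg_volume_form (surface p q) \<omega>"
    and "extends_torus_form (surface p q) \<omega>"
  shows "alg_volume_density_property (surface p q) \<omega>"
proof -
  interpret surface_with_form p q \<omega>
    by unfold_locales (use assms simple_root_pderiv[of p] simple_root_pderiv[of q] in auto)
  show ?thesis
    unfolding alg_volume_density_property_def
    using AVF_subset_Lie_alg Lie_alg_subset_AVF[OF two_form] by (rule equalityI[rotated])
qed

end
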